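(* Let $d,a,b_1,\dots,b_n,c$ be positive integers with $d\mid q-1$, let $\lambda_1,\dots,\lambda_n\in\kappa^\times$ be distinct and different from $1$, and put $e=|a+\sum_ib_i+c-d|$. Suppose that $e>0$ and $$\gcd(d,a)=\gcd(d,b_i)=\gcd(d,c)=\gcd(d,e)=1\quad\text{for all }i.$$ Let $X_{D,\lambda}$ be the smooth projective model over $\kappa$ of the affine curve $$y^d=\Big(\prod_{i=1}^n(1-\lambda_ix)^{b_i}\Big)x^a(1-x)^c,$$ with its induced action of $\mu_d$. If $m\in\mathbb{Z}/d\mathbb{Z}$ and $m\neq0$, then $L(X_{D,\lambda},\chi^m;t)$ is a polynomial in $t$ of degree $n+1$.
   Context: $\kappa$ is a finite field with $q$ elements, $\mu_d\subset\kappa^\times$ the group of $d$th roots of unity. Fix a generator $\varphi$ of $\widehat{\kappa^\times}=\mathrm{Hom}(\kappa^\times,\overline{\mathbb{Q}}^\times)$ and put $\chi=\varphi|_{\mu_d}$, so $\widehat{\mu_d}=\{\chi^m\mid m\in\mathbb{Z}/d\mathbb{Z}\}$. The group $\mu_d$ acts on the affine curve by $\xi\cdot(x,y)=(x,\xi y)$ and on its projective closure $\overline{C}_{D,\lambda}$ (obtained by homogenizing with $x=X/Z$, $y=Y/Z$) by $\xi\cdot(X:Y:Z)=(X:\xi Y:Z)$; $X_{D,\lambda}\to\overline{C}_{D,\lambda}$ is the desingularization, i.e. the smooth projective curve obtained by normalization, to which the action lifts. For a variety $V$ over $\kappa$ with an action over $\kappa$ of a finite abelian group $G$, with $F$ the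 $q$-Frobenius on $V(\overline{\kappa})$, and for $\theta\in\mathrm{Hom}(G,\overline{\mathbb{Q}}^\times)$ and $r\ge1$, $$N_r(V;\theta)=\frac{1}{\#G}\sum_{g\in G}\theta(g)\,\#\{x\in V(\overline{\kappa})\mid F^r(x)=g(x)\},\qquad L(V,\theta;t)=\exp\Big(\sum_{r=1}^\infty\frac{N_r(V;\theta)}{r}t^r\Big)\in\overline{\mathbb{Q}}[[t]].$$ *)

theory Defs
  imports
    "HOL-Algebra.Algebraic_Closure_Type"
    "HOL-Computational_Algebra.Computational_Algebra"
    "HOL-Library.Cardinality"
begin

section \<open>Characters\<close>

abbreviation mult_group :: "'k::field monoid" where
  "mult_group \<equiv> units_of (ring_of_type_algebra :: 'k ring)"

text \<open>
  \<open>rat alg_closure\<close> is the algebraic closure of the rational numbers. Characters of the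
  multiplicative group are total functions, of which only the values at nonzero arguments matter.
\<close>

definition generates_characters :: "('k::field \<Rightarrow> rat alg_closure) \<Rightarrow> bool" where
  "generates_characters \<phi> \<longleftrightarrow> \<phi> \<in> hom mult_group mult_group \<and>
     (\<forall>\<psi> \<in> hom mult_group mult_group. \<exists>k::int. \<forall>x. x \<noteq> 0 \<longrightarrow> \<psi> x = \<phi> x powi k)"

definition roots_of_unity :: "nat \<Rightarrow> 'k::field set" where
  "roots_of_unity d = {\<xi>. \<xi> ^ d = 1}"


section \<open>Equivariant L-functions\<close>

text \<open>
  Here \<open>V\<close> is the set of geometric points of a variety, \<open>F\<close> the Frobenius on it and \<open>act\<close> the action
  of the finite group with elements \<open>G\<close>.
\<close>

definition N_count ::
  "'p set \<Rightarrow> ('p \<Rightarrow> 'p) \<Rightarrow> 'g set \<Rightarrow> ('g \<Rightarrow> 'p \<Rightarrow> 'p) \<Rightarrow> ('g \<Rightarrow> 'e::field_char_0) \<Rightarrow> nat \<Rightarrow> 'e" where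
  "N_count V F G act \<theta> r =
     1 / of_nat (card G) * (\<Sum>g\<in>G. \<theta> g * of_nat (card {x \<in> V. (F ^^ r) x = act g x}))"

definition L_series ::
  "'p set \<Rightarrow> ('p \<Rightarrow> 'p) \<Rightarrow> 'g set \<Rightarrow> ('g \<Rightarrow> 'p \<Rightarrow> 'p) \<Rightarrow> ('g \<Rightarrow> 'e::field_char_0) \<Rightarrow> 'e fps" where
  "L_series V F G act \<theta> =
     fps_compose (fps_exp 1)
       (Abs_fps (\<lambda>r. if r = 0 then 0 else N_count V F G act \<theta> r / of_nat r))"


section \<open>Plane curves and their projective closure\<close>

text \<open>
  A polynomial in two variables \<open>x\<close>, \<open>y\<close> is an \<open>'a poly poly\<close> with inner variable \<open>x\<close> and outer
  variable \<open>y\<close>. A homogeneous form of degree \<open>N\<close> in \<open>X\<close>, \<open>Y\<close>, \<open>Z\<close> is represented by its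
  dehomogenization, a polynomial of total degree at most \<open>N\<close>; \<open>homog_eval N p\<close> evaluates the form
  \<open>Z ^ N * p (X / Z, Y / Z)\<close>.
\<close>

definition total_degree :: "'a::zero poly poly \<Rightarrow> nat" where
  "total_degree p =
     (LEAST N. \<forall>i j. Polynomial.coeff (Polynomial.coeff p j) i \<noteq> 0 \<longrightarrow> i + j \<le> N)"

definition homog_eval :: "nat \<Rightarrow> 'a::comm_ring_1 poly poly \<Rightarrow> 'a \<times> 'a \<times> 'a \<Rightarrow> 'a" where
  "homog_eval N p = (\<lambda>(u, v, w). \<Sum>j\<le>N. \<Sum>i\<le>N - j.
     Polynomial.coeff (Polynomial.coeff p j) i * u ^ i * v ^ j * w ^ (N - i - j))"

text \<open>A point of the projective plane is the set of all its homogeneous coordinate vectors.\<close>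

definition proj_plane :: "('a::field \<times> 'a \<times> 'a) set set" where
  "proj_plane = {{(s * u, s * v, s * w) | s. s \<noteq> 0} | u v w. (u, v, w) \<noteq> (0, 0, 0)}"

definition rhs_poly ::
  "nat \<Rightarrow> (nat \<Rightarrow> 'k::field) \<Rightarrow> (nat \<Rightarrow> nat) \<Rightarrow> nat \<Rightarrow> nat \<Rightarrow> 'k poly" where
  "rhs_poly n lam b a c = (\<Prod>i = 1..n. [:1, - lam i:] ^ b i) * [:0, 1:] ^ a * [:1, - 1:] ^ c"

definition curve_poly :: "nat \<Rightarrow> 'k::field poly \<Rightarrow> 'k poly poly" where
  "curve_poly d f = [:0, 1:] ^ d - [:f:]"

definition proj_closure ::
  "nat \<Rightarrow> 'k::field poly \<Rightarrow> ('k alg_closure \<times> 'k alg_closure \<times> 'k alg_closure) set set" where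
  "proj_closure d f =
     {P \<in> proj_plane. \<forall>v\<in>P.
        homog_eval (total_degree (curve_poly d f)) (map_poly (map_poly to_ac) (curve_poly d f)) v = 0}"


section \<open>The function field\<close>

text \<open>
  The function field of \<open>y ^ d = f x\<close> over the algebraic closure of the base field is realised as a
  subfield of an algebraic closure of the rational function field in \<open>x\<close>: the element \<open>y_fun d f\<close>
  plays the role of \<open>y\<close>, and \<open>ff_eval p \<eta>\<close> is the value \<open>p (x, \<eta>)\<close>. This is the function field of
  the curve whenever the polynomial \<open>Y ^ d - f\<close> is irreducible over the field of rational functions
  in \<open>x\<close>, and different choices of the root differ by an isomorphism over that field.
\<close>

type_synonym 'k ambient = "'k alg_closure poly fract alg_closure"

definition ff_eval :: "'k::field alg_closure poly poly \<Rightarrow> 'k ambient \<Rightarrow> 'k ambient" where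
  "ff_eval p \<eta> = poly (map_poly (\<lambda>u. to_ac (to_fract u)) p) \<eta>"

definition y_fun :: "nat \<Rightarrow> 'k::field poly \<Rightarrow> 'k ambient" where
  "y_fun d f = (SOME y. y ^ d = to_ac (to_fract (map_poly to_ac f)))"

definition function_field :: "nat \<Rightarrow> 'k::field poly \<Rightarrow> 'k ambient set" where
  "function_field d f =
     {ff_eval p (y_fun d f) / ff_eval r (y_fun d f) | p r. ff_eval r (y_fun d f) \<noteq> 0}"

text \<open>
  The local ring at a point \<open>P\<close> of the projective closure consists of the quotients of homogeneous
  forms of equal degree \<open>N\<close>, the denominator not vanishing at \<open>P\<close>.
\<close>

definition local_ring ::
  "nat \<Rightarrow> 'k::field poly \<Rightarrow> ('k alg_closure \<times> 'k alg_closure \<times> 'k alg_closure) set \<Rightarrow> 'k ambient set"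
where
  "local_ring d f P =
     {ff_eval p (y_fun d f) / ff_eval r (y_fun d f) | p r.
        ff_eval r (y_fun d f) \<noteq> 0 \<and>
        (\<exists>N. total_degree p \<le> N \<and> total_degree r \<le> N \<and> (\<forall>v\<in>P. homog_eval N r v \<noteq> 0))}"


section \<open>Normalization\<close>

definition integral_closure :: "'l::field set \<Rightarrow> 'l set \<Rightarrow> 'l set" where
  "integral_closure A K =
     {h \<in> K. \<exists>p. Polynomial.lead_coeff p = 1 \<and> (\<forall>i. Polynomial.coeff p i \<in> A) \<and> poly p h = 0}"

text \<open>
  The normalization is finite over the projective closure, so its closed points above \<open>P\<close> are the
  maximal ideals of the integral closure, in the function field, of the local ring at \<open>P\<close>.
\<close>

type_synonym 'k curve_point =
  "('k alg_closure \<times> 'k alg_closure \<times> 'k alg_closure) set \<times> 'k ambient set"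

definition smooth_model :: "nat \<Rightarrow> 'k::field poly \<Rightarrow> 'k curve_point set" where
  "smooth_model d f =
     {(P, M). P \<in> proj_closure d f \<and>
        maximalideal M
          (ring_of_type_algebra
             \<lparr>carrier := integral_closure (local_ring d f P) (function_field d f)\<rparr>)}"

text \<open>
  The automorphism \<open>(x, y) \<mapsto> (x, \<xi> y)\<close> of the curve pulls functions back by
  \<open>h (x, y) \<mapsto> h (x, \<xi> y)\<close>; the maximal ideal of the image point consists of the functions
  whose pullback lies in \<open>M\<close>.
\<close>

definition mu_act :: "nat \<Rightarrow> 'k::field poly \<Rightarrow> 'k \<Rightarrow> 'k curve_point \<Rightarrow> 'k curve_point" where
  "mu_act d f \<xi> = (\<lambda>(P, M).
     ((\<lambda>(u, v, w). (u, to_ac \<xi> * v, w)) ` P,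
      (let y = y_fun d f; y' = to_ac (to_fract [:to_ac \<xi>:]) * y
       in {ff_eval p y / ff_eval r y | p r.
             ff_eval r y \<noteq> 0 \<and> ff_eval p y' / ff_eval r y' \<in> M})))"

text \<open>
  On geometric points the \<open>q\<close>-Frobenius of a variety over the base field is the action of the Galois
  automorphism \<open>z \<mapsto> z ^ q\<close>. It acts on the function field through the coefficients, fixing \<open>x\<close>
  and \<open>y\<close>, and a maximal ideal is sent to its image; for example \<open>x - x0\<close> goes to \<open>x - x0 ^ q\<close>.
\<close>

definition frob_coeffs ::
  "nat \<Rightarrow> 'k::field alg_closure poly poly \<Rightarrow> 'k alg_closure poly poly" where
  "frob_coeffs q = map_poly (map_poly (\<lambda>z. z ^ q))"

definition frobenius ::
  "nat \<Rightarrow> 'k::{finite,field} poly \<Rightarrow> 'k curve_point \<Rightarrow> 'k curve_point" where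
  "frobenius d f = (\<lambda>(P, M).
     let q = CARD('k); y = y_fun d f
     in ((\<lambda>(u, v, w). (u ^ q, v ^ q, w ^ q)) ` P,
         {ff_eval (frob_coeffs q p) y / ff_eval (frob_coeffs q r) y | p r.
            ff_eval r y \<noteq> 0 \<and> ff_eval p y / ff_eval r y \<in> M}))"

definition curve_L ::
  "nat \<Rightarrow> 'k::{finite,field} poly \<Rightarrow> ('k \<Rightarrow> rat alg_closure) \<Rightarrow> rat alg_closure fps" where
  "curve_L d f \<theta> =
     L_series (smooth_model d f) (frobenius d f) (roots_of_unity d) (mu_act d f) \<theta>"

end

theory Submission imports Defs "HOL-Algebra.Sylow" begin


text \<open>
  The coefficients \<open>N_r\<close> of the logarithm of the L-series are character sums over the line. Write
  \<open>f x\<close> for the right hand side of the equation, \<open>\<theta>\<close> for the character \<open>\<chi> ^ m\<close> and \<open>k\<close> for the algebraic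
  closure of the base field. Over a geometric point \<open>a\<close> of the line with \<open>f a \<noteq> 0\<close> and
  \<open>a ^ q ^ r = a\<close>, the \<open>d\<close> points of the curve are permuted simply transitively by the group of \<open>d\<close>-th roots of
  unity, and the \<open>r\<close>-th power of the Frobenius multiplies \<open>y\<close> by \<open>f a ^ ((q ^ r - 1) / d)\<close>; so \<open>a\<close> contributes
  the value of \<open>\<theta>\<close> at this root of unity. All other points of the smooth model lie over roots of \<open>f\<close>
  and over infinity. The multiplicities of the roots and the degree of \<open>f\<close> are prime to \<open>d\<close> (for
  the degree this is what \<open>gcd d e = 1\<close> means), so there the curve is totally ramified: the group acts
  trivially on these points, and their contribution is a multiple of the sum of the values of \<open>\<theta>\<close>,
  which is zero. This is \<open>N_count_eq\<close>.

  Two facts about the normalization are needed. At points with \<open>y \<noteq> 0\<close> the local ring is a discrete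
  valuation ring (\<open>unramified_point_normal\<close>). Above a ramified point there is only one
  maximal ideal, which is therefore stable under the group (\<open>maximal_eq\<close>). The latter is
  seen by decomposing an integral element into its eigencomponents \<open>t\<^sub>i * y ^ i\<close> under the group, with
  \<open>t\<^sub>i\<close> in \<open>k(x)\<close>: extended to the function field, the valuation of \<open>k(x)\<close> is not an integer on the
  components with \<open>0 < i < d\<close>, hence positive, so that they vanish at every point above, and only the average over the group matters.

  Let \<open>f x\<close> be the product of the factors \<open>(u\<^sub>j * (\<alpha>\<^sub>j - x)) ^ e\<^sub>j\<close> for \<open>j < s\<close>, where \<open>s = n + 2\<close>. The norm of
  \<open>f a\<close> can be computed from the values at the \<open>\<alpha>\<^sub>j\<close> of the monic polynomial with roots \<open>a ^ q ^ i\<close>, \<open>i < r\<close>.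
  Thus \<open>N_r\<close> is a sum, over these polynomials, of a completely multiplicative function \<open>\<Psi>\<close> on
  monic polynomials, a product of nontrivial characters \<open>\<eta>\<^sub>j\<close> of the values at \<open>\<alpha>\<^sub>j\<close>. Let \<open>c\<^sub>N\<close> be the
  sum of \<open>\<Psi>\<close> over monic polynomials of degree \<open>N\<close>. Counting the Frobenius orbits among the roots of
  each polynomial gives \<open>N * c\<^sub>N = (\<Sum>r=1..N. N_r * c\<^bsub>N - r\<^esub>)\<close> (\<open>monic_sum_recurrence\<close>), which says that the
  L-series is the generating function of the \<open>c\<^sub>N\<close>.

  It remains to see that \<open>c\<^sub>N\<close> vanishes for \<open>N \<ge> s\<close> but not for \<open>N = s - 1 = n + 1\<close>. In degree at
  least \<open>s\<close> the value at one of the \<open>s\<close> points varies freely while the others are fixed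
  (\<open>monic_sum_point_char_eq_0\<close>). In degree \<open>s - 1\<close> Lagrange interpolation turns the sum into a Jacobi
  sum (\<open>monic_sum_point_char_nonzero\<close>). This is nonzero because convolution with a nontrivial
  character is invertible on functions of mean zero and the product of the \<open>\<eta>\<^sub>j\<close> is nontrivial
  (\<open>jacobi_nonzero\<close>).
\<close>

section \<open>Finite fields and their characters\<close>

text \<open>
  The polynomial \<open>Y ^ d - c\<close> is separable: a double root would be a root of its derivative
  \<open>d * Y ^ (d - 1)\<close> and hence zero.
\<close>
lemma card_power_roots:
  fixes c :: "'a :: alg_closed_field"
  assumes "of_nat d \<noteq> (0 :: 'a)" "c \<noteq> 0"
  shows "card {y. y ^ d = c} = d"
proof -
  have d: "d > 0" using assms(1) by (cases d) auto
  define p where "p = monom (1::'a) d - [:c:]"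
  have ev: "poly p y = y ^ d - c" for y by (simp add: p_def poly_monom)
  have deg: "degree p = d"
    proof -
    have "degree p = degree (- [:c:] + monom 1 d)" unfolding p_def by (metis add.commute diff_conv_add_uminus)
    also have "\<dots> = d" using d by (subst degree_add_eq_right) (auto simp: degree_monom_eq)
    finally show ?thesis .
  qed
  have p0: "p \<noteq> 0" using deg d by auto
  obtain A where A: "size A = degree p" "p = smult (lead_coeff p) (\<Prod>x\<in>#A. [:-x, 1:])"
    using alg_closed_imp_factorization[OF p0] by blast
  have cnt: "count A y \<le> 1" for y
  proof (rule ccontr)
    assume "\<not> count A y \<le> 1"
    then have "count A y \<ge> 2" by simp
    then have "{#y,y#} \<subseteq># A"
      by (auto simp: subseteq_mset_def)
    then obtain B where B: "A = B + {#y,y#}" by (metis subset_mset.diff_add)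
    define q where "q = (\<Prod>x\<in>#B. [:-x, 1:])"
    have "p = smult (lead_coeff p) (q * ([:-y,1:] * [:-y,1:]))"
      by (subst A(2), subst B) (simp add: q_def mult_ac del: mult_pCons_left mult_pCons_right)
    then have "p = [:-y,1:]^2 * smult (lead_coeff p) q"
      unfolding power2_eq_square by (metis mult.commute mult_smult_left)
    then obtain r where r: "p = [:-y,1:] * ([:-y,1:] * r)" by (metis mult.assoc power2_eq_square)
    have "poly p y = 0" "poly (pderiv p) y = 0"
      by (simp_all only: r pderiv_mult poly_mult poly_add) simp_all
    moreover have "pderiv p = smult (of_nat d) (monom 1 (d - 1))"
      by (simp add: p_def pderiv_diff pderiv_monom pderiv_pCons smult_monom)
    ultimately have "y ^ d = c" "y ^ (d - 1) = 0"
      using assms by (auto simp: ev poly_monom)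
    then show False using assms(2) d by (cases d) auto
  qed
  have "set_mset A = {y. poly p y = 0}"
    by (subst A(2)) (use p0 in \<open>auto simp: poly_prod_mset prod_mset_zero_iff image_iff\<close>)
  then have sA: "set_mset A = {y. y ^ d = c}" by (simp add: ev)
  have "A = mset_set (set_mset A)"
  proof (rule multiset_eqI)
    fix y
    have "count A y = (if y \<in># A then 1 else 0)"
      using cnt[of y] by (cases "count A y") (auto simp: not_in_iff simp flip: count_greater_zero_iff)
    then show "count A y = count (mset_set (set_mset A)) y" by (simp add: count_mset_set')
  qed
  then have "size A = card (set_mset A)" by (metis size_mset_set)
  then show ?thesis using sA A(1) deg by simp
qed

lemma finite_field_power_card:
  fixes x :: "'k :: {finite,field}"
  shows "x \<noteq> 0 \<Longrightarrow> x ^ (CARD('k) - 1) = 1" "x ^ CARD('k) = x"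
proof -
  have 1: "x ^ (CARD('k) - 1) = 1" if x: "x \<noteq> 0" for x :: 'k
  proof -
    have "bij_betw ((*) x) (UNIV - {0}) (UNIV - {0})"
      by (rule bij_betwI[where g = "\<lambda>y. y / x"]) (use x in auto)
    then have "(\<Prod>y\<in>UNIV-{0}. x * y) = (\<Prod>y\<in>UNIV-{0}. y)"
      by (rule prod.reindex_bij_betw)
    then have "x ^ (CARD('k) - 1) * (\<Prod>y\<in>UNIV-{0}. y) = 1 * (\<Prod>y\<in>UNIV-{0::'k}. y)"
      by (simp add: prod.distrib card_Diff_singleton)
    then show ?thesis by (subst (asm) mult_cancel_right) auto
  qed
  show "x \<noteq> 0 \<Longrightarrow> x ^ (CARD('k) - 1) = 1" by (fact 1)
  have "CARD('k) = Suc (CARD('k) - 1)" by simp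
  then show "x ^ CARD('k) = x" using 1[of x] by (cases "x = 0") (metis power_0_left mult_zero_left power_Suc, metis power_Suc mult.right_neutral)
qed

text \<open>
  By Sylow's theorem a prime divisor of the order of the additive group is the order of a subgroup, so it kills
  a nonzero element and must be the characteristic.
\<close>
lemma card_field_eq_char_power: "\<exists>n. CARD('k::{finite,field}) = CHAR('k) ^ n"
proof -
  have "p = CHAR('k)" if p: "prime p" "p dvd CARD('k)" for p
  proof -
    interpret R: ring "ring_of_type_algebra :: 'k ring" by (rule ring_from_type_algebra)
    let ?G = "add_monoid (ring_of_type_algebra :: 'k ring)"
    have ord: "Coset.order ?G = p ^ 1 * (CARD('k) div p)"
      using p by (simp add: order_def Coset.order_def ring_of_type_algebra_def)
    obtain H where H: "subgroup H ?G" "card H = p ^ 1"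
      using sylow_thm[OF p(1) R.add.is_group ord] by (auto simp: ring_of_type_algebra_def)
    have "H \<noteq> {0}" using H p by (auto simp: prime_nat_iff)
    moreover have "0 \<in> H" using subgroup.one_closed[OF H(1)] by (simp add: ring_of_type_algebra_def)
    ultimately obtain x where x: "x \<in> H" "x \<noteq> 0" by blast
    have nsm: "y [^]\<^bsub>?G\<^esub> (n::nat) = of_nat n * y" for y :: 'k and n
      by (induction n) (simp_all add: nat_pow_def ring_of_type_algebra_def algebra_simps)
    interpret HG: group "?G\<lparr>carrier := H\<rparr>" using subgroup.subgroup_is_group[OF H(1) R.add.is_group] .
    have "x [^]\<^bsub>?G\<lparr>carrier := H\<rparr>\<^esub> Coset.order (?G\<lparr>carrier := H\<rparr>) = 0"
      using HG.pow_order_eq_1[of x] x by (simp add: ring_of_type_algebra_def)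
    then have "x [^]\<^bsub>?G\<^esub> p = 0"
      using H by (simp add: Coset.order_def nat_pow_def)
    then have "of_nat p = (0::'k)" using nsm x by simp
    then have "CHAR('k) dvd p" by (simp add: of_nat_eq_0_iff_char_dvd)
    then show ?thesis using p(1) by (metis CHAR_not_1' One_nat_def prime_nat_iff)
  qed
  then have *: "\<forall>p\<in>#prime_factorization CARD('k). p = CHAR('k)" by (auto simp: in_prime_factors_iff)
  have "CARD('k) = prod_mset (prime_factorization CARD('k))"
    by (simp add: prod_mset_prime_factorization)
  moreover have "\<exists>n. M = replicate_mset n y" if "\<forall>p\<in>#M. p = y" for M :: "nat multiset" and y
    using that by (induction M) (auto, metis replicate_mset_Suc)
  ultimately show ?thesis using * by (metis prod_mset_replicate_mset)
qed

lemma frobenius_add: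
  fixes x y :: "'k::{finite,field} alg_closure"
  shows "(x + y) ^ CARD('k) = x ^ CARD('k) + y ^ CARD('k)"
proof -
  obtain n where n: "CARD('k) = CHAR('k) ^ n" using card_field_eq_char_power by blast
  show ?thesis using freshmans_dream'[of "CARD('k)" n x y] n prime_CHAR_semidom[where 'a = 'k] finite_imp_CHAR_pos[where 'a = 'k]
    by simp
qed

lemma frobenius_fixed_iff:
  fixes x :: "'k::{finite,field} alg_closure"
  shows "x ^ CARD('k) = x \<longleftrightarrow> x \<in> range to_ac"
proof
  assume "x \<in> range to_ac"
  then show "x ^ CARD('k) = x" using finite_field_power_card(2) by (metis imageE to_ac_power)
next
  assume x: "x ^ CARD('k) = x"
  define p where "p = - [:0, 1:] + monom (1::'k alg_closure) CARD('k)"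
  have "card {0,1::'k} \<le> CARD('k)" by (intro card_mono) auto
  then have q2: "CARD('k) > 1" by simp
  have deg: "degree p = CARD('k)"
    unfolding p_def using q2 by (subst degree_add_eq_right) (auto simp: degree_monom_eq)
  have p0: "p \<noteq> 0" using deg q2 by auto
  have ev: "poly p z = z ^ CARD('k) - z" for z by (simp add: p_def poly_monom)
  let ?R = "range (to_ac :: 'k \<Rightarrow> _)"
  have sub: "?R \<subseteq> {z. poly p z = 0}"
    using finite_field_power_card(2) by (auto simp: ev simp flip: to_ac_power)
  have fin: "finite {z. poly p z = 0}" using p0 poly_roots_finite by blast
  have "card {z. poly p z = 0} \<le> CARD('k)" using card_poly_roots_bound[OF p0] deg by simp
  moreover have "card ?R = CARD('k)" by (simp add: card_image inj_to_ac)
  ultimately have "?R = {z. poly p z = 0}" using card_seteq[OF fin sub] by simp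
  then show "x \<in> range to_ac" using x ev by auto
qed

lemma finite_field_generator:
  obtains g :: "'k::{finite,field}" where "g \<noteq> 0" "\<And>x. x \<noteq> 0 \<Longrightarrow> \<exists>i. x = g ^ i"
    "\<And>i. g ^ i = 1 \<longleftrightarrow> CARD('k) - 1 dvd i"
proof -
  let ?R = "ring_of_type_algebra :: 'k ring"
  interpret R: Ring.field ?R by (rule field_from_type_algebra)
  have pw: "y [^]\<^bsub>?R\<^esub> (n::nat) = y ^ n" for y :: 'k and n
    by (induction n) (simp_all add: nat_pow_def ring_of_type_algebra_def algebra_simps)
  have car: "carrier (Multiplicative_Group.mult_of ?R) = UNIV - {0}" by (simp add: ring_of_type_algebra_def)
  have "finite (carrier ?R)" by (simp add: ring_of_type_algebra_def)
  from R.finite_field_mult_group_has_gen[OF this]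
  have "\<exists>a\<in>UNIV - {0}. UNIV - {0::'k} = {a ^ i | i::nat. i \<in> UNIV}"
    unfolding car pw .
  then obtain g :: 'k where g: "g \<in> UNIV - {0}" "UNIV - {0} = {g ^ i | i::nat. i \<in> UNIV}"
    by (rule bexE)
  have gen: "\<exists>i. x = g ^ i" if "x \<noteq> 0" for x
  proof -
    have "x \<in> {g ^ i | i::nat. i \<in> UNIV}" using that unfolding g(2)[symmetric] by simp
    then show ?thesis by auto
  qed
  have g: "g \<noteq> 0" using g(1) by simp
  have ord: "CARD('k) - 1 dvd i" if i: "g ^ i = 1" for i
  proof (rule ccontr)
    assume nd: "\<not> CARD('k) - 1 dvd i"
    define r where "r = i mod (CARD('k) - 1)"
    have r: "r > 0" using nd unfolding r_def by (simp only: mod_greater_zero_iff_not_dvd not_False_eq_True)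
    have "card {0,1::'k} \<le> CARD('k)" by (intro card_mono) auto
    then have rl: "r < CARD('k) - 1" by (simp add: r_def)
    have "g ^ i = (g ^ (CARD('k) - 1)) ^ (i div (CARD('k) - 1)) * g ^ r"
      unfolding r_def by (metis mult_div_mod_eq power_add power_mult)
    then have gr: "g ^ r = 1" using i finite_field_power_card(1)[OF g] by simp
    have "UNIV - {0} \<subseteq> (\<lambda>j. g ^ j) ` {..<r}"
    proof
      fix x :: 'k assume "x \<in> UNIV - {0}"
      then obtain j where "x = g ^ j" using gen by auto
      also have "g ^ j = (g ^ r) ^ (j div r) * g ^ (j mod r)"
        by (metis mult_div_mod_eq power_add power_mult)
      finally show "x \<in> (\<lambda>j. g ^ j) ` {..<r}" using gr r by auto
    qed
    then have "card (UNIV - {0::'k}) \<le> card ((\<lambda>j. g ^ j) ` {..<r})" by (intro card_mono) auto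
    also have "\<dots> \<le> r" using card_image_le[of "{..<r}"] by simp
    finally show False using rl by (simp add: card_Diff_singleton)
  qed
  have "g ^ i = 1 \<longleftrightarrow> CARD('k) - 1 dvd i" for i
    using ord finite_field_power_card(1)[OF g] by (auto simp: power_mult)
  then show ?thesis using that g gen by blast
qed

lemma Units_of_type_algebra: "Units (ring_of_type_algebra :: 'b::field ring) = UNIV - {0}"
  by (auto simp: Units_def ring_of_type_algebra_def) (metis mult.commute right_inverse)

lemma mult_group_hom_iff:
  fixes \<phi> :: "'k::field \<Rightarrow> 'e::field"
  shows "\<phi> \<in> hom mult_group mult_group \<longleftrightarrow>
    (\<forall>x. x \<noteq> 0 \<longrightarrow> \<phi> x \<noteq> 0) \<and> (\<forall>x y. x \<noteq> 0 \<longrightarrow> y \<noteq> 0 \<longrightarrow> \<phi> (x * y) = \<phi> x * \<phi> y)"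
  using Units_of_type_algebra[where 'b = 'k] Units_of_type_algebra[where 'b = 'e]
  by (auto simp: hom_def units_of_def ring_of_type_algebra_def Pi_def)

text \<open>
  The value of a generating character at a generator \<open>g\<close> of the multiplicative group is a primitive
  root of unity. Every root of unity \<open>z\<close> of order dividing \<open>q - 1\<close> is the value at
  \<open>g\<close> of some character, hence a power of \<open>\<phi> g\<close>; if \<open>\<phi> g\<close> had a
  smaller order \<open>r\<close>, there would be \<open>q - 1\<close> roots of unity of order dividing
  \<open>r\<close>.
\<close>
lemma generating_character_order:
  fixes \<phi> :: "'k::{finite,field} \<Rightarrow> rat alg_closure"
  assumes \<phi>: "generates_characters \<phi>"
    and g: "g \<noteq> 0" "\<And>x. x \<noteq> 0 \<Longrightarrow> \<exists>i. x = g ^ i" "\<And>i. g ^ i = 1 \<longleftrightarrow> CARD('k) - 1 dvd i"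
    and k: "\<phi> g ^ k = 1"
  shows "CARD('k) - 1 dvd k"
proof (rule ccontr)
  assume nd: "\<not> ?thesis"
  let ?n = "CARD('k) - 1"
  have hom: "\<And>x. x \<noteq> 0 \<Longrightarrow> \<phi> x \<noteq> 0" "\<And>x y. x \<noteq> 0 \<Longrightarrow> y \<noteq> 0 \<Longrightarrow> \<phi> (x * y) = \<phi> x * \<phi> y"
    using \<phi> by (auto simp: generates_characters_def mult_group_hom_iff)
  have "\<phi> 1 * \<phi> 1 = \<phi> 1" using hom(2)[of 1 1] by simp
  then have one: "\<phi> 1 = 1" using hom(1)[of 1] by simp
  have pw: "\<phi> (g ^ i) = \<phi> g ^ i" for i
    by (induction i) (use hom g one in auto)
  define r where "r = k mod ?n"
  have r: "r > 0" using nd unfolding r_def by (simp only: mod_greater_zero_iff_not_dvd not_False_eq_True)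
  have "card {0,1::'k} \<le> CARD('k)" by (intro card_mono) auto
  then have n0: "?n > 0" by simp
  then have rl: "r < ?n" by (simp add: r_def)
  have "\<phi> g ^ k = (\<phi> g ^ ?n) ^ (k div ?n) * \<phi> g ^ r"
    unfolding r_def by (metis mult_div_mod_eq power_add power_mult)
  moreover have "\<phi> g ^ ?n = 1" using g(3)[of ?n] one by (simp flip: pw)
  ultimately have gr: "\<phi> g ^ r = 1" using k by simp
  have "{z :: rat alg_closure. z ^ ?n = 1} \<subseteq> {z. z ^ r = 1}"
  proof safe
    fix z :: "rat alg_closure" assume z: "z ^ ?n = 1"
    have z0: "z \<noteq> 0" using z n0 by (auto simp: power_0_left)
    \<comment> \<open>Discrete logarithm with base \<open>g\<close>.\<close>
    define lg where "lg x = (SOME i. x = g ^ i)" for x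
    have lg: "g ^ lg x = x" if "x \<noteq> 0" for x
      unfolding lg_def using someI_ex[OF g(2)[OF that]] by simp
    have eq: "z ^ i = z ^ j" if ij: "g ^ i = g ^ j" for i j
    proof -
      have "z ^ i = z ^ j" if "g ^ i = g ^ j" "i \<le> j" for i j
      proof -
        have "g ^ j = g ^ i * g ^ (j - i)" using that(2) by (simp flip: power_add)
        then have "g ^ (j - i) = 1" using that(1) g(1) by simp
        then obtain l where "j - i = ?n * l" using g(3) by blast
        then have "z ^ (j - i) = 1" using z by (simp add: power_mult)
        then show ?thesis using that(2) by (metis le_add_diff_inverse mult.right_neutral power_add)
      qed
      then show ?thesis using ij by (metis nle_le)
    qed
    define \<psi> where "\<psi> x = z ^ lg x" for x
    have "\<psi> \<in> hom mult_group mult_group"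
      unfolding mult_group_hom_iff \<psi>_def
    proof (intro conjI allI impI)
      fix x y :: 'k assume "x \<noteq> 0" "y \<noteq> 0"
      then have "g ^ lg (x * y) = g ^ (lg x + lg y)" by (simp add: lg power_add)
      then show "z ^ lg (x * y) = z ^ lg x * z ^ lg y" using eq by (metis power_add)
    qed (use z0 in auto)
    then obtain l where "\<psi> g = \<phi> g powi l" using \<phi> g(1) unfolding generates_characters_def by blast
    moreover have "\<psi> g = z" using eq[of "lg g" 1] lg[OF g(1)] by (simp add: \<psi>_def)
    ultimately have "z ^ r = (\<phi> g ^ r) powi l" by (metis power_int_mult mult.commute power_int_of_nat)
    then show "z ^ r = 1" using gr by simp
  qed
  moreover have "finite {z :: rat alg_closure. z ^ r = 1}"
    using card_power_roots[of r "1 :: rat alg_closure"] r by (intro card_ge_0_finite) auto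
  ultimately have "card {z :: rat alg_closure. z ^ ?n = 1} \<le> card {z :: rat alg_closure. z ^ r = 1}"
    by (intro card_mono)
  moreover have "card {z :: rat alg_closure. z ^ ?n = 1} = ?n"
    by (rule card_power_roots) (use n0 in \<open>auto simp del: of_nat_diff\<close>)
  moreover have "card {z :: rat alg_closure. z ^ r = 1} = r"
    by (rule card_power_roots) (use r in auto)
  ultimately show False using rl by linarith
qed

lemma of_nat_dvd_card_nonzero:
  assumes "d dvd CARD('k::{finite,field}) - 1"
  shows "of_nat d \<noteq> (0 :: 'k alg_closure)"
proof
  assume "of_nat d = (0 :: 'k alg_closure)"
  then have "CHAR('k) dvd d" by (simp add: of_nat_eq_0_iff_char_dvd)
  then have 1: "CHAR('k) dvd CARD('k) - 1" using assms dvd_trans by blast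
  have "of_nat CARD('k) = (0::'k)"
  proof -
    have "(\<Sum>x\<in>UNIV. x + 1) = (\<Sum>x\<in>UNIV. x :: 'k)"
      by (rule sum.reindex_bij_witness[where i = "\<lambda>x. x - 1" and j = "\<lambda>x. x + 1"]) auto
    then show ?thesis by (simp add: sum.distrib)
  qed
  then have "CHAR('k) dvd CARD('k)" by (simp add: of_nat_eq_0_iff_char_dvd)
  then have "CHAR('k) dvd CARD('k) - (CARD('k) - 1)" using 1 by (rule dvd_diff_nat)
  then have "CHAR('k) dvd 1" by simp
  then show False by (metis CHAR_not_1' dvd_1_iff_1 One_nat_def)
qed

text \<open>
  A root of unity of order dividing \<open>q - 1\<close> is fixed by the Frobenius.
\<close>
lemma power_dvd_card_in_range:
  fixes y :: "'k::{finite,field} alg_closure"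
  assumes "d dvd CARD('k) - 1" "y ^ d = 1"
  shows "\<exists>\<xi>\<in>roots_of_unity d. y = to_ac \<xi>"
proof -
  obtain l where "CARD('k) - 1 = d * l" using assms(1) by blast
  then have "y ^ (CARD('k) - 1) = 1" using assms(2) by (simp add: power_mult)
  moreover have "CARD('k) = Suc (CARD('k) - 1)" by simp
  ultimately have "y ^ CARD('k) = y" by (metis mult.right_neutral power_Suc)
  then obtain \<xi> where \<xi>: "y = to_ac \<xi>" using frobenius_fixed_iff by blast
  then have "to_ac (\<xi> ^ d) = to_ac 1" using assms(2) by simp
  then have "\<xi> ^ d = 1" by (simp only: to_ac_eq_iff)
  then show ?thesis using \<xi> by (auto simp: roots_of_unity_def)
qed

lemma roots_of_unity_alg_closure:
  assumes "d dvd CARD('k::{finite,field}) - 1"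
  shows "{y. y ^ d = 1} = (to_ac :: 'k \<Rightarrow> _) ` roots_of_unity d"
  using power_dvd_card_in_range[OF assms] by (auto simp: roots_of_unity_def simp flip: to_ac_power)

lemma card_roots_of_unity:
  assumes "d dvd CARD('k::{finite,field}) - 1"
  shows "card (roots_of_unity d :: 'k set) = d"
proof -
  have "card ((to_ac :: 'k \<Rightarrow> _) ` roots_of_unity d) = d"
    using card_power_roots[OF of_nat_dvd_card_nonzero[OF assms], of 1]
    by (simp flip: roots_of_unity_alg_closure[OF assms])
  then show ?thesis by (simp add: card_image inj_on_subset[OF inj_to_ac])
qed

section \<open>Jacobi sums\<close>

definition mult_char :: "('k::field \<Rightarrow> 'e::field) \<Rightarrow> bool" where
  "mult_char \<eta> \<longleftrightarrow> \<eta> 0 = 0 \<and> \<eta> 1 = 1 \<and> (\<forall>x y. \<eta> (x * y) = \<eta> x * \<eta> y)"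

lemma mult_char_power: "mult_char \<eta> \<Longrightarrow> \<eta> (x ^ k) = \<eta> x ^ k"
  by (induction k) (auto simp: mult_char_def)

lemma mult_char_pow: "mult_char \<eta> \<Longrightarrow> k > 0 \<Longrightarrow> mult_char (\<lambda>x. \<eta> x ^ k)"
  by (auto simp: mult_char_def power_mult_distrib)

lemma mult_char_prod: "mult_char \<eta> \<Longrightarrow> \<eta> (\<Prod>i\<in>A. f i) = (\<Prod>i\<in>A. \<eta> (f i))"
  by (induction A rule: infinite_finite_induct) (auto simp: mult_char_def)

lemma mult_char_nonzero: "mult_char \<eta> \<Longrightarrow> x \<noteq> 0 \<Longrightarrow> \<eta> x \<noteq> 0"
  by (metis mult_char_def mult_zero_left right_inverse zero_neq_one)

lemma sum_mult_char:
  fixes \<eta> :: "'k::{finite,field} \<Rightarrow> 'e::field"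
  assumes "mult_char \<eta>" "z \<noteq> 0" "\<eta> z \<noteq> 1"
  shows "(\<Sum>x\<in>UNIV. \<eta> x) = 0"
proof -
  have "bij_betw ((*) z) UNIV UNIV"
    by (rule bij_betwI[where g = "\<lambda>y. y / z"]) (use assms in auto)
  then have "(\<Sum>x\<in>UNIV. \<eta> (z * x)) = (\<Sum>x\<in>UNIV. \<eta> x)"
    by (rule sum.reindex_bij_betw)
  then have "\<eta> z * (\<Sum>x\<in>UNIV. \<eta> x) = (\<Sum>x\<in>UNIV. \<eta> x)"
    using assms(1) by (simp add: mult_char_def sum_distrib_left)
  then show ?thesis using assms(3) by simp
qed

text \<open>
  Convolution of \<open>h\<close> with the multiplicative character \<open>\<eta>\<close>, rescaled by
  \<open>c\<close>, on the additive group.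
\<close>
definition char_conv :: "('k::{finite,field} \<Rightarrow> 'e::field) \<Rightarrow> 'k \<Rightarrow> ('k \<Rightarrow> 'e) \<Rightarrow> 'k \<Rightarrow> 'e" where
  "char_conv \<eta> c h t = (\<Sum>x\<in>UNIV. \<eta> x * h (t - c * x))"

lemma sum_translate:
  fixes h :: "'k::{finite,field} \<Rightarrow> 'e::comm_monoid_add"
  assumes "c \<noteq> 0"
  shows "(\<Sum>z\<in>UNIV. h (t - c * z)) = (\<Sum>z\<in>UNIV. h z)"
  by (rule sum.reindex_bij_witness[where i = "\<lambda>y. (t - y) / c" and j = "\<lambda>z. t - c * z"])
     (use assms in auto)

lemma sum_char_conv:
  assumes "c \<noteq> 0" "(\<Sum>z\<in>UNIV. h z) = 0"
  shows "(\<Sum>t\<in>UNIV. char_conv \<eta> c h t) = 0"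
proof -
  have "(\<Sum>t\<in>UNIV. char_conv \<eta> c h t) = (\<Sum>x\<in>UNIV. \<eta> x * (\<Sum>t\<in>UNIV. h (t - c * x)))"
    unfolding char_conv_def by (subst sum.swap) (simp add: sum_distrib_left)
  also have "(\<lambda>x. \<Sum>t\<in>UNIV. h (t - c * x)) = (\<lambda>x. 0)"
  proof
    fix x
    have "(\<Sum>t\<in>UNIV. h (t - c * x)) = (\<Sum>z\<in>UNIV. h z)"
      by (rule sum.reindex_bij_witness[where i = "\<lambda>y. y + c * x" and j = "\<lambda>z. z - c * x"]) auto
    then show "(\<Sum>t\<in>UNIV. h (t - c * x)) = 0" using assms by simp
  qed
  finally show ?thesis by simp
qed

text \<open>
  On functions of mean zero the convolution with a nontrivial character is invertible: convolving back with the
  inverse character produces the kernel \<open>K z = (\<Sum>y\<in>UNIV - {0}. \<eta> (1 + z / y))\<close>, which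
  is \<open>q - 1\<close> at \<open>z = 0\<close> and \<open>- 1\<close> elsewhere.
\<close>
lemma char_conv_inverse:
  fixes h :: "'k::{finite,field} \<Rightarrow> 'e::field"
  assumes \<eta>: "mult_char \<eta>" "z \<noteq> 0" "\<eta> z \<noteq> 1" and c: "c \<noteq> 0" and h: "(\<Sum>z\<in>UNIV. h z) = 0"
  shows "(\<Sum>y\<in>UNIV. inverse (\<eta> y) * char_conv \<eta> c h (t + c * y)) = of_nat CARD('k) * h t"
proof -
  define K where "K z = (\<Sum>y\<in>UNIV. inverse (\<eta> y) * \<eta> (y + z))" for z
  have K0: "K 0 = of_nat (CARD('k) - 1)"
  proof -
    have "K 0 = (\<Sum>y\<in>UNIV. if y = (0::'k) then 0 else 1)"
      unfolding K_def using \<eta>(1) mult_char_nonzero[OF \<eta>(1)] by (intro sum.cong) (auto simp: mult_char_def)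
    also have "\<dots> = (\<Sum>y\<in>UNIV-{0::'k}. 1)" by (intro sum.mono_neutral_cong_right) auto
    finally show ?thesis by (simp add: card_Diff_singleton)
  qed
  have K1: "K z = - 1" if z: "z \<noteq> 0" for z
  proof -
    have "K z = (\<Sum>y\<in>UNIV-{0}. \<eta> (1 + z / y))"
      unfolding K_def
    proof (intro sum.mono_neutral_cong_right ballI)
      fix y :: 'k assume "y \<in> UNIV - {0}"
      then have "y + z = y * (1 + z / y)" "\<eta> y \<noteq> 0"
        using mult_char_nonzero[OF \<eta>(1)] by (auto simp: field_simps)
      then show "inverse (\<eta> y) * \<eta> (y + z) = \<eta> (1 + z / y)"
        using \<eta>(1) by (simp add: mult_char_def)
    qed (use \<eta>(1) in \<open>auto simp: mult_char_def\<close>)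
    also have "\<dots> = (\<Sum>w\<in>UNIV-{1}. \<eta> w)"
      by (rule sum.reindex_bij_witness[where i = "\<lambda>w. z / (w - 1)" and j = "\<lambda>y. 1 + z / y"])
         (use z in auto)
    also have "\<dots> = (\<Sum>w\<in>UNIV. \<eta> w) - \<eta> 1"
      by (simp add: sum_diff1)
    finally show ?thesis using sum_mult_char[OF \<eta>] \<eta>(1) by (simp add: mult_char_def)
  qed
  have "(\<Sum>y\<in>UNIV. inverse (\<eta> y) * char_conv \<eta> c h (t + c * y))
      = (\<Sum>y\<in>UNIV. \<Sum>z\<in>UNIV. inverse (\<eta> y) * \<eta> (y + z) * h (t - c * z))"
  proof (rule sum.cong)
    fix y :: 'k
    have "char_conv \<eta> c h (t + c * y) = (\<Sum>z\<in>UNIV. \<eta> (y + z) * h (t - c * z))"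
      unfolding char_conv_def
      by (rule sum.reindex_bij_witness[where i = "\<lambda>z. y + z" and j = "\<lambda>x. x - y"])
         (auto simp: algebra_simps)
    then show "inverse (\<eta> y) * char_conv \<eta> c h (t + c * y) = (\<Sum>z\<in>UNIV. inverse (\<eta> y) * \<eta> (y + z) * h (t - c * z))"
      by (simp add: sum_distrib_left mult.assoc)
  qed simp
  also have "\<dots> = (\<Sum>z\<in>UNIV. K z * h (t - c * z))"
    unfolding K_def by (subst sum.swap) (simp add: sum_distrib_right)
  also have "\<dots> = K 0 * h t + (\<Sum>z\<in>UNIV-{0}. K z * h (t - c * z))"
    by (subst sum.remove[of _ 0]) auto
  also have "(\<Sum>z\<in>UNIV-{0}. K z * h (t - c * z)) = - (\<Sum>z\<in>UNIV-{0}. h (t - c * z))"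
    using K1 by (simp add: sum_negf)
  also have "(\<Sum>z\<in>UNIV-{0}. h (t - c * z)) = (\<Sum>z\<in>UNIV. h (t - c * z)) - h t"
    by (simp add: sum_diff1)
  finally have "(\<Sum>y\<in>UNIV. inverse (\<eta> y) * char_conv \<eta> c h (t + c * y)) = of_nat (CARD('k) - 1) * h t + h t"
    using K0 sum_translate[OF c, of h t] h by simp
  also have "\<dots> = of_nat (Suc (CARD('k) - 1)) * h t" by (simp add: algebra_simps)
  finally show ?thesis by simp
qed

text \<open>
  Generalised Jacobi sum, as a function of the value \<open>t\<close> of a linear form with coefficients
  \<open>c\<close>.
\<close>
definition jacobi :: "(nat \<Rightarrow> 'k \<Rightarrow> 'e) \<Rightarrow> (nat \<Rightarrow> 'k) \<Rightarrow> nat \<Rightarrow> 'k::{finite,field} \<Rightarrow> 'e::field" where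
  "jacobi \<eta> c s t = (\<Sum>v | v \<in> PiE {..<s} (\<lambda>_. UNIV) \<and> (\<Sum>j<s. c j * v j) = t. \<Prod>j<s. \<eta> j (v j))"

lemma jacobi_Suc: "jacobi \<eta> c (Suc s) = char_conv (\<eta> s) (c s) (jacobi \<eta> c s)"
proof
  fix t
  let ?P = "PiE {..<s} (\<lambda>_. UNIV :: 'a set)"
  have fin: "finite ?P" by (intro finite_PiE) auto
  have "char_conv (\<eta> s) (c s) (jacobi \<eta> c s) t
     = (\<Sum>x\<in>UNIV. \<Sum>v | v \<in> ?P \<and> (\<Sum>j<s. c j * v j) = t - c s * x. \<eta> s x * (\<Prod>j<s. \<eta> j (v j)))"
    by (simp add: char_conv_def jacobi_def sum_distrib_left)
  also have "\<dots> = (\<Sum>(x,v)\<in>(SIGMA x:UNIV. {v \<in> ?P. (\<Sum>j<s. c j * v j) = t - c s * x}). \<eta> s x * (\<Prod>j<s. \<eta> j (v j)))"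
    using fin by (subst sum.Sigma) auto
  also have "\<dots> = jacobi \<eta> c (Suc s) t"
    unfolding jacobi_def
    by (rule sum.reindex_bij_witness[where j = "\<lambda>(x,v). v(s := x)" and i = "\<lambda>v. (v s, restrict v {..<s})"])
       (auto simp: PiE_def extensional_def fun_eq_iff algebra_simps restrict_def intro!: prod.cong sum.cong)
  finally show "jacobi \<eta> c (Suc s) t = char_conv (\<eta> s) (c s) (jacobi \<eta> c s) t" by simp
qed

text \<open>
  Being an iterated invertible convolution, the Jacobi sum does not vanish identically in \<open>t\<close>. It
  is homogeneous in \<open>t\<close> for the product of the characters; as this product is nontrivial, the value
  at \<open>0\<close> vanishes and the values at nonzero arguments vanish together.
\<close>
lemma jacobi_nonzero:
  fixes \<eta> :: "nat \<Rightarrow> 'k::{finite,field} \<Rightarrow> 'e::field_char_0"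
  assumes \<eta>: "\<And>j. j < s \<Longrightarrow> mult_char (\<eta> j)" "\<And>j. j < s \<Longrightarrow> \<exists>z. z \<noteq> 0 \<and> \<eta> j z \<noteq> 1"
    and c: "\<And>j. j < s \<Longrightarrow> c j \<noteq> 0" and s: "s > 0"
    and tot: "z \<noteq> 0" "(\<Prod>j<s. \<eta> j z) \<noteq> 1"
  shows "jacobi \<eta> c s 1 \<noteq> 0"
proof -
  \<comment> \<open>The mean zero condition is part of the induction, because the inversion of the convolution
    needs it.\<close>
  have *: "(\<Sum>t\<in>UNIV. jacobi \<eta> c k t) = 0 \<and> (\<exists>t. jacobi \<eta> c k t \<noteq> 0)" if "k > 0" "k \<le> s" for k
    using that
  proof (induction k)
    case (Suc k)
    obtain z where z: "z \<noteq> 0" "\<eta> k z \<noteq> 1" using \<eta>(2)[of k] Suc.prems by auto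
    show ?case
    proof (cases "k = 0")
      case True
      have j0: "jacobi \<eta> c 0 t = (if t = 0 then 1 else 0)" for t
      proof -
        have "{v. v = (\<lambda>x. undefined) \<and> 0 = t} = (if t = 0 then {\<lambda>x. undefined :: 'k} else {})" by auto
        then show ?thesis by (simp add: jacobi_def)
      qed
      have j1: "jacobi \<eta> c (Suc k) t = \<eta> k (t / c k)" for t
      proof -
        have "jacobi \<eta> c (Suc k) t = (\<Sum>x\<in>{t / c k}. \<eta> k x)"
          unfolding jacobi_Suc char_conv_def True j0 
          by (rule sum.mono_neutral_cong_right) (use c[of 0] s in \<open>auto simp: field_simps\<close>)
        then show ?thesis by simp
      qed
      have "(\<Sum>t\<in>UNIV. \<eta> k (t / c k)) = (\<Sum>t\<in>UNIV. \<eta> k t)"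
        by (rule sum.reindex_bij_witness[where i = "\<lambda>t. t * c k" and j = "\<lambda>t. t / c k"])
           (use c[of k] Suc.prems in auto)
      then have "(\<Sum>t\<in>UNIV. jacobi \<eta> c (Suc k) t) = 0"
        using sum_mult_char[OF \<eta>(1) z] Suc.prems j1 by simp
      moreover have "jacobi \<eta> c (Suc k) (c k) \<noteq> 0"
        using \<eta>(1)[of k] c[of k] Suc.prems by (simp add: j1 mult_char_def)
      ultimately show ?thesis by blast
    next
      case False
      then have IH: "(\<Sum>t\<in>UNIV. jacobi \<eta> c k t) = 0" "\<exists>t. jacobi \<eta> c k t \<noteq> 0"
        using Suc by auto
      have ck: "c k \<noteq> 0" using c Suc.prems by simp
      have 1: "(\<Sum>t\<in>UNIV. jacobi \<eta> c (Suc k) t) = 0"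
        unfolding jacobi_Suc by (rule sum_char_conv[OF ck IH(1)])
      have "\<exists>t. jacobi \<eta> c (Suc k) t \<noteq> 0"
      proof (rule ccontr)
        assume "\<not> ?thesis"
        then have "of_nat CARD('k) * jacobi \<eta> c k t = 0" for t
          using char_conv_inverse[OF \<eta>(1) z ck IH(1), of t] Suc.prems by (simp add: jacobi_Suc)
        then show False using IH(2) by simp
      qed
      with 1 show ?thesis by blast
    qed
  qed simp
  \<comment> \<open>Substitute \<open>u * v j\<close> for \<open>v j\<close>.\<close>
  have hom: "jacobi \<eta> c s (u * t) = (\<Prod>j<s. \<eta> j u) * jacobi \<eta> c s t" if u: "u \<noteq> 0" for u t
  proof -
    have "(\<Prod>j<s. \<eta> j u) * jacobi \<eta> c s t = 
       (\<Sum>v | v \<in> PiE {..<s} (\<lambda>_. UNIV) \<and> (\<Sum>j<s. c j * v j) = t. \<Prod>j<s. \<eta> j (u * v j))"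
      unfolding jacobi_def sum_distrib_left using \<eta>(1)
      by (auto simp: mult_char_def prod.distrib intro!: sum.cong)
    also have "\<dots> = jacobi \<eta> c s (u * t)"
      unfolding jacobi_def
    proof (rule sum.reindex_bij_witness[where j = "\<lambda>v. \<lambda>j\<in>{..<s}. u * v j" and i = "\<lambda>v. \<lambda>j\<in>{..<s}. v j / u"], goal_cases)
      case (3 v)
      then show ?case using u by (auto simp: fun_eq_iff PiE_def extensional_def restrict_def)
    next
      case (4 v)
      then have "(\<Sum>j<s. c j * (v j / u)) = (u * t) / u" 
        by (simp flip: sum_divide_distrib) 
      then show ?case using u by auto
    qed (use u in \<open>auto simp: fun_eq_iff PiE_def extensional_def restrict_def sum_distrib_left algebra_simps\<close>)
    finally show ?thesis by simp
  qed
  have 0: "jacobi \<eta> c s 0 = 0"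
    using hom[OF tot(1), of 0] tot(2) by simp
  obtain t where t: "jacobi \<eta> c s t \<noteq> 0" using *[of s] s by auto
  with 0 have "t \<noteq> 0" by auto
  then show ?thesis using t hom[of t 1] by auto
qed
section \<open>The residue character\<close>

text \<open>
  The power residue character: it is \<open>\<phi> ^ m\<close>, restricted to the group of \<open>d\<close>-th
  roots of unity and pulled back along the surjection \<open>z \<mapsto> z ^ ((q - 1) / d)\<close>.
\<close>
definition residue_char :: "('k::{finite,field} \<Rightarrow> 'e::field) \<Rightarrow> nat \<Rightarrow> int \<Rightarrow> 'k \<Rightarrow> 'e" where
  "residue_char \<phi> d m z = (if z = 0 then 0 else \<phi> (z ^ ((CARD('k) - 1) div d)) powi m)"

context
  fixes \<phi> :: "'k::{finite,field} \<Rightarrow> rat alg_closure" and d :: nat and m :: int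
  assumes \<phi>: "generates_characters \<phi>" and d: "d dvd CARD('k) - 1" "d > 0" and m: "\<not> int d dvd m"
begin

lemma generating_character_mult:
  "x \<noteq> 0 \<Longrightarrow> \<phi> x \<noteq> 0" "x \<noteq> 0 \<Longrightarrow> y \<noteq> 0 \<Longrightarrow> \<phi> (x * y) = \<phi> x * \<phi> y" "\<phi> 1 = 1"
  "x \<noteq> 0 \<Longrightarrow> \<phi> (x ^ i) = \<phi> x ^ i"
proof -
  show 1: "\<phi> x \<noteq> 0" if "x \<noteq> 0" for x
    using \<phi> that by (auto simp: generates_characters_def mult_group_hom_iff)
  show 2: "\<phi> (x * y) = \<phi> x * \<phi> y" if "x \<noteq> 0" "y \<noteq> 0" for x y
    using \<phi> that by (auto simp: generates_characters_def mult_group_hom_iff)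
  have "\<phi> 1 * \<phi> 1 = \<phi> 1" using 2[of 1 1] by simp
  then show 3: "\<phi> 1 = 1" using 1[of 1] by simp
  show "x \<noteq> 0 \<Longrightarrow> \<phi> (x ^ i) = \<phi> x ^ i"
    by (induction i) (use 2 3 in auto)
qed

lemma mult_char_residue_char: "mult_char (residue_char \<phi> d m)"
  unfolding mult_char_def residue_char_def
  using generating_character_mult by (auto simp: power_mult_distrib power_int_mult_distrib)

text \<open>
  The character \<open>\<phi> ^ m\<close> of the group of \<open>d\<close>-th roots of unity is nontrivial,
  since \<open>d\<close> does not divide \<open>m\<close>, and remains so after raising to a power prime to
  \<open>d\<close>.
\<close>
lemma residue_char_nontrivial:
  assumes "coprime d k"
  shows "\<exists>z. z \<noteq> 0 \<and> residue_char \<phi> d m z ^ k \<noteq> 1"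
proof -
  obtain g :: 'k where g: "g \<noteq> 0" "\<And>x. x \<noteq> 0 \<Longrightarrow> \<exists>i. x = g ^ i" "\<And>i. g ^ i = 1 \<longleftrightarrow> CARD('k) - 1 dvd i"
    using finite_field_generator by blast
  obtain l where l: "CARD('k) - 1 = d * l" using d by blast
  have "card {0,1::'k} \<le> CARD('k)" by (intro card_mono) auto
  then have l0: "l > 0" using l by (cases l) auto
  have False if *: "residue_char \<phi> d m g ^ k = 1"
  proof -
    have "residue_char \<phi> d m g ^ k = \<phi> g powi (int l * m * int k)"
      using g(1) d l generating_character_mult(4)[OF g(1)]
      by (simp add: residue_char_def power_int_mult flip: power_int_of_nat)
    then have 1: "\<phi> g powi (int l * m * int k) = 1" using * by simp
    then have "\<phi> g ^ nat \<bar>int l * m * int k\<bar> = 1"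
      by (cases "int l * m * int k \<ge> 0") (auto simp: power_int_def inverse_eq_1_iff power_inverse)
    then have "CARD('k) - 1 dvd nat \<bar>int l * m * int k\<bar>"
      using generating_character_order[OF \<phi> g] by blast
    then have "int (d * l) dvd int l * m * int k" unfolding l by (simp add: dvd_nat_abs_iff)
    then have "int l * int d dvd int l * (m * int k)" by (simp add: mult_ac)
    then have "int d dvd m * int k" using l0 by (subst (asm) dvd_times_left_cancel_iff) auto
    then show False using assms m by (metis coprime_dvd_mult_left_iff coprime_int_iff)
  qed
  then show ?thesis using g(1) by blast
qed

lemma sum_character_roots_of_unity: "(\<Sum>\<xi>\<in>roots_of_unity d. \<phi> \<xi> powi m) = 0"
proof -
  obtain z where z: "z \<noteq> 0" "residue_char \<phi> d m z \<noteq> 1"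
    using residue_char_nontrivial[of 1] by auto
  define w where "w = z ^ ((CARD('k) - 1) div d)"
  have w: "w \<noteq> 0" "\<phi> w powi m \<noteq> 1" "w ^ d = 1"
    using z d finite_field_power_card(1)[OF z(1)] by (auto simp: w_def residue_char_def simp flip: power_mult)
  have nz: "\<xi> \<noteq> 0" if "\<xi> \<in> roots_of_unity d" for \<xi> :: 'k
    using that d(2) by (auto simp: roots_of_unity_def power_0_left)
  have "(\<Sum>\<xi>\<in>roots_of_unity d. \<phi> (w * \<xi>) powi m) = (\<Sum>\<xi>\<in>roots_of_unity d. \<phi> \<xi> powi m)"
    by (rule sum.reindex_bij_witness[where i = "\<lambda>\<xi>. \<xi> / w" and j = "\<lambda>\<xi>. w * \<xi>"])
       (use w in \<open>auto simp: roots_of_unity_def power_mult_distrib power_divide\<close>)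
  also have "(\<Sum>\<xi>\<in>roots_of_unity d. \<phi> (w * \<xi>) powi m) = \<phi> w powi m * (\<Sum>\<xi>\<in>roots_of_unity d. \<phi> \<xi> powi m)"
    unfolding sum_distrib_left
    by (rule sum.cong) (use generating_character_mult w nz in \<open>auto simp: power_int_mult_distrib\<close>)
  finally show ?thesis using w(2) by simp
qed

end

section \<open>Polynomials with coefficients in the finite field\<close>

definition ring_map :: "('a::comm_ring_1 \<Rightarrow> 'b::comm_ring_1) \<Rightarrow> bool" where
  "ring_map f \<longleftrightarrow> f 0 = 0 \<and> f 1 = 1 \<and> (\<forall>x y. f (x + y) = f x + f y) \<and> (\<forall>x y. f (x * y) = f x * f y)"

lemma ring_mapD:
  assumes "ring_map f"
  shows "f 0 = 0" "f 1 = 1" "f (x + y) = f x + f y" "f (x * y) = f x * f y" "f (- x) = - f x"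
    "f (x - y) = f x - f y" "f (x ^ n) = f x ^ n"
proof -
  show 1: "f 0 = 0" "f 1 = 1" "f (x + y) = f x + f y" "f (x * y) = f x * f y" for x y
    using assms by (auto simp: ring_map_def)
  show 2: "f (- x) = - f x" for x using 1(3)[of x "- x"] 1(1) by (simp add: eq_neg_iff_add_eq_0 add.commute)
  show "f (x - y) = f x - f y" using 1(3)[of x "- y"] 2 by simp
  show "f (x ^ n) = f x ^ n" by (induction n) (use 1 in auto)
qed

lemma ring_map_sum: "ring_map f \<Longrightarrow> f (\<Sum>i\<in>A. g i) = (\<Sum>i\<in>A. f (g i))"
  by (induction A rule: infinite_finite_induct) (auto simp: ring_mapD)

lemma ring_map_prod: "ring_map f \<Longrightarrow> f (\<Prod>i\<in>A. g i) = (\<Prod>i\<in>A. f (g i))"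
  by (induction A rule: infinite_finite_induct) (auto simp: ring_mapD)

lemma ring_map_map_poly:
  assumes f: "ring_map f"
  shows "ring_map (map_poly f)"
  unfolding ring_map_def
  using f by (auto simp: poly_eq_iff coeff_map_poly ring_mapD coeff_mult ring_map_sum)

lemma ring_map_to_ac [simp]: "ring_map to_ac" by (simp add: ring_map_def)

lemma ring_map_frobenius [simp]: "ring_map (\<lambda>x :: 'k::{finite,field} alg_closure. x ^ CARD('k))"
  by (auto simp: ring_map_def frobenius_add power_mult_distrib)

lemma poly_ring_map: "ring_map f \<Longrightarrow> poly (map_poly f p) (f x) = f (poly p x)"
  by (induction p) (auto simp: map_poly_pCons ring_mapD)

lemma frobenius_inj:
  fixes x y :: "'k::{finite,field} alg_closure"
  shows "x ^ CARD('k) ^ n = y ^ CARD('k) ^ n \<longleftrightarrow> x = y"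
proof
  assume "x ^ CARD('k) ^ n = y ^ CARD('k) ^ n"
  then show "x = y"
  proof (induction n)
    case (Suc n)
    let ?f = "\<lambda>x :: 'k alg_closure. x ^ CARD('k)"
    have "?f (x ^ CARD('k) ^ n) = ?f (y ^ CARD('k) ^ n)" using Suc.prems by (simp add: mult.commute flip: power_mult)
    then have "?f (x ^ CARD('k) ^ n - y ^ CARD('k) ^ n) = 0"
      by (simp add: ring_mapD(6)[OF ring_map_frobenius])
    then show ?case using Suc.IH by simp
  qed simp
qed simp

text \<open>
  Galois descent: the fixed field of the Frobenius is the base field.
\<close>
lemma poly_descend:
  fixes p :: "'k::{finite,field} alg_closure poly"
  assumes "map_poly (\<lambda>x. x ^ CARD('k)) p = p"
  shows "\<exists>g. p = map_poly to_ac g"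
proof (intro exI poly_eqI)
  fix i
  have "coeff p i ^ CARD('k) = coeff p i"
    by (metis assms coeff_map_poly power_0_left zero_less_card_finite not_gr0)
  then show "coeff p i = coeff (map_poly to_ac (map_poly of_ac p)) i"
    by (simp add: coeff_map_poly to_ac_of_ac frobenius_fixed_iff)
qed

lemma map_poly_to_ac_fixed:
  fixes g :: "'k::{finite,field} poly"
  shows "map_poly (\<lambda>x. x ^ CARD('k)) (map_poly to_ac g) = map_poly to_ac g"
  by (rule poly_eqI) (simp add: coeff_map_poly power_0_left finite_field_power_card(2) flip: to_ac_power)

lemma map_poly_to_ac_eq_iff [simp]: "map_poly to_ac g = map_poly to_ac h \<longleftrightarrow> g = h"
  by (auto simp: poly_eq_iff coeff_map_poly)

lemma map_poly_to_ac_eq_0_iff [simp]: "map_poly to_ac g = 0 \<longleftrightarrow> g = 0"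
  by (auto simp: poly_eq_iff coeff_map_poly)

lemma degree_map_poly_to_ac [simp]: "degree (map_poly to_ac g) = degree g"
  by (rule degree_map_poly) simp

lemma dvd_map_poly_to_ac_iff:
  fixes g h :: "'k::{finite,field} poly"
  shows "map_poly to_ac h dvd map_poly to_ac g \<longleftrightarrow> h dvd g"
proof
  assume "h dvd g"
  then show "map_poly to_ac h dvd map_poly to_ac g"
    by (auto simp: ring_mapD(4)[OF ring_map_map_poly[OF ring_map_to_ac]])
next
  assume "map_poly to_ac h dvd map_poly to_ac g"
  then obtain p where p: "map_poly to_ac g = map_poly to_ac h * p" by blast
  show "h dvd g"
  proof (cases "h = 0")
    case True
    with p show ?thesis by simp
  next
    case False
    let ?F = "map_poly (\<lambda>x::'k alg_closure. x ^ CARD('k))"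
    have h0: "map_poly to_ac h \<noteq> 0" using False by simp
    have "?F (map_poly to_ac g) = ?F (map_poly to_ac h) * ?F p"
      unfolding p by (rule ring_mapD(4)[OF ring_map_map_poly[OF ring_map_frobenius]])
    then have "map_poly to_ac h * p = map_poly to_ac h * ?F p"
      unfolding map_poly_to_ac_fixed using p by simp
    then have "?F p = p" using h0 by simp
    then obtain l where "p = map_poly to_ac l" using poly_descend by blast
    then have "map_poly to_ac g = map_poly to_ac (h * l)"
      using p by (simp add: ring_mapD(4)[OF ring_map_map_poly[OF ring_map_to_ac]])
    then show ?thesis by (simp only: map_poly_to_ac_eq_iff) simp
  qed
qed

lemma alg_closed_proots:
  fixes p :: "'a::alg_closed_field poly"
  assumes "p \<noteq> 0"
  shows "p = smult (lead_coeff p) (\<Prod>x\<in>#proots p. [:-x, 1:])" "size (proots p) = degree p"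
proof -
  obtain A where A: "size A = degree p" "p = smult (lead_coeff p) (\<Prod>x\<in>#A. [:-x, 1:])"
    using alg_closed_imp_factorization[OF assms] by blast
  have nz: "(\<Prod>x\<in>#B. [:-x, 1:]) \<noteq> 0" for B :: "'a multiset"
    by (induction B) (auto simp del: mult_pCons_left)
  have "proots (\<Prod>x\<in>#A. [:-x, 1:]) = A"
    by (induction A) (use nz in \<open>auto simp: proots_mult simp del: mult_pCons_left\<close>)
  then have "proots p = A" using assms by (subst A(2)) simp
  then show "p = smult (lead_coeff p) (\<Prod>x\<in>#proots p. [:-x, 1:])" "size (proots p) = degree p"
    using A by simp_all
qed

lemma dvd_iff_proots_subset:
  fixes p g :: "'a::alg_closed_field poly"
  assumes "p \<noteq> 0" "g \<noteq> 0"
  shows "p dvd g \<longleftrightarrow> proots p \<subseteq># proots g"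
proof
  assume "p dvd g"
  then show "proots p \<subseteq># proots g" using assms by (auto simp: proots_mult)
next
  assume "proots p \<subseteq># proots g"
  then have "(\<Prod>x\<in>#proots p. [:-x, 1:]) dvd (\<Prod>x\<in>#proots g. [:-x, 1:])"
    by (auto simp: subset_mset.le_iff_add)
  then show "p dvd g"
    by (subst alg_closed_proots(1)[OF assms(1)], subst alg_closed_proots(1)[OF assms(2)])
       (use assms in \<open>auto simp: smult_dvd_iff dvd_smult_iff\<close>)
qed

lemma order_map_poly:
  fixes f :: "'a::field \<Rightarrow> 'b::field"
  assumes f: "ring_map f" and p: "p \<noteq> 0"
  shows "order (f x) (map_poly f p) = order x p"
proof -
  have inj: "f y = 0 \<longleftrightarrow> y = 0" for y
    using ring_mapD(1,2)[OF f] ring_mapD(4)[OF f, of y "inverse y"] by (cases "y = 0") auto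
  obtain h where h: "p = [:-x, 1:] ^ order x p * h" "\<not> [:-x, 1:] dvd h"
    using order_decomp[OF p] by blast
  have hx: "poly h x \<noteq> 0" using h(2) by (simp add: poly_eq_0_iff_dvd)
  have "map_poly f p = map_poly f [:-x, 1:] ^ order x p * map_poly f h"
    by (subst h(1)) (simp add: ring_mapD[OF ring_map_map_poly[OF f]])
  also have "map_poly f [:-x, 1:] = [:-f x, 1:]"
    by (simp add: map_poly_pCons ring_mapD[OF f])
  finally have 1: "map_poly f p = [:-f x, 1:] ^ order x p * map_poly f h" .
  have "poly (map_poly f h) (f x) \<noteq> 0" using hx inj by (simp add: poly_ring_map[OF f])
  then have 2: "order (f x) (map_poly f h) = 0" "map_poly f h \<noteq> 0" by (auto simp: order_0I)
  show ?thesis unfolding 1 using 2 by (subst order_mult) (auto simp: order_power_n_n)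
qed


section \<open>Orbits of the Frobenius\<close>

definition orbit_factors :: "nat \<Rightarrow> 'k::{finite,field} alg_closure \<Rightarrow> 'k alg_closure poly" where
  "orbit_factors r x = (\<Prod>i<r. [:- (x ^ CARD('k) ^ i), 1:])"

text \<open>
  This is meant for \<open>x ^ q ^ r = x\<close>. Then \<open>orbit_factors r x\<close> is the characteristic
  polynomial of \<open>x\<close> in the extension of degree \<open>r\<close> of the base field, a power of the
  minimal polynomial of \<open>x\<close>, and has coefficients in the base field.
\<close>
definition orbit_poly :: "nat \<Rightarrow> 'k::{finite,field} alg_closure \<Rightarrow> 'k poly" where
  "orbit_poly r x = map_poly of_ac (orbit_factors r x)"

lemma monic_orbit_factors: "degree (orbit_factors r x) = r" "lead_coeff (orbit_factors r x) = 1" "orbit_factors r x \<noteq> 0"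
proof -
  show 1: "lead_coeff (orbit_factors r x) = 1"
    unfolding orbit_factors_def lead_coeff_prod by simp
  then show "orbit_factors r x \<noteq> 0" by auto
  show "degree (orbit_factors r x) = r"
    unfolding orbit_factors_def by (subst degree_prod_eq_sum_degree) auto
qed

lemma map_poly_orbit_poly:
  fixes x :: "'k::{finite,field} alg_closure"
  assumes x: "x ^ CARD('k) ^ r = x"
  shows "map_poly to_ac (orbit_poly r x) = orbit_factors r x"
proof -
  let ?f = "\<lambda>x::'k alg_closure. x ^ CARD('k)"
  let ?F = "map_poly ?f"
  let ?h = "\<lambda>i. [:- (x ^ CARD('k) ^ i), 1:]"
  have neg: "(- z) ^ CARD('k) = - (z ^ CARD('k))" for z :: "'k alg_closure"
    by (rule ring_mapD(5)[OF ring_map_frobenius])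
  have "?F (orbit_factors r x) = (\<Prod>i<r. ?F (?h i))"
    unfolding orbit_factors_def by (rule ring_map_prod[OF ring_map_map_poly[OF ring_map_frobenius]])
  also have "\<dots> = (\<Prod>i<r. ?h (Suc i))"
    by (intro prod.cong) (simp_all add: neg map_poly_pCons power_0_left mult.commute flip: power_mult)
  also have "\<dots> = orbit_factors r x"
  proof (cases r)
    case (Suc r')
    have "(\<Prod>i<r. ?h (Suc i)) = (\<Prod>i<r'. ?h (Suc i)) * ?h 0"
      using x Suc by simp
    also have "\<dots> = (\<Prod>i<r. ?h i)"
      unfolding Suc prod.lessThan_Suc_shift by (simp add: mult.commute del: mult_pCons_left mult_pCons_right)
    finally show ?thesis by (simp add: orbit_factors_def)
  qed (simp add: orbit_factors_def)
  finally obtain g where "orbit_factors r x = map_poly to_ac g" using poly_descend by blast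
  then show ?thesis
    by (simp add: orbit_poly_def map_poly_map_poly o_def)
qed

text \<open>
  The iterates of the Frobenius permute the finitely many roots of \<open>g\<close>; the period of
  \<open>x\<close> is the degree of its minimal polynomial.
\<close>
lemma orbit_period:
  fixes x :: "'k::{finite,field} alg_closure" and g :: "'k poly"
  defines "q \<equiv> CARD('k)"
  assumes g: "g \<noteq> 0" and x: "poly (map_poly to_ac g) x = 0"
  obtains m where "m > 0" "\<And>r. x ^ q ^ r = x \<longleftrightarrow> m dvd r" "inj_on (\<lambda>i. x ^ q ^ i) {..<m}"
proof -
  let ?G = "map_poly to_ac g"
  have G: "?G \<noteq> 0" using g by simp
  have root: "poly ?G (x ^ q ^ i) = 0" for i
  proof (induction i)
    case (Suc i)
    have "poly (map_poly (\<lambda>x. x ^ q) ?G) ((x ^ q ^ i) ^ q) = (poly ?G (x ^ q ^ i)) ^ q"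
      unfolding q_def by (rule poly_ring_map[OF ring_map_frobenius])
    then show ?case using Suc map_poly_to_ac_fixed[of g] 
      by (simp add: q_def power_0_left mult.commute flip: power_mult)
  qed (use x in simp)
  have "\<not> inj (\<lambda>i. x ^ q ^ i)"
  proof
    assume "inj (\<lambda>i. x ^ q ^ i)"
    then have "infinite (range (\<lambda>i. x ^ q ^ i))" by (simp add: finite_image_iff)
    moreover have "range (\<lambda>i. x ^ q ^ i) \<subseteq> {z. poly ?G z = 0}" using root by auto
    ultimately show False using poly_roots_finite[OF G] finite_subset by blast
  qed
  have cancel: "x ^ q ^ (j - i) = x" if "x ^ q ^ i = x ^ q ^ j" "i < j" for i j
  proof -
    have "x ^ q ^ j = (x ^ q ^ (j - i)) ^ q ^ i"
      using that(2) by (simp flip: power_mult power_add)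
    then have "x ^ q ^ i = (x ^ q ^ (j - i)) ^ q ^ i" using that(1) by simp
    then show ?thesis unfolding q_def frobenius_inj by simp
  qed
  obtain i j where "x ^ q ^ i = x ^ q ^ j" "i < j"
    using \<open>\<not> inj _\<close> by (metis injI linorder_neqE_nat)
  then have ex: "x ^ q ^ (j - i) = x \<and> j - i > 0" using cancel by simp
  define m where "m = (LEAST m. x ^ q ^ m = x \<and> m > 0)"
  have m: "x ^ q ^ m = x" "m > 0" unfolding m_def using LeastI[of "\<lambda>m. x ^ q ^ m = x \<and> m > 0", OF ex] by auto
  have least: "m \<le> r" if "x ^ q ^ r = x" "r > 0" for r
    unfolding m_def using that by (intro Least_le) auto
  have mult: "x ^ q ^ (m * k) = x" for k
  proof (induction k)
    case (Suc k)
    have "x ^ q ^ (m * Suc k) = (x ^ q ^ m) ^ q ^ (m * k)" by (simp add: power_add power_mult)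
    then show ?case using Suc m by simp
  qed simp
  have period: "x ^ q ^ r = x \<longleftrightarrow> m dvd r" for r
  proof
    assume r: "x ^ q ^ r = x"
    have "x ^ q ^ r = (x ^ q ^ (m * (r div m))) ^ q ^ (r mod m)"
      by (metis mult_div_mod_eq power_add power_mult)
    then have "x ^ q ^ (r mod m) = x" using r mult by simp
    then have "r mod m = 0" using least[of "r mod m"] m(2) by (meson mod_less_divisor not_gr0 not_le)
    then show "m dvd r" by blast
  qed (use mult in auto)
  have "inj_on (\<lambda>i. x ^ q ^ i) {..<m}"
  proof (rule inj_onI)
    fix i j assume ij: "i \<in> {..<m}" "j \<in> {..<m}" "x ^ q ^ i = x ^ q ^ j"
    show "i = j"
    proof (rule ccontr)
      assume "i \<noteq> j"
      then consider "i < j" | "j < i" by linarith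
      then show False
      proof cases
        case 1 then show False using cancel[OF ij(3)] least[of "j - i"] ij by auto
      next
        case 2 then show False using cancel[OF ij(3)[symmetric]] least[of "i - j"] ij by auto
      qed
    qed
  qed
  then show ?thesis using that m(2) period by blast
qed

lemma orbit_factors_mult:
  fixes x :: "'k::{finite,field} alg_closure"
  assumes "x ^ CARD('k) ^ m = x"
  shows "orbit_factors (m * k) x = orbit_factors m x ^ k"
proof (induction k)
  case (Suc k)
  have xm: "x ^ CARD('k) ^ (m * k) = x"
  proof (induction k)
    case (Suc k)
    have "x ^ CARD('k) ^ (m * Suc k) = (x ^ CARD('k) ^ m) ^ CARD('k) ^ (m * k)" by (simp add: power_add power_mult)
    then show ?case using Suc assms by simp
  qed simp
  have "orbit_factors (m * Suc k) x = orbit_factors (m * k) x * (\<Prod>i<m. [:- (x ^ CARD('k) ^ (m * k + i)), 1:])"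
  proof -
    have "(\<Prod>i<a + b. h i) = (\<Prod>i<a. h i) * (\<Prod>i<b. h (a + i))" for a b :: nat and h :: "nat \<Rightarrow> 'k alg_closure poly"
      by (induction b) (auto simp: mult.assoc)
    from this[of _ "m * k" m] show ?thesis unfolding orbit_factors_def by (simp add: add.commute)
  qed
  also have "(\<Prod>i<m. [:- (x ^ CARD('k) ^ (m * k + i)), 1:]) = orbit_factors m x"
    unfolding orbit_factors_def by (intro prod.cong) (simp_all add: power_add power_mult xm[unfolded power_mult])
  finally show ?case using Suc by simp
qed (simp add: orbit_factors_def)

text \<open>
  Let \<open>x\<close> be a root of \<open>g\<close> with period \<open>m\<close>. The \<open>r\<close> that
  count for \<open>x\<close> are the multiples \<open>m * k\<close> for which
  \<open>orbit_factors (m * k) x = orbit_factors m x ^ k\<close> divides \<open>g\<close>. All conjugates of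
  \<open>x\<close> have the same multiplicity in \<open>g\<close>, so these are the \<open>k\<close> from
  \<open>1\<close> up to this multiplicity, and the sum over all roots of their multiplicities is the degree.
\<close>
lemma sum_orbit_factors_dvd:
  fixes g :: "'k::{finite,field} poly"
  assumes g: "g \<noteq> 0"
  shows "(\<Sum>r=1..degree g. card {x. x ^ CARD('k) ^ r = x \<and> orbit_factors r x dvd map_poly to_ac g}) = degree g"
proof -
  let ?G = "map_poly to_ac g" and ?q = "CARD('k)"
  have G: "?G \<noteq> 0" using g by simp
  define Z where "Z = {x. poly ?G x = 0}"
  have finZ: "finite Z" unfolding Z_def using poly_roots_finite[OF G] .
  have ord_orbit: "order (x ^ ?q ^ i) ?G = order x ?G" for x i
  proof (induction i)
    case (Suc i)
    have "order ((x ^ ?q ^ i) ^ ?q) (map_poly (\<lambda>x. x ^ ?q) ?G) = order (x ^ ?q ^ i) ?G"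
      by (rule order_map_poly[OF ring_map_frobenius G])
    then show ?case using Suc map_poly_to_ac_fixed[of g] by (simp add: mult.commute flip: power_mult)
  qed simp
  define D where "D = (\<lambda>r. {x. x ^ ?q ^ r = x \<and> orbit_factors r x dvd ?G})"
  have DZ: "D r \<subseteq> Z" if "r > 0" for r
  proof
    fix x assume x: "x \<in> D r"
    have "poly (orbit_factors r x) x = 0"
      unfolding orbit_factors_def poly_prod using that by (intro prod_zero) (auto intro!: bexI[of _ 0])
    then show "x \<in> Z" using x by (auto simp: D_def Z_def)
  qed
  have cnt: "card {r\<in>{1..degree g}. x \<in> D r} = order x ?G" if x: "x \<in> Z" for x
  proof -
    obtain m where m: "m > 0" "\<And>r. x ^ ?q ^ r = x \<longleftrightarrow> m dvd r" "inj_on (\<lambda>i. x ^ ?q ^ i) {..<m}"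
      using orbit_period[OF g] x unfolding Z_def by blast
    have pm: "proots (orbit_factors m x) = mset_set ((\<lambda>i. x ^ ?q ^ i) ` {..<m})"
    proof -
      have "proots (orbit_factors m x) = (\<Sum>i<m. {#x ^ ?q ^ i#})"
        unfolding orbit_factors_def by (subst proots_prod) auto
      also have "\<dots> = (\<Sum>y\<in>(\<lambda>i. x ^ ?q ^ i) ` {..<m}. {#y#})"
        using m(3) by (subst sum.reindex) (auto simp: o_def)
      finally show ?thesis by (simp add: sum_multiset_singleton)
    qed
    have dv: "orbit_factors (m * k) x dvd ?G \<longleftrightarrow> k \<le> order x ?G" for k
    proof -
      have "orbit_factors (m * k) x dvd ?G \<longleftrightarrow> repeat_mset k (mset_set ((\<lambda>i. x ^ ?q ^ i) ` {..<m})) \<subseteq># proots ?G"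
        using m(2)[of m] G monic_orbit_factors(3)[of "m * k" x] 
        by (subst dvd_iff_proots_subset) (auto simp: orbit_factors_mult proots_power pm)
      also have "\<dots> \<longleftrightarrow> (\<forall>y\<in>(\<lambda>i. x ^ ?q ^ i) ` {..<m}. k \<le> order y ?G)"
        using G by (auto simp: subseteq_mset_def count_mset_set')
      also have "\<dots> \<longleftrightarrow> k \<le> order x ?G" using m(1) by (auto simp: ord_orbit)
      finally show ?thesis .
    qed
    have "{r\<in>{1..degree g}. x \<in> D r} = (\<lambda>k. m * k) ` {1..order x ?G}"
    proof safe
      fix r assume r: "r \<in> {1..degree g}" "x \<in> D r"
      then obtain k where k: "r = m * k" using m(2) by (auto simp: D_def)
      then show "r \<in> (\<lambda>k. m * k) ` {1..order x ?G}" using r dv[of k] by (cases "k = 0") (auto simp: D_def)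
    next
      fix k assume k: "k \<in> {1..order x ?G}"
      then have "orbit_factors (m * k) x dvd ?G" using dv by simp
      then have "degree (orbit_factors (m * k) x) \<le> degree ?G" using G dvd_imp_degree_le by blast
      then show "m * k \<in> {1..degree g}" using k m(1) by (simp add: monic_orbit_factors)
      show "x \<in> D (m * k)" using k dv m(2) by (simp add: D_def)
    qed
    moreover have "inj_on (\<lambda>k. m * k) {1..order x ?G}" using m(1) by (auto simp: inj_on_def)
    ultimately show ?thesis by (simp add: card_image)
  qed
  have "(\<Sum>r=1..degree g. card (D r)) = (\<Sum>r=1..degree g. \<Sum>x\<in>Z. if x \<in> D r then 1 else 0)"
  proof (rule sum.cong)
    fix r assume "r \<in> {1..degree g}"
    then have "D r = {x\<in>Z. x \<in> D r}" using DZ[of r] by auto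
    then have "card (D r) = (\<Sum>x\<in>{x\<in>Z. x \<in> D r}. 1)" by simp
    also have "\<dots> = (\<Sum>x\<in>Z. if x \<in> D r then 1 else 0)" by (rule sum.inter_filter[OF finZ])
    finally show "card (D r) = (\<Sum>x\<in>Z. if x \<in> D r then 1 else 0)" .
  qed simp
  also have "\<dots> = (\<Sum>x\<in>Z. \<Sum>r=1..degree g. if x \<in> D r then 1 else 0)" by (rule sum.swap)
  also have "\<dots> = (\<Sum>x\<in>Z. order x ?G)"
  proof (rule sum.cong)
    fix x assume "x \<in> Z"
    from cnt[OF this] show "(\<Sum>r=1..degree g. if x \<in> D r then 1 else 0) = order x ?G"
      by (simp flip: sum.inter_filter)
  qed simp
  also have "\<dots> = size (proots ?G)"
    unfolding size_multiset_overloaded_eq using G by (simp add: Z_def)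
  also have "\<dots> = degree g" using alg_closed_proots(2)[OF G] by simp
  finally show ?thesis by (simp add: D_def)
qed


section \<open>The L-series of a character on monic polynomials\<close>

definition monics :: "nat \<Rightarrow> 'k::comm_ring_1 poly set" where
  "monics N = {g. degree g = N \<and> lead_coeff g = 1}"

lemma finite_monics: "finite (monics N :: 'k::{finite,field} poly set)"
proof -
  have "(monics N :: 'k poly set) \<subseteq> Poly ` {xs. set xs \<subseteq> UNIV \<and> length xs = Suc N}"
  proof
    fix g :: "'k poly" assume g: "g \<in> monics N"
    then have "g \<noteq> 0" by (auto simp: monics_def)
    then have "length (coeffs g) = Suc N" using g by (simp add: monics_def length_coeffs)
    moreover have "Poly (coeffs g) = g" by simp
    ultimately show "g \<in> Poly ` {xs. set xs \<subseteq> UNIV \<and> length xs = Suc N}" by (metis (mono_tags, lifting) image_eqI mem_Collect_eq top_greatest)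
  qed
  moreover have "finite {xs. set xs \<subseteq> (UNIV :: 'k set) \<and> length xs = Suc N}"
    by (rule finite_lists_length_eq) simp
  ultimately show ?thesis using finite_surj by blast
qed

lemma orbit_poly_monic:
  fixes x :: "'k::{finite,field} alg_closure"
  assumes x: "x ^ CARD('k) ^ r = x"
  shows "orbit_poly r x \<in> monics r"
proof -
  have m: "degree (orbit_poly r x) = r"
    using monic_orbit_factors(1)[of r x] by (simp flip: map_poly_orbit_poly[OF x])
  moreover have "to_ac (coeff (orbit_poly r x) r) = coeff (orbit_factors r x) r"
    by (simp add: coeff_map_poly flip: map_poly_orbit_poly[OF x])
  then have "to_ac (coeff (orbit_poly r x) r) = to_ac 1"
    using monic_orbit_factors[of r x] by simp
  then have "coeff (orbit_poly r x) r = 1" by (simp only: to_ac_eq_iff)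
  ultimately show ?thesis by (simp add: monics_def)
qed

definition monic_sum :: "('k::{finite,field} poly \<Rightarrow> 'e::field) \<Rightarrow> nat \<Rightarrow> 'e" where
  "monic_sum \<Psi> N = (\<Sum>g\<in>monics N. \<Psi> g)"

text \<open>
  For completely multiplicative \<open>\<Psi>\<close> this is the coefficient of \<open>t ^ r\<close> in
  \<open>t * L' / L\<close>, where \<open>L\<close> is the Euler product of \<open>\<Psi>\<close> over the monic
  irreducible polynomials.
\<close>
definition orbit_sum :: "('k::{finite,field} poly \<Rightarrow> 'e::field) \<Rightarrow> nat \<Rightarrow> 'e" where
  "orbit_sum \<Psi> r = (\<Sum>x | x ^ CARD('k) ^ r = x. \<Psi> (orbit_poly r x))"

lemma finite_frobenius_fixed:
  assumes "r > 0"
  shows "finite {x :: 'k::{finite,field} alg_closure. x ^ CARD('k) ^ r = x}"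
proof -
  have "card {0,1::'k} \<le> CARD('k)" by (intro card_mono) auto
  then have q: "CARD('k) > 1" by simp
  then have "CARD('k) ^ r > 1" using assms by (rule one_less_power)
  then have "degree (- [:0, 1:] + monom (1::'k alg_closure) (CARD('k) ^ r)) = CARD('k) ^ r"
    by (subst degree_add_eq_right) (auto simp: degree_monom_eq)
  then have "- [:0, 1:] + monom (1::'k alg_closure) (CARD('k) ^ r) \<noteq> 0" using q by auto
  from poly_roots_finite[OF this] show ?thesis by (simp add: poly_monom)
qed

text \<open>
  A direct form of the logarithmic derivative of the Euler product: every monic \<open>g\<close> of degree
  \<open>N\<close> is divisible by \<open>orbit_poly r x\<close> for exactly \<open>N\<close> pairs
  \<open>(r, x)\<close>, and the multiples of a given \<open>orbit_poly r x\<close> contribute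
  \<open>\<Psi> (orbit_poly r x)\<close> times the sum over monic cofactors of degree \<open>N - r\<close>.
\<close>
lemma monic_sum_recurrence:
  fixes \<Psi> :: "'k::{finite,field} poly \<Rightarrow> 'e::field"
  assumes mult: "\<And>g h. lead_coeff g = 1 \<Longrightarrow> lead_coeff h = 1 \<Longrightarrow> \<Psi> (g * h) = \<Psi> g * \<Psi> h"
  shows "of_nat N * monic_sum \<Psi> N = (\<Sum>r=1..N. orbit_sum \<Psi> r * monic_sum \<Psi> (N - r))"
proof -
  let ?q = "CARD('k)"
  define Fx where "Fx = (\<lambda>r. {x :: 'k alg_closure. x ^ ?q ^ r = x})"
  have finX: "finite (Fx r)" if "r \<in> {1..N}" for r using finite_frobenius_fixed[of r] that by (simp add: Fx_def)
  have dvd: "orbit_factors r x dvd map_poly to_ac g \<longleftrightarrow> orbit_poly r x dvd g" if "x \<in> Fx r" for r x and g :: "'k poly"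
    using that dvd_map_poly_to_ac_iff[of "orbit_poly r x" g] by (simp add: Fx_def map_poly_orbit_poly)
  have cnt: "(\<Sum>r=1..N. card {x\<in>Fx r. orbit_poly r x dvd g}) = N" if "g \<in> monics N" for g :: "'k poly"
  proof -
    have "g \<noteq> 0" "degree g = N" using that by (auto simp: monics_def)
    then have "(\<Sum>r=1..N. card {x. x ^ ?q ^ r = x \<and> orbit_factors r x dvd map_poly to_ac g}) = N"
      using sum_orbit_factors_dvd[of g] by simp
    moreover have "{x. x ^ ?q ^ r = x \<and> orbit_factors r x dvd map_poly to_ac g} = {x\<in>Fx r. orbit_poly r x dvd g}" for r
      using dvd by (auto simp: Fx_def)
    ultimately show ?thesis by simp
  qed
  have shift: "(\<Sum>g | g \<in> monics N \<and> orbit_poly r x dvd g. \<Psi> g) = \<Psi> (orbit_poly r x) * monic_sum \<Psi> (N - r)"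
    if r: "r \<in> {1..N}" and x: "x \<in> Fx r" for r x
  proof -
    let ?Q = "orbit_poly r x"
    have Q: "degree ?Q = r" "lead_coeff ?Q = 1" using orbit_poly_monic[of x r] x by (auto simp: Fx_def monics_def)
    then have Q0: "?Q \<noteq> 0" by auto
    have "(\<Sum>g | g \<in> monics N \<and> ?Q dvd g. \<Psi> g) = (\<Sum>h\<in>monics (N - r). \<Psi> (?Q * h))"
    proof (rule sum.reindex_bij_witness[where i = "\<lambda>h. ?Q * h" and j = "\<lambda>g. g div ?Q"])
      fix h :: "'k poly" assume h: "h \<in> monics (N - r)"
      then have "h \<noteq> 0" by (auto simp: monics_def)
      then show "?Q * h \<in> {g \<in> monics N. ?Q dvd g}"
        using h Q Q0 r lead_coeff_mult[of ?Q h] by (auto simp: monics_def degree_mult_eq)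
      show "?Q * h div ?Q = h" using Q0 by simp
    next
      fix g assume g: "g \<in> {g \<in> monics N. ?Q dvd g}"
      then obtain h where h: "g = ?Q * h" by blast
      have "h \<noteq> 0" using g h by (auto simp: monics_def)
      then have "degree g = r + degree h" "lead_coeff g = lead_coeff h"
        using Q Q0 lead_coeff_mult[of ?Q h] by (simp_all add: h degree_mult_eq)
      then show "g div ?Q \<in> monics (N - r)" using g h Q0 by (auto simp: monics_def)
      show "?Q * (g div ?Q) = g" using h Q0 by simp
      then show "\<Psi> (?Q * (g div ?Q)) = \<Psi> g" by simp
    qed
    also have "\<dots> = (\<Sum>h\<in>monics (N - r). \<Psi> ?Q * \<Psi> h)"
      using mult Q by (intro sum.cong) (auto simp: monics_def)
    finally show ?thesis by (simp add: monic_sum_def sum_distrib_left)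
  qed
  have "of_nat N * monic_sum \<Psi> N = (\<Sum>g\<in>monics N. \<Psi> g * of_nat (\<Sum>r=1..N. card {x\<in>Fx r. orbit_poly r x dvd g}))"
    unfolding monic_sum_def sum_distrib_left
  proof (rule sum.cong)
    fix g :: "'k poly" assume "g \<in> monics N"
    show "of_nat N * \<Psi> g = \<Psi> g * of_nat (\<Sum>r = 1..N. card {x \<in> Fx r. orbit_poly r x dvd g})"
      unfolding cnt[OF \<open>g \<in> monics N\<close>] by (rule mult.commute)
  qed simp
  also have "\<dots> = (\<Sum>g\<in>monics N. \<Sum>r=1..N. \<Sum>x\<in>Fx r. if orbit_poly r x dvd g then \<Psi> g else 0)"
  proof (rule sum.cong)
    fix g :: "'k poly" assume "g \<in> monics N"
    show "\<Psi> g * of_nat (\<Sum>r = 1..N. card {x \<in> Fx r. orbit_poly r x dvd g}) = (\<Sum>r=1..N. \<Sum>x\<in>Fx r. if orbit_poly r x dvd g then \<Psi> g else 0)"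
      unfolding of_nat_sum sum_distrib_left
    proof (rule sum.cong)
      fix r assume "r \<in> {1..N}"
      have "(\<Sum>x\<in>Fx r. if orbit_poly r x dvd g then \<Psi> g else 0) = (\<Sum>x\<in>{x\<in>Fx r. orbit_poly r x dvd g}. \<Psi> g)"
        using finX[OF \<open>r \<in> _\<close>] by (rule sum.inter_filter[symmetric])
      then show "\<Psi> g * of_nat (card {x \<in> Fx r. orbit_poly r x dvd g}) = (\<Sum>x\<in>Fx r. if orbit_poly r x dvd g then \<Psi> g else 0)"
        by (simp add: mult.commute)
    qed simp
  qed simp
  also have "\<dots> = (\<Sum>r=1..N. \<Sum>g\<in>monics N. \<Sum>x\<in>Fx r. if orbit_poly r x dvd g then \<Psi> g else 0)"
    by (rule sum.swap)
  also have "\<dots> = (\<Sum>r=1..N. \<Sum>x\<in>Fx r. \<Sum>g\<in>monics N. if orbit_poly r x dvd g then \<Psi> g else 0)"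
    by (intro sum.cong refl sum.swap)
  also have "\<dots> = (\<Sum>r=1..N. \<Sum>x\<in>Fx r. \<Psi> (orbit_poly r x) * monic_sum \<Psi> (N - r))"
  proof (intro sum.cong refl)
    fix r x assume rx: "r \<in> {1..N}" "x \<in> Fx r"
    have "(\<Sum>g\<in>monics N. if orbit_poly r x dvd g then \<Psi> g else 0) = (\<Sum>g | g \<in> monics N \<and> orbit_poly r x dvd g. \<Psi> g)"
      by (rule sum.inter_filter[symmetric, OF finite_monics])
    then show "(\<Sum>g\<in>monics N. if orbit_poly r x dvd g then \<Psi> g else 0) = \<Psi> (orbit_poly r x) * monic_sum \<Psi> (N - r)"
      using shift[OF rx] by simp
  qed
  finally show ?thesis by (simp add: orbit_sum_def sum_distrib_right Fx_def)
qed

text \<open>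
  The recurrence is the differential equation \<open>L' = L * G'\<close> of \<open>L = exp G\<close>, read off
  coefficientwise.
\<close>
lemma exp_eq_fps_of_recurrence:
  fixes c S :: "nat \<Rightarrow> 'e::field_char_0"
  assumes "c 0 = 1" and rec: "\<And>N. of_nat N * c N = (\<Sum>r=1..N. S r * c (N - r))"
  shows "fps_compose (fps_exp 1) (Abs_fps (\<lambda>r. if r = 0 then 0 else S r / of_nat r)) = Abs_fps c"
proof -
  define G where "G = Abs_fps (\<lambda>r. if r = 0 then 0 else S r / of_nat r)"
  define L where "L = fps_compose (fps_exp 1) G"
  have G0: "fps_nth G 0 = 0" by (simp add: G_def)
  have "fps_deriv L = L * fps_deriv G"
    unfolding L_def using fps_compose_deriv[OF G0, of "fps_exp 1"] by simp
  then have LN: "of_nat (Suc n) * fps_nth L (Suc n) = (\<Sum>i=0..n. fps_nth L i * (of_nat (Suc (n - i)) * fps_nth G (Suc (n - i))))" for n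
    by (metis (mono_tags, lifting) fps_deriv_nth fps_mult_nth Suc_eq_plus1 sum.cong)
  have rec': "of_nat (Suc n) * c (Suc n) = (\<Sum>i=0..n. c i * (of_nat (Suc (n - i)) * fps_nth G (Suc (n - i))))" for n
  proof -
    have "of_nat (Suc n) * c (Suc n) = (\<Sum>r=1..Suc n. S r * c (Suc n - r))" by (rule rec)
    also have "\<dots> = (\<Sum>i=0..n. c i * S (Suc (n - i)))"
      by (rule sum.reindex_bij_witness[where i = "\<lambda>i. Suc (n - i)" and j = "\<lambda>r. Suc n - r"]) (auto simp: Suc_diff_le)
    also have "\<dots> = (\<Sum>i=0..n. c i * (of_nat (Suc (n - i)) * fps_nth G (Suc (n - i))))"
      by (simp add: G_def del: of_nat_Suc)
    finally show ?thesis .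
  qed
  have "fps_nth L N = c N" for N
  proof (induction N rule: less_induct)
    case (less N)
    show ?case
    proof (cases N)
      case 0
      then show ?thesis using assms(1) by (simp add: L_def)
    next
      case (Suc n)
      have "of_nat (Suc n) * fps_nth L (Suc n) = of_nat (Suc n) * c (Suc n)"
        unfolding LN rec' by (rule sum.cong) (use less Suc in auto)
      then show ?thesis unfolding Suc by (simp only: mult_cancel_left of_nat_eq_0_iff) simp
    qed
  qed
  then show ?thesis unfolding L_def[symmetric] G_def[symmetric] by (simp add: fps_eq_iff)
qed

section \<open>Characters supported at finitely many rational points\<close>

text \<open>
  If \<open>g\<close> is monic with roots \<open>x\<close>, then
  \<open>u j ^ degree g * poly g (\<alpha> j)\<close> is the product of the values
  \<open>u j * (\<alpha> j - x)\<close> of a linear polynomial at the roots of \<open>g\<close>.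
\<close>
definition point_char ::
  "(nat \<Rightarrow> 'k::field \<Rightarrow> 'e::field) \<Rightarrow> (nat \<Rightarrow> 'k) \<Rightarrow> (nat \<Rightarrow> 'k) \<Rightarrow> nat \<Rightarrow> 'k poly \<Rightarrow> 'e" where
  "point_char \<eta> u \<alpha> s g = (\<Prod>j<s. \<eta> j (u j ^ degree g * poly g (\<alpha> j)))"

lemma point_char_mult:
  assumes "\<And>j. j < s \<Longrightarrow> mult_char (\<eta> j)" "lead_coeff g = 1" "lead_coeff h = 1"
  shows "point_char \<eta> u \<alpha> s (g * h) = point_char \<eta> u \<alpha> s g * point_char \<eta> u \<alpha> s h"
proof -
  have "g \<noteq> 0" "h \<noteq> 0" using assms by auto
  then have "degree (g * h) = degree g + degree h" by (rule degree_mult_eq)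
  then show ?thesis
    using assms(1) unfolding point_char_def prod.distrib[symmetric]
    by (intro prod.cong) (auto simp: mult_char_def power_add)
qed

lemma add_mem_monics:
  assumes "g \<in> monics N" "degree h < N"
  shows "g + h \<in> monics N"
  using assms by (auto simp: monics_def degree_add_eq_left coeff_eq_0)

text \<open>
  As soon as the degree \<open>N\<close> is at least the number \<open>s\<close> of points, adding multiples of
  the polynomial \<open>W\<close> that vanishes at all points but \<open>\<alpha> 0\<close> permutes the monic
  polynomials of degree \<open>N\<close>. It lets the value at \<open>\<alpha> 0\<close> run through the whole
  field and changes no other value, so that the sum contains the sum of the nontrivial character
  \<open>\<eta> 0\<close> as a factor.
\<close>
lemma monic_sum_point_char_eq_0:
  fixes \<eta> :: "nat \<Rightarrow> 'k::{finite,field} \<Rightarrow> 'e::field_char_0"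
  assumes \<eta>: "mult_char (\<eta> 0)" "z \<noteq> 0" "\<eta> 0 z \<noteq> 1"
    and \<alpha>: "inj_on \<alpha> {..<s}" and u: "u 0 \<noteq> 0" and s: "0 < s" "s \<le> N"
  shows "monic_sum (point_char \<eta> u \<alpha> s) N = 0"
proof -
  define W where "W = (\<Prod>j\<in>{..<s} - {0}. [:- \<alpha> j, 1:])"
  have "degree W = s - 1" unfolding W_def using s by (subst degree_prod_eq_sum_degree) auto
  then have dW: "degree (smult c W) < N" for c using s by (cases "c = 0") auto
  have W0: "poly W (\<alpha> 0) \<noteq> 0"
    unfolding W_def poly_prod using \<alpha> s by (auto simp: inj_on_def)
  have Wj: "poly W (\<alpha> j) = 0" if "j \<in> {..<s} - {0}" for j
    unfolding W_def poly_prod using that by (intro prod_zero) auto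
  let ?\<Psi> = "point_char \<eta> u \<alpha> s"
  have shift: "(\<Sum>g\<in>monics N. ?\<Psi> (g + smult c W)) = (\<Sum>g\<in>monics N. ?\<Psi> g)" for c
    using dW[of c] dW[of "- c"] add_mem_monics[of _ N "smult c W"] add_mem_monics[of _ N "- smult c W"]
    by (intro sum.reindex_bij_witness[where i = "\<lambda>g. g - smult c W" and j = "\<lambda>g. g + smult c W"]) auto
  have "of_nat CARD('k) * (\<Sum>g\<in>monics N. ?\<Psi> g) = (\<Sum>c\<in>UNIV. \<Sum>g\<in>monics N. ?\<Psi> (g + smult c W))"
    by (simp add: shift)
  also have "\<dots> = (\<Sum>g\<in>monics N. \<Sum>c\<in>UNIV. ?\<Psi> (g + smult c W))" by (rule sum.swap)
  also have "\<dots> = (\<Sum>g\<in>(monics N :: 'k poly set). 0)"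
  proof (rule sum.cong)
    fix g :: "'k poly" assume g: "g \<in> monics N"
    let ?R = "\<Prod>j\<in>{..<s} - {0}. \<eta> j (u j ^ N * poly g (\<alpha> j))"
    have "(\<Sum>c\<in>UNIV. ?\<Psi> (g + smult c W)) = (\<Sum>c\<in>UNIV. \<eta> 0 (u 0 ^ N * (poly g (\<alpha> 0) + c * poly W (\<alpha> 0))) * ?R)"
    proof (rule sum.cong)
      fix c
      have "degree (g + smult c W) = N" using add_mem_monics[OF g dW] by (simp add: monics_def)
      then show "?\<Psi> (g + smult c W) = \<eta> 0 (u 0 ^ N * (poly g (\<alpha> 0) + c * poly W (\<alpha> 0))) * ?R"
        unfolding point_char_def using s
        by (subst prod.remove[of _ 0]) (auto simp: Wj intro!: prod.cong)
    qed simp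
    also have "\<dots> = (\<Sum>c\<in>UNIV. \<eta> 0 (u 0 ^ N * (poly g (\<alpha> 0) + c * poly W (\<alpha> 0)))) * ?R"
      by (simp add: sum_distrib_right)
    also have "(\<Sum>c\<in>UNIV. \<eta> 0 (u 0 ^ N * (poly g (\<alpha> 0) + c * poly W (\<alpha> 0)))) = (\<Sum>y\<in>UNIV. \<eta> 0 y)"
      by (rule sum.reindex_bij_witness[where i = "\<lambda>y. (y / u 0 ^ N - poly g (\<alpha> 0)) / poly W (\<alpha> 0)"
            and j = "\<lambda>c. u 0 ^ N * (poly g (\<alpha> 0) + c * poly W (\<alpha> 0))"]) (use W0 u in auto)
    also have "\<dots> = 0" by (rule sum_mult_char[OF \<eta>])
    finally show "(\<Sum>c\<in>UNIV. ?\<Psi> (g + smult c W)) = 0" by simp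
  qed simp
  finally show ?thesis by (simp add: monic_sum_def)
qed

text \<open>
  Lagrange interpolation identifies polynomials of degree below \<open>s\<close> with their vectors of values
  \<open>v\<close> at the \<open>s\<close> points. The coefficient of degree \<open>s - 1\<close> is the linear
  form with coefficients \<open>1 / w j\<close>, so the sum over monic polynomials of degree
  \<open>s - 1\<close> is, up to a nonzero constant, a Jacobi sum.
\<close>
lemma monic_sum_point_char_nonzero:
  fixes \<eta> :: "nat \<Rightarrow> 'k::{finite,field} \<Rightarrow> 'e::field_char_0"
  assumes \<eta>: "\<And>j. j < s \<Longrightarrow> mult_char (\<eta> j)" "\<And>j. j < s \<Longrightarrow> \<exists>z. z \<noteq> 0 \<and> \<eta> j z \<noteq> 1"
    and tot: "z \<noteq> 0" "(\<Prod>j<s. \<eta> j z) \<noteq> 1"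
    and \<alpha>: "inj_on \<alpha> {..<s}" and u: "\<And>j. j < s \<Longrightarrow> u j \<noteq> 0" and s: "0 < s"
  shows "monic_sum (point_char \<eta> u \<alpha> s) (s - 1) \<noteq> 0"
proof -
  define L where "L j = (\<Prod>i\<in>{..<s} - {j}. [:- \<alpha> i, 1:])" for j
  define w where "w j = poly (L j) (\<alpha> j)" for j
  have degL: "degree (L j) = s - 1" "coeff (L j) (s - 1) = 1" if "j < s" for j
  proof -
    show 1: "degree (L j) = s - 1" unfolding L_def using that by (subst degree_prod_eq_sum_degree) auto
    have "lead_coeff (L j) = 1" unfolding L_def lead_coeff_prod by simp
    with 1 show "coeff (L j) (s - 1) = 1" by simp
  qed
  have w: "w j \<noteq> 0" if "j < s" for j
    unfolding w_def L_def poly_prod using \<alpha> that by (auto simp: inj_on_def)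
  have Li: "poly (L j) (\<alpha> i) = 0" if "i < s" "i \<noteq> j" for i j
    unfolding L_def poly_prod using that by (intro prod_zero) auto
  define \<Phi> where "\<Phi> v = (\<Sum>j<s. smult (v j / w j) (L j))" for v
  have \<Phi>_at: "poly (\<Phi> v) (\<alpha> i) = v i" if "i < s" for v i
  proof -
    have "poly (\<Phi> v) (\<alpha> i) = (\<Sum>j<s. v j / w j * poly (L j) (\<alpha> i))"
      by (simp add: \<Phi>_def poly_sum)
    also have "\<dots> = (\<Sum>j\<in>{i}. v j / w j * poly (L j) (\<alpha> i))"
      by (rule sum.mono_neutral_right) (use that Li in auto)
    finally show ?thesis using w[OF that] by (simp add: w_def)
  qed
  have \<Phi>_deg: "degree (\<Phi> v) \<le> s - 1" for v
    unfolding \<Phi>_def using degL by (intro degree_sum_le) (auto intro: order_trans[OF degree_smult_le])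
  have \<Phi>_coeff: "coeff (\<Phi> v) (s - 1) = (\<Sum>j<s. (1 / w j) * v j)" for v
    unfolding \<Phi>_def using degL by (simp add: coeff_sum)
  have interp: "g = h" if "degree g \<le> s - 1" "degree h \<le> s - 1" "\<And>j. j < s \<Longrightarrow> poly g (\<alpha> j) = poly h (\<alpha> j)" for g h :: "'k poly"
  proof (rule ccontr)
    assume "g \<noteq> h"
    then have 0: "g - h \<noteq> 0" by simp
    have "s = card (\<alpha> ` {..<s})" using \<alpha> by (simp add: card_image)
    also have "\<dots> \<le> card {x. poly (g - h) x = 0}"
      by (intro card_mono poly_roots_finite[OF 0]) (use that in auto)
    also have "\<dots> \<le> degree (g - h)" by (rule card_poly_roots_bound[OF 0])
    also have "\<dots> \<le> s - 1" using that by (intro degree_diff_le)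
    finally show False using s by simp
  qed
  let ?V = "{v \<in> PiE {..<s} (\<lambda>_. UNIV). (\<Sum>j<s. (1 / w j) * v j) = 1}"
  have "monic_sum (point_char \<eta> u \<alpha> s) (s - 1) = (\<Sum>v\<in>?V. \<Prod>j<s. \<eta> j (u j ^ (s - 1) * v j))"
    unfolding monic_sum_def
  proof (rule sum.reindex_bij_witness[where i = \<Phi> and j = "\<lambda>g. \<lambda>j\<in>{..<s}. poly g (\<alpha> j)"])
    fix g :: "'k poly" assume g: "g \<in> monics (s - 1)"
    let ?v = "\<lambda>j\<in>{..<s}. poly g (\<alpha> j)"
    show 1: "\<Phi> ?v = g" by (rule interp) (use \<Phi>_deg g \<Phi>_at in \<open>auto simp: monics_def\<close>)
    have "coeff (\<Phi> ?v) (s - 1) = 1" unfolding 1 using g by (metis (mono_tags) mem_Collect_eq monics_def)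
    then show "?v \<in> ?V" unfolding \<Phi>_coeff by simp
    show "(\<Prod>j<s. \<eta> j (u j ^ (s - 1) * ?v j)) = point_char \<eta> u \<alpha> s g"
      using g by (simp add: point_char_def monics_def)
  next
    fix v assume v: "v \<in> ?V"
    have c: "coeff (\<Phi> v) (s - 1) = 1" unfolding \<Phi>_coeff using v by simp
    then have "degree (\<Phi> v) = s - 1" using \<Phi>_deg[of v] le_degree[of "\<Phi> v" "s - 1"] by simp
    with c show "\<Phi> v \<in> monics (s - 1)" by (simp add: monics_def)
    show "(\<lambda>j\<in>{..<s}. poly (\<Phi> v) (\<alpha> j)) = v"
      using v \<Phi>_at by (auto simp: PiE_def extensional_def fun_eq_iff)
  qed
  also have "\<dots> = (\<Sum>v\<in>?V. (\<Prod>j<s. \<eta> j (u j ^ (s - 1))) * (\<Prod>j<s. \<eta> j (v j)))"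
    unfolding prod.distrib[symmetric] using \<eta>(1) by (intro sum.cong prod.cong) (auto simp: mult_char_def)
  also have "\<dots> = (\<Prod>j<s. \<eta> j (u j ^ (s - 1))) * jacobi \<eta> (\<lambda>j. 1 / w j) s 1"
    by (simp add: jacobi_def sum_distrib_left)
  also have "\<dots> \<noteq> 0"
    using jacobi_nonzero[OF \<eta> _ s tot, of "\<lambda>j. 1 / w j"] w u mult_char_nonzero[OF \<eta>(1)] by auto
  finally show ?thesis .
qed

section \<open>The function field\<close>

definition x_fun :: "'k::field alg_closure poly \<Rightarrow> 'k ambient" where
  "x_fun u = to_ac (to_fract u)"

lemma ring_map_x_fun [simp]: "ring_map x_fun"
  by (simp add: ring_map_def x_fun_def)

lemmas x_fun_simps [simp] = ring_mapD[OF ring_map_x_fun]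

lemma x_fun_eq_iff [simp]: "x_fun u = x_fun v \<longleftrightarrow> u = v"
  by (simp add: x_fun_def)

lemma x_fun_eq_0_iff [simp]: "x_fun u = 0 \<longleftrightarrow> u = 0"
  by (simp add: x_fun_def)

lemma x_fun_const_mult: "x_fun [:a * b:] = x_fun [:a:] * x_fun [:b:]"
proof -
  have "[:a * b:] = [:a:] * [:b:]" by simp
  then show ?thesis by (simp only: x_fun_simps)
qed

lemma x_fun_const_add: "x_fun [:a + b:] = x_fun [:a:] + x_fun [:b:]"
proof -
  have "[:a + b:] = [:a:] + [:b:]" by simp
  then show ?thesis by (simp only: x_fun_simps)
qed

lemma x_fun_const_1: "x_fun [:1:] = 1" and x_fun_const_0: "x_fun [:0:] = 0"
  by (simp_all flip: one_pCons)

lemma x_fun_const_power: "x_fun [:a ^ i:] = x_fun [:a:] ^ i"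
  by (induction i) (simp_all only: x_fun_const_1 x_fun_const_mult power_0 power_Suc)

lemma x_fun_const_sum: "x_fun [:\<Sum>i\<in>I. a i:] = (\<Sum>i\<in>I. x_fun [:a i:])"
  by (induction I rule: infinite_finite_induct)
     (simp_all only: sum.infinite sum.empty sum.insert x_fun_const_0 x_fun_const_add not_False_eq_True)

lemma monic_division:
  fixes p c :: "'a::idom poly"
  assumes "lead_coeff c = 1" "degree c > 0"
  shows "\<exists>q r. p = c * q + r \<and> degree r < degree c"
proof -
  obtain q r where qr: "pseudo_divmod p c = (q, r)" by force
  have c0: "c \<noteq> 0" using assms by auto
  have "p = c * q + r" using pseudo_divmod(1)[OF c0 qr] assms by simp
  moreover have "degree r < degree c" using pseudo_divmod(2)[OF c0 qr] assms by auto
  ultimately show ?thesis by blast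
qed

lemma ff_eval_altdef: "ff_eval p \<eta> = poly (map_poly x_fun p) \<eta>"
  by (simp add: ff_eval_def x_fun_def[abs_def])

definition twist :: "'a::comm_ring_1 \<Rightarrow> 'a poly poly \<Rightarrow> 'a poly poly" where
  "twist z p = pcompose p [:0, [:z:]:]"

lemma ring_map_twist: "ring_map (twist z)"
  by (auto simp: ring_map_def twist_def pcompose_add pcompose_mult pcompose_1)

lemma coeff_twist: "coeff (twist z p) i = smult (z ^ i) (coeff p i)"
  by (simp add: twist_def coeff_pcompose_linear poly_const_pow)

lemma twist_twist: "twist z (twist w p) = twist (z * w) p"
  by (rule poly_eqI) (simp add: coeff_twist power_mult_distrib mult.commute)

lemma twist_1 [simp]: "twist 1 p = p"
  by (rule poly_eqI) (simp add: coeff_twist)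

text \<open>
  That \<open>d\<close> is prime to the order of \<open>f\<close> at \<open>0\<close> makes
  \<open>Y ^ d - f\<close> irreducible over \<open>k(x)\<close>, where \<open>k\<close> is the algebraic closure
  of the base field. The element \<open>y\<close> therefore generates a Kummer extension of degree
  \<open>d\<close>, whose Galois group is the group \<open>U\<close> of \<open>d\<close>-th roots of unity.
\<close>
locale kummer =
  fixes d :: nat and f :: "'k::{finite,field} poly"
  assumes d_dvd: "d dvd CARD('k) - 1" and d_pos: "d > 0"
    and f0: "f \<noteq> 0" and order_f: "coprime d (order 0 f)"
begin

definition F :: "'k alg_closure poly" where "F = map_poly to_ac f"
definition y :: "'k ambient" where "y = y_fun d f"
definition ev :: "'k alg_closure poly poly \<Rightarrow> 'k ambient" where "ev p = ff_eval p y"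
definition curve :: "'k alg_closure poly poly" where "curve = curve_poly d F"
definition U :: "'k alg_closure set" where "U = {z. z ^ d = 1}"

lemma F0: "F \<noteq> 0" using f0 by (simp add: F_def)

lemma order_F: "coprime d (order 0 F)"
proof -
  have "order (to_ac 0) (map_poly to_ac f) = order 0 f"
    using order_map_poly[OF ring_map_to_ac f0] .
  then show ?thesis using order_f by (simp add: F_def)
qed

lemma d_nonzero: "of_nat d \<noteq> (0 :: 'k alg_closure)"
  by (rule of_nat_dvd_card_nonzero[OF d_dvd])

lemma card_U: "card U = d" and finite_U: "finite U"
proof -
  show "card U = d" unfolding U_def by (rule card_power_roots[OF d_nonzero]) simp
  then show "finite U" using d_pos by (intro card_ge_0_finite) simp
qed

lemma U_eq: "U = to_ac ` (roots_of_unity d :: 'k set)"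
  unfolding U_def by (rule roots_of_unity_alg_closure[OF d_dvd])

lemma U_simps: "1 \<in> U" "z \<in> U \<Longrightarrow> w \<in> U \<Longrightarrow> z * w \<in> U" "z \<in> U \<Longrightarrow> inverse z \<in> U" "z \<in> U \<Longrightarrow> z \<noteq> 0"
  "z \<in> U \<Longrightarrow> z ^ d = 1"
proof -
  show "1 \<in> U" by (simp add: U_def)
  show "z \<in> U \<Longrightarrow> w \<in> U \<Longrightarrow> z * w \<in> U" by (simp add: U_def power_mult_distrib)
  show "z \<in> U \<Longrightarrow> inverse z \<in> U" by (simp add: U_def power_inverse)
  show "z \<in> U \<Longrightarrow> z \<noteq> 0" using d_pos by (auto simp: U_def power_0_left)
  show "z \<in> U \<Longrightarrow> z ^ d = 1" by (simp add: U_def)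
qed

lemma y_power: "y ^ d = x_fun F"
  unfolding y_def y_fun_def x_fun_def F_def
  by (rule someI_ex) (rule nth_root_exists[OF d_pos])

lemma ring_map_ev: "ring_map ev"
  by (simp add: ring_map_def ev_def ff_eval_altdef ring_mapD[OF ring_map_map_poly[OF ring_map_x_fun]])

lemmas ev_simps [simp] = ring_mapD[OF ring_map_ev]

lemma ev_const [simp]: "ev [:u:] = x_fun u"
  by (simp add: ev_def ff_eval_altdef map_poly_pCons)

lemma ev_Y [simp]: "ev [:0, 1:] = y"
  by (simp add: ev_def ff_eval_altdef map_poly_pCons)

lemma ev_altdef: "ev p = (\<Sum>i\<le>degree p. x_fun (coeff p i) * y ^ i)"
proof -
  have "degree (map_poly x_fun p) = degree p" by (rule degree_map_poly) simp
  then show ?thesis by (simp add: ev_def ff_eval_altdef poly_altdef coeff_map_poly)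
qed

lemma curve_altdef: "curve = - [:F:] + monom 1 d"
  by (simp add: curve_def curve_poly_def monom_altdef)

lemma degree_curve: "degree curve = d" and lead_coeff_curve: "lead_coeff curve = 1"
proof -
  show "degree curve = d"
    unfolding curve_altdef using d_pos by (subst degree_add_eq_right) (auto simp: degree_monom_eq)
  then show "lead_coeff curve = 1" using d_pos by (simp add: curve_altdef coeff_pCons split: nat.splits)
qed

lemma ev_curve: "ev curve = 0"
proof -
  have "ev (monom 1 d) = y ^ d" by (simp only: monom_altdef smult_1_left ev_simps ev_Y)
  then show ?thesis using y_power by (simp add: curve_altdef)
qed

lemma coeff_curve: "coeff curve i = (if i = d then 1 else 0) - (if i = 0 then F else 0)"
  by (cases i) (auto simp: curve_altdef)

text \<open>
  If \<open>P\<close> is a relation of minimal degree \<open>s\<close> over \<open>k(x)\<close> satisfied by \<open>y\<close>, it divides \<open>Y ^ d - f\<close>, so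
  that its \<open>s\<close> roots have \<open>d\<close>-th power \<open>f\<close>. Comparing its constant term with its leading coefficient
  shows that \<open>f ^ s\<close> is a \<open>d\<close>-th power up to sign; the order of vanishing at \<open>0\<close> then forces \<open>d\<close> to
  divide \<open>s\<close>.
\<close>
lemma ev_eq_0_imp_degree_ge:
  assumes "p \<noteq> 0" "ev p = 0"
  shows "degree p \<ge> d"
proof -
  define s where "s = (LEAST s. \<exists>p. p \<noteq> 0 \<and> ev p = 0 \<and> degree p = s)"
  have "\<exists>p. p \<noteq> 0 \<and> ev p = 0 \<and> degree p = s"
    unfolding s_def by (rule LeastI_ex) (use assms in blast)
  then obtain P where P: "P \<noteq> 0" "ev P = 0" "degree P = s" by blast
  have least: "s \<le> degree p" if "p \<noteq> 0" "ev p = 0" for p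
    unfolding s_def using that by (intro Least_le) blast
  have "s > 0"
  proof (rule ccontr)
    assume "\<not> s > 0"
    then obtain u where u: "P = [:u:]" using P(3) degree_eq_zeroE by auto
    then show False using P by simp
  qed
  obtain Q r where Qr: "pseudo_divmod curve P = (Q, r)" by force
  define l where "l = lead_coeff P"
  have l0: "l \<noteq> 0" using P(1) by (simp add: l_def)
  obtain k where k: "smult (l ^ k) curve = P * Q + r"
    using pseudo_divmod(1)[OF P(1) Qr] unfolding l_def by blast
  have "ev (smult (l ^ k) curve) = 0" 
    using ev_curve ev_simps(4)[of "[:l ^ k:]" curve] by simp
  then have "ev r = 0" unfolding k using P by simp
  then have "r = 0" using pseudo_divmod(2)[OF P(1) Qr] least[of r] P(3) by fastforce
  let ?x = "map_poly x_fun :: 'k alg_closure poly poly \<Rightarrow> _"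
  note hom = ring_mapD[OF ring_map_map_poly[OF ring_map_x_fun]]
  define P' where "P' = ?x P"
  have degP': "degree P' = s" unfolding P'_def P(3)[symmetric] by (rule degree_map_poly) simp
  have lcP': "lead_coeff P' = x_fun l" using degP' P(3) by (simp add: P'_def coeff_map_poly l_def)
  have P'0: "P' \<noteq> 0" using lcP' l0 by auto
  have roots: "z ^ d = x_fun F" if "z \<in># proots P'" for z
  proof -
    have "poly P' z = 0" using that P'0 by simp
    then have "poly (?x (P * Q)) z = 0" by (simp add: hom P'_def)
    then have "poly (?x (smult (l ^ k) curve)) z = 0" using k \<open>r = 0\<close> by simp
    moreover have "?x (smult (l ^ k) curve) = smult (x_fun (l ^ k)) (?x curve)"
      by (rule map_poly_smult) auto
    moreover have "?x curve = - [:x_fun F:] + monom 1 d"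
      unfolding curve_altdef by (simp add: hom map_poly_pCons map_poly_monom)
    ultimately show ?thesis using l0 by (simp add: poly_monom)
  qed
  have pm: "poly (\<Prod>z\<in>#A. [:-z, 1:]) 0 = (\<Prod>z\<in>#A. - z)" for A :: "'k ambient multiset"
    by (induction A) (simp_all only: image_mset_empty image_mset_add_mset prod_mset.empty prod_mset.add_mset
        poly_1 poly_mult, simp)
  have "poly P' 0 = poly (smult (x_fun l) (\<Prod>z\<in>#proots P'. [:-z, 1:])) 0"
    using alg_closed_proots(1)[OF P'0] lcP' by simp
  then have c0: "coeff P' 0 = x_fun l * (\<Prod>z\<in>#proots P'. - z)"
    unfolding poly_smult pm by (simp add: poly_0_coeff_0)
  have prodroots: "(\<Prod>z\<in>#A. - z) ^ d = (x_fun ((-1) ^ d * F)) ^ size A"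
    if "\<And>z. z \<in># A \<Longrightarrow> z ^ d = x_fun F" for A
    using that
  proof (induction A)
    case (add z A)
    have "(- z) ^ d = (- 1) ^ d * z ^ d" by (metis mult_minus1 power_mult_distrib)
    then have "(- z) ^ d = x_fun ((-1) ^ d * F)" using add.prems by simp
    then show ?case using add by (simp add: power_mult_distrib del: mult_minus_left)
  qed simp
  have "coeff P' 0 ^ d = x_fun l ^ d * x_fun ((-1) ^ d * F) ^ s"
    unfolding c0 power_mult_distrib
    using prodroots[OF roots] alg_closed_proots(2)[OF P'0] degP' by simp
  then have "x_fun (coeff P 0 ^ d) = x_fun (l ^ d * ((-1) ^ d * F) ^ s)"
    by (simp add: P'_def coeff_map_poly)
  then have eq: "coeff P 0 ^ d = l ^ d * ((-1) ^ d * F) ^ s" by (simp only: x_fun_eq_iff)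
  have nz: "l ^ d * ((-1) ^ d * F) ^ s \<noteq> 0" using l0 F0 by simp
  have op: "order 0 (u ^ j) = j * order 0 u" if "u \<noteq> 0" for u :: "'k alg_closure poly" and j
    by (induction j) (use that in \<open>auto simp: order_mult\<close>)
  have cP: "coeff P 0 \<noteq> 0" using eq nz d_pos by (auto simp: power_0_left)
  have "order 0 ((-1) ^ d * F) = order 0 F"
  proof (cases "even d")
    case False then have "(-1) ^ d * F = - F" by simp
    then show ?thesis by simp
  qed simp
  then have "d * order 0 (coeff P 0) = d * order 0 l + s * order 0 F"
    using arg_cong[OF eq, of "order 0"] nz op cP l0 F0 by (simp add: order_mult)
  then have "d dvd s * order 0 F" by (metis dvd_add_right_iff dvd_triv_left)
  then have "d dvd s" using order_F by (simp add: coprime_dvd_mult_left_iff)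
  then have "d \<le> s" using \<open>s > 0\<close> by (rule dvd_imp_le)
  then show ?thesis using least[OF assms] by simp
qed

lemma ev_eq_0_iff: "ev p = 0 \<longleftrightarrow> curve dvd p"
proof
  assume p: "ev p = 0"
  obtain q r where qr: "p = curve * q + r" "degree r < degree curve"
    using monic_division[OF lead_coeff_curve] degree_curve d_pos by metis
  have "ev r = 0" using p ev_curve unfolding qr(1) by simp
  then have "r = 0" using ev_eq_0_imp_degree_ge[of r] qr(2) degree_curve by force
  then show "curve dvd p" using qr by simp
qed (use ev_curve in auto)

lemma twist_curve: "z \<in> U \<Longrightarrow> twist z curve = curve"
  by (rule poly_eqI) (auto simp: coeff_twist coeff_curve U_simps)

lemma ev_twist_eq_0_iff:
  assumes "z \<in> U"
  shows "ev (twist z p) = 0 \<longleftrightarrow> ev p = 0"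
proof -
  have *: "ev (twist z p) = 0" if "ev p = 0" "z \<in> U" for z p
    using that twist_curve ev_curve by (auto simp: ev_eq_0_iff ring_mapD(4)[OF ring_map_twist])
  show ?thesis
    using *[of p z] *[of "twist z p" "inverse z"] assms U_simps by (auto simp: twist_twist)
qed

lemma ev_twist: "ev (twist z p) = ff_eval p (x_fun [:z:] * y)"
proof -
  have "map_poly x_fun (twist z p) = pcompose (map_poly x_fun p) [:0, x_fun [:z:]:]"
  proof (rule poly_eqI)
    fix i
    have "smult (z ^ i) (coeff p i) = [:z:] ^ i * coeff p i" by (simp add: poly_const_pow)
    then have "x_fun (smult (z ^ i) (coeff p i)) = x_fun [:z:] ^ i * x_fun (coeff p i)"
      by (simp only: x_fun_simps)
    then show "coeff (map_poly x_fun (twist z p)) i = coeff (pcompose (map_poly x_fun p) [:0, x_fun [:z:]:]) i"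
      by (simp add: coeff_map_poly coeff_twist coeff_pcompose_linear)
  qed
  then show ?thesis by (simp add: ev_def ff_eval_altdef poly_pcompose mult.commute)
qed

abbreviation K :: "'k ambient set" where "K \<equiv> function_field d f"

lemma K_altdef: "K = {ev p / ev r | p r. ev r \<noteq> 0}"
  by (simp add: function_field_def ev_def y_def)

lemma K_I: "ev r \<noteq> 0 \<Longrightarrow> ev p / ev r \<in> K"
  by (auto simp: K_altdef)

lemma K_E:
  assumes "h \<in> K" obtains p r where "h = ev p / ev r" "ev r \<noteq> 0"
  using assms by (auto simp: K_altdef)

lemma K_closed: "h \<in> K \<Longrightarrow> g \<in> K \<Longrightarrow> h + g \<in> K" "h \<in> K \<Longrightarrow> g \<in> K \<Longrightarrow> h * g \<in> K"
  "ev p \<in> K" "h \<in> K \<Longrightarrow> inverse h \<in> K"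
proof -
  assume "h \<in> K" "g \<in> K"
  then obtain p r p' r' where h: "h = ev p / ev r" "ev r \<noteq> 0" "g = ev p' / ev r'" "ev r' \<noteq> 0"
    by (metis K_E)
  have 1: "h + g = ev (p * r' + p' * r) / ev (r * r')" "h * g = ev (p * p') / ev (r * r')" "ev (r * r') \<noteq> 0"
    using h by (simp_all add: add_frac_eq)
  show "h + g \<in> K" unfolding 1(1) by (rule K_I[OF 1(3)])
  show "h * g \<in> K" unfolding 1(2) by (rule K_I[OF 1(3)])
next
  show "ev p \<in> K" using K_I[of 1 p] by simp
next
  assume "h \<in> K"
  then obtain p r where h: "h = ev p / ev r" "ev r \<noteq> 0" by (metis K_E)
  show "inverse h \<in> K"
    using h K_I[of p r] K_I[of 1 0] by (cases "ev p = 0") auto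
qed

lemma K_ev [simp]: "ev p \<in> K" "x_fun u \<in> K" "y \<in> K" "0 \<in> K" "1 \<in> K"
  using K_closed(3)[of p] K_closed(3)[of "[:u:]"] K_closed(3)[of "[:0,1:]"] K_closed(3)[of 0] K_closed(3)[of 1] by auto

lemma K_divide: "h \<in> K \<Longrightarrow> g \<in> K \<Longrightarrow> h / g \<in> K"
  using K_closed by (simp add: divide_inverse)

lemma K_power: "h \<in> K \<Longrightarrow> h ^ i \<in> K"
  by (induction i) (auto simp: K_closed)

lemma K_sum: "(\<And>i. i \<in> A \<Longrightarrow> h i \<in> K) \<Longrightarrow> (\<Sum>i\<in>A. h i) \<in> K"
  by (induction A rule: infinite_finite_induct) (auto simp: K_closed)

text \<open>The automorphism of the function field over \<open>k(x)\<close> that sends \<open>y\<close> to \<open>z * y\<close>.\<close>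
definition sg :: "'k alg_closure \<Rightarrow> 'k ambient \<Rightarrow> 'k ambient" where
  "sg z h = (THE h'. \<exists>p r. ev r \<noteq> 0 \<and> h = ev p / ev r \<and> h' = ev (twist z p) / ev (twist z r))"

lemma sg_frac:
  assumes z: "z \<in> U" and r: "ev r \<noteq> 0"
  shows "sg z (ev p / ev r) = ev (twist z p) / ev (twist z r)"
  unfolding sg_def
proof (rule the_equality)
  fix h' assume "\<exists>p' r'. ev r' \<noteq> 0 \<and> ev p / ev r = ev p' / ev r' \<and> h' = ev (twist z p') / ev (twist z r')"
  then obtain p' r' where 1: "ev r' \<noteq> 0" "ev p / ev r = ev p' / ev r'" "h' = ev (twist z p') / ev (twist z r')" by blast
  have "ev (p * r' - p' * r) = 0" using 1 r by (simp add: frac_eq_eq)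
  then have "ev (twist z (p * r' - p' * r)) = 0" by (simp only: ev_twist_eq_0_iff[OF z])
  then have "ev (twist z p) * ev (twist z r') = ev (twist z p') * ev (twist z r)"
    by (simp add: ring_mapD[OF ring_map_twist])
  moreover have "ev (twist z r) \<noteq> 0" "ev (twist z r') \<noteq> 0" using 1 r ev_twist_eq_0_iff[OF z] by auto
  ultimately show "h' = ev (twist z p) / ev (twist z r)" unfolding 1(3) by (simp add: frac_eq_eq)
qed (use r in blast)

lemma sg_ev: "z \<in> U \<Longrightarrow> sg z (ev p) = ev (twist z p)"
  using sg_frac[of z 1 p] by (simp add: ring_mapD[OF ring_map_twist])

lemma sg_x_fun [simp]: "z \<in> U \<Longrightarrow> sg z (x_fun u) = x_fun u"
  using sg_ev[of z "[:u:]"] by (simp add: twist_def)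

lemma sg_y: "z \<in> U \<Longrightarrow> sg z y = x_fun [:z:] * y"
  using sg_ev[of z "[:0,1:]"] by (simp only: ev_Y ev_twist) (simp add: ff_eval_altdef map_poly_pCons)

lemma sg_hom:
  assumes z: "z \<in> U" and h: "h \<in> K" and g: "g \<in> K"
  shows "sg z (h + g) = sg z h + sg z g" "sg z (h * g) = sg z h * sg z g" "sg z h \<in> K"
proof -
  obtain p r p' r' where h: "h = ev p / ev r" "ev r \<noteq> 0" "g = ev p' / ev r'" "ev r' \<noteq> 0"
    using h g by (metis K_E)
  have 1: "h + g = ev (p * r' + p' * r) / ev (r * r')" "h * g = ev (p * p') / ev (r * r')" "ev (r * r') \<noteq> 0"
    using h by (simp_all add: add_frac_eq)
  have 2: "ev (twist z r) \<noteq> 0" "ev (twist z r') \<noteq> 0" using h ev_twist_eq_0_iff[OF z] by auto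
  show "sg z (h + g) = sg z h + sg z g"
    unfolding 1(1) sg_frac[OF z 1(3)] unfolding h(1,3) sg_frac[OF z h(2)] sg_frac[OF z h(4)]
    using 2 by (simp add: ring_mapD[OF ring_map_twist] add_frac_eq)
  show "sg z (h * g) = sg z h * sg z g"
    unfolding 1(2) sg_frac[OF z 1(3)] unfolding h(1,3) sg_frac[OF z h(2)] sg_frac[OF z h(4)]
    by (simp add: ring_mapD[OF ring_map_twist])
  show "sg z h \<in> K" unfolding h(1) sg_frac[OF z h(2)] by (rule K_I[OF 2(1)])
qed

lemma sg_0 [simp]: "z \<in> U \<Longrightarrow> sg z 0 = 0" and sg_1 [simp]: "z \<in> U \<Longrightarrow> sg z 1 = 1"
  using sg_x_fun[of z 0] sg_x_fun[of z 1] by simp_all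

lemma sg_sum: "z \<in> U \<Longrightarrow> (\<And>i. i \<in> A \<Longrightarrow> h i \<in> K) \<Longrightarrow> sg z (\<Sum>i\<in>A. h i) = (\<Sum>i\<in>A. sg z (h i))"
  by (induction A rule: infinite_finite_induct) (auto simp: sg_hom K_sum)

lemma sg_power: "z \<in> U \<Longrightarrow> h \<in> K \<Longrightarrow> sg z (h ^ i) = sg z h ^ i"
  by (induction i) (auto simp: sg_hom K_power)

lemma sg_sg:
  assumes "z \<in> U" "w \<in> U" "h \<in> K"
  shows "sg z (sg w h) = sg (z * w) h"
proof -
  obtain p r where h: "h = ev p / ev r" "ev r \<noteq> 0" using assms by (metis K_E)
  have "ev (twist w r) \<noteq> 0" using h ev_twist_eq_0_iff[OF assms(2)] by auto
  then show ?thesis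
    unfolding h(1) using h(2) assms U_simps(2)[OF assms(1,2)] by (simp add: sg_frac twist_twist)
qed

lemma sg_id: "h \<in> K \<Longrightarrow> sg 1 h = h"
  by (elim K_E) (simp add: sg_frac U_simps)

lemma sg_inverse_inverse: "z \<in> U \<Longrightarrow> h \<in> K \<Longrightarrow> sg (inverse z) (sg z h) = h"
  using sg_sg[of "inverse z" z h] U_simps by (simp add: sg_id)


subsection \<open>Averages and norms\<close>

lemma sum_U_power: "(\<Sum>z\<in>U. z ^ i) = (if d dvd i then of_nat d else 0)"
proof (cases "d dvd i")
  case True
  then obtain j where "i = d * j" by blast
  then have "z ^ i = 1" if "z \<in> U" for z using that by (simp add: power_mult U_simps)
  then show ?thesis using True by (simp add: card_U)
next
  case False
  have "\<exists>w\<in>U. w ^ i \<noteq> 1"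
  proof (rule ccontr)
    assume "\<not> ?thesis"
    then have all: "w ^ i = 1" if "w \<in> U" for w using that by blast
    define r where "r = i mod d"
    have r: "0 < r" "r < d" using False d_pos by (auto simp: r_def mod_greater_zero_iff_not_dvd)
    have "U \<subseteq> {w. poly (- 1 + monom 1 r) w = 0}"
    proof
      fix w assume w: "w \<in> U"
      have "w ^ i = (w ^ d) ^ (i div d) * w ^ r" unfolding r_def by (metis mult_div_mod_eq power_add power_mult)
      then show "w \<in> {w. poly (- 1 + monom 1 r) w = 0}" using all[OF w] U_simps(5)[OF w] by (simp add: poly_monom)
    qed
    moreover have deg: "degree (- 1 + monom (1 :: 'k alg_closure) r) = r"
      using r by (subst degree_add_eq_right) (auto simp: degree_monom_eq)
    then have nz: "- 1 + monom (1 :: 'k alg_closure) r \<noteq> 0" using r by auto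
    ultimately have "card U \<le> card {w. poly (- 1 + monom (1 :: 'k alg_closure) r) w = 0}"
      using poly_roots_finite[OF nz] by (intro card_mono) auto
    also have "\<dots> \<le> r" using card_poly_roots_bound[OF nz] deg by simp
    finally show False using r card_U by simp
  qed
  then obtain w where w: "w \<in> U" "w ^ i \<noteq> 1" by blast
  have "(\<Sum>z\<in>U. (w * z) ^ i) = (\<Sum>z\<in>U. z ^ i)"
    by (rule sum.reindex_bij_witness[where i = "\<lambda>z. inverse w * z" and j = "\<lambda>z. w * z"])
       (use w U_simps in \<open>auto simp flip: mult.assoc\<close>)
  then have "w ^ i * (\<Sum>z\<in>U. z ^ i) = (\<Sum>z\<in>U. z ^ i)" by (simp add: power_mult_distrib sum_distrib_left)
  then show ?thesis using w False by simp
qed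

text \<open>The part of \<open>p\<close> that only involves powers of \<open>Y ^ d\<close>, with \<open>Y ^ d\<close> replaced by \<open>f\<close>.\<close>
definition red :: "'k alg_closure poly poly \<Rightarrow> 'k alg_closure poly" where
  "red p = (\<Sum>j\<le>degree p. coeff p (d * j) * F ^ j)"

lemma red_altdef:
  assumes "\<And>j. j > N \<Longrightarrow> coeff p (d * j) = 0"
  shows "red p = (\<Sum>j\<le>N. coeff p (d * j) * F ^ j)"
proof -
  have big: "coeff p (d * j) = 0" if "degree p < j" for j
  proof -
    have "j \<le> d * j" using d_pos by simp
    then show ?thesis using that by (intro coeff_eq_0) linarith
  qed
  have "red p = (\<Sum>j\<le>max N (degree p). coeff p (d * j) * F ^ j)"
    unfolding red_def by (rule sum.mono_neutral_left) (use big in auto)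
  also have "\<dots> = (\<Sum>j\<le>N. coeff p (d * j) * F ^ j)"
    by (rule sum.mono_neutral_right) (use assms in auto)
  finally show ?thesis .
qed

lemma sum_ev_twist: "(\<Sum>z\<in>U. ev (twist z p)) = x_fun (of_nat d * red p)"
proof -
  define n where "n = d * degree p"
  have n: "degree p \<le> n" using d_pos by (simp add: n_def)
  have evn: "ev q = (\<Sum>i\<le>n. x_fun (coeff q i) * y ^ i)" if "\<And>i. i > n \<Longrightarrow> coeff q i = 0" for q
  proof -
    have "degree q \<le> n" using that by (intro degree_le) auto
    then show ?thesis unfolding ev_altdef
      by (intro sum.mono_neutral_left) (auto simp: coeff_eq_0)
  qed
  have "(\<Sum>z\<in>U. ev (twist z p)) = (\<Sum>z\<in>U. \<Sum>i\<le>n. x_fun (smult (z ^ i) (coeff p i)) * y ^ i)"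
    by (rule sum.cong) (use n in \<open>auto simp: evn coeff_twist coeff_eq_0\<close>)
  also have "\<dots> = (\<Sum>i\<le>n. \<Sum>z\<in>U. x_fun (smult (z ^ i) (coeff p i)) * y ^ i)" by (rule sum.swap)
  also have "\<dots> = (\<Sum>i\<le>n. x_fun (smult (\<Sum>z\<in>U. z ^ i) (coeff p i)) * y ^ i)"
    by (simp add: smult_sum ring_map_sum[OF ring_map_x_fun] sum_distrib_right)
  also have "\<dots> = (\<Sum>i\<in>(*) d ` {..degree p}. x_fun (smult (of_nat d) (coeff p i)) * y ^ i)"
  proof (rule sum.mono_neutral_cong_right)
    show "\<forall>i\<in>{..n} - (*) d ` {..degree p}. x_fun (smult (\<Sum>z\<in>U. z ^ i) (coeff p i)) * y ^ i = 0"
    proof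
      fix i assume i: "i \<in> {..n} - (*) d ` {..degree p}"
      have "\<not> d dvd i"
      proof
        assume "d dvd i"
        then obtain j where j: "i = d * j" by blast
        then have "j \<le> degree p" using i d_pos by (simp add: n_def)
        then show False using i j by auto
      qed
      then show "x_fun (smult (\<Sum>z\<in>U. z ^ i) (coeff p i)) * y ^ i = 0" by (simp add: sum_U_power)
    qed
  qed (auto simp: n_def sum_U_power)
  also have "\<dots> = (\<Sum>j\<le>degree p. x_fun (smult (of_nat d) (coeff p (d * j))) * (y ^ d) ^ j)"
    using d_pos by (subst sum.reindex) (auto simp: inj_on_def power_mult)
  also have "\<dots> = x_fun (\<Sum>j\<le>degree p. smult (of_nat d) (coeff p (d * j)) * F ^ j)"
    by (simp add: y_power ring_map_sum[OF ring_map_x_fun] del: mult_smult_left)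
  also have "(\<Sum>j\<le>degree p. smult (of_nat d) (coeff p (d * j)) * F ^ j) = of_nat d * red p"
    by (simp add: red_def sum_distrib_left of_nat_poly mult.assoc)
  finally show ?thesis .
qed

lemma x_fun_of_nat: "x_fun (of_nat n) = of_nat n" "x_fun [:of_nat n:] = of_nat n"
proof -
  show "x_fun (of_nat n) = of_nat n" by (induction n) simp_all
  then show "x_fun [:of_nat n:] = of_nat n" by (simp add: of_nat_poly)
qed

lemma of_nat_d_nonzero: "of_nat d \<noteq> (0 :: 'k ambient)"
  using d_nonzero by (simp flip: x_fun_of_nat(2))

text \<open>
  The polynomials \<open>norm_poly p\<close> and \<open>conorm_poly p\<close> represent the norm of
  \<open>p (x, y)\<close> over \<open>k(x)\<close> and the complementary factor; with them every element of the
  function field has a denominator in \<open>k[x]\<close>.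
\<close>
definition norm_poly :: "'k alg_closure poly poly \<Rightarrow> 'k alg_closure poly poly" where
  "norm_poly p = (\<Prod>z\<in>U. twist z p)"

definition conorm_poly :: "'k alg_closure poly poly \<Rightarrow> 'k alg_closure poly poly" where
  "conorm_poly p = (\<Prod>z\<in>U - {1}. twist z p)"

lemma norm_poly_split: "norm_poly p = p * conorm_poly p"
  unfolding norm_poly_def conorm_poly_def using finite_U U_simps(1) by (subst prod.remove[of _ 1]) auto

lemma twist_norm_poly:
  assumes "w \<in> U"
  shows "twist w (norm_poly p) = norm_poly p"
proof -
  have "twist w (norm_poly p) = (\<Prod>z\<in>U. twist (w * z) p)"
    by (simp add: norm_poly_def ring_map_prod[OF ring_map_twist] twist_twist)
  also have "\<dots> = norm_poly p"
    unfolding norm_poly_def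
    by (rule prod.reindex_bij_witness[where i = "\<lambda>z. inverse w * z" and j = "\<lambda>z. w * z"])
       (use assms U_simps in \<open>auto simp flip: mult.assoc\<close>)
  finally show ?thesis .
qed

lemma ev_norm_poly: "ev (norm_poly p) = x_fun (red (norm_poly p))"
proof -
  have "of_nat d * ev (norm_poly p) = x_fun (of_nat d * red (norm_poly p))"
    using sum_ev_twist[of "norm_poly p"] by (simp add: twist_norm_poly card_U)
  also have "\<dots> = of_nat d * x_fun (red (norm_poly p))"
    by (simp add: x_fun_of_nat)
  finally show ?thesis using of_nat_d_nonzero by simp
qed

lemma ev_norm_poly_eq_0_iff: "ev (norm_poly p) = 0 \<longleftrightarrow> ev p = 0"
proof -
  have "ev (norm_poly p) = (\<Prod>z\<in>U. ev (twist z p))"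
    by (simp add: norm_poly_def ring_map_prod[OF ring_map_ev])
  then show ?thesis using finite_U U_simps(1) ev_twist_eq_0_iff by auto
qed

lemma red_norm_poly_eq_0_iff: "red (norm_poly p) = 0 \<longleftrightarrow> ev p = 0"
  using ev_norm_poly_eq_0_iff[of p] by (simp add: ev_norm_poly)

lemma frac_norm:
  assumes "ev r \<noteq> 0"
  shows "ev p / ev r = ev (p * conorm_poly r) / x_fun (red (norm_poly r))"
proof -
  have "ev (norm_poly r) \<noteq> 0" using assms by (simp add: ev_norm_poly_eq_0_iff)
  then have "ev (conorm_poly r) \<noteq> 0" by (auto simp: norm_poly_split)
  moreover have "x_fun (red (norm_poly r)) = ev r * ev (conorm_poly r)"
    by (metis ev_norm_poly norm_poly_split ev_simps(4))
  ultimately show ?thesis by simp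
qed

text \<open>The projection of the function field onto \<open>k(x)\<close> that averages over the Galois group.\<close>
definition av :: "'k ambient \<Rightarrow> 'k ambient" where
  "av h = (\<Sum>z\<in>U. sg z h) / x_fun [:of_nat d:]"

lemma av_frac:
  assumes r: "ev r \<noteq> 0"
  shows "av (ev p / ev r) = x_fun (red (p * conorm_poly r)) / x_fun (red (norm_poly r))"
proof -
  let ?q = "p * conorm_poly r"
  have nz: "ev (norm_poly r) \<noteq> 0" using r by (simp add: ev_norm_poly_eq_0_iff)
  have "sg z (ev p / ev r) = ev (twist z ?q) / ev (norm_poly r)" if "z \<in> U" for z
    using sg_frac[OF that nz, of ?q] frac_norm[OF r, of p] by (simp add: twist_norm_poly[OF that] ev_norm_poly)
  then have "(\<Sum>z\<in>U. sg z (ev p / ev r)) = x_fun (of_nat d * red ?q) / ev (norm_poly r)"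
    by (simp add: sum_ev_twist flip: sum_divide_distrib)
  then show ?thesis using of_nat_d_nonzero
    unfolding av_def by (simp add: ev_norm_poly x_fun_of_nat)
qed

definition K0 :: "'k ambient set" where "K0 = {x_fun p / x_fun r | p r. r \<noteq> 0}"

lemma av_mem_K0: "h \<in> K \<Longrightarrow> av h \<in> K0"
proof (elim K_E)
  fix p r assume h: "h = ev p / ev r" "ev r \<noteq> 0"
  then show "av h \<in> K0" unfolding K0_def using av_frac[OF h(2), of p] red_norm_poly_eq_0_iff[of r] by blast
qed

lemma K0_subset_K: "t \<in> K0 \<Longrightarrow> t \<in> K"
  by (auto simp: K0_def K_divide)

lemma sg_K0:
  assumes z: "z \<in> U" and "t \<in> K0"
  shows "sg z t = t"
proof -
  obtain p r where t: "t = x_fun p / x_fun r" "r \<noteq> 0" using assms(2) by (auto simp: K0_def)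
  show ?thesis using sg_frac[OF z, of "[:r:]" "[:p:]"] t by (simp add: twist_def)
qed

lemma av_mult_K0: "t \<in> K0 \<Longrightarrow> h \<in> K \<Longrightarrow> av (h * t) = av h * t"
  by (simp add: av_def sg_hom K0_subset_K sg_K0 flip: sum_distrib_right)

lemma av_add: "h \<in> K \<Longrightarrow> g \<in> K \<Longrightarrow> av (h + g) = av h + av g"
  by (simp add: av_def sg_hom sum.distrib add_divide_distrib)

lemma av_K0: "t \<in> K0 \<Longrightarrow> av t = t"
  using of_nat_d_nonzero by (simp add: av_def sg_K0 card_U x_fun_of_nat)

lemma av_sum: "(\<And>i. i \<in> A \<Longrightarrow> h i \<in> K) \<Longrightarrow> av (\<Sum>i\<in>A. h i) = (\<Sum>i\<in>A. av (h i))"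
proof (induction A rule: infinite_finite_induct)
  case (insert x A)
  then show ?case by (simp add: av_add K_sum)
qed (auto simp: av_def)

lemma av_sg:
  assumes "w \<in> U" "h \<in> K"
  shows "av (sg w h) = av h"
proof -
  have "(\<Sum>z\<in>U. sg z (sg w h)) = (\<Sum>z\<in>U. sg z h)"
    by (rule sum.reindex_bij_witness[where i = "\<lambda>z. z * inverse w" and j = "\<lambda>z. z * w"])
       (use assms U_simps in \<open>auto simp: sg_sg mult.assoc\<close>)
  then show ?thesis by (simp add: av_def)
qed

end

section \<open>Maximal ideals of subrings of a field\<close>

abbreviation subring_of :: "'l::field set \<Rightarrow> 'l ring" where
  "subring_of R \<equiv> ring_of_type_algebra\<lparr>carrier := R\<rparr>"

lemma subring_of_simps:
  "carrier (subring_of R) = R" "x \<otimes>\<^bsub>subring_of R\<^esub> y = x * y" "x \<oplus>\<^bsub>subring_of R\<^esub> y = x + y"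
  "\<zero>\<^bsub>subring_of R\<^esub> = 0" "\<one>\<^bsub>subring_of R\<^esub> = 1"
  "x \<otimes>\<^bsub>ring_of_type_algebra\<^esub> y = x * y" "x \<oplus>\<^bsub>ring_of_type_algebra\<^esub> y = x + y"
  by (simp_all add: ring_of_type_algebra_def)

lemma ring_subring_of_iff:
  "ring (subring_of R) \<longleftrightarrow> 1 \<in> R \<and> (\<forall>x\<in>R. - x \<in> R) \<and> (\<forall>x\<in>R. \<forall>y\<in>R. x + y \<in> R \<and> x * y \<in> R)"
proof
  assume "ring (subring_of R)"
  then interpret ring "subring_of R" .
  have "- x \<in> R" if "x \<in> R" for x
  proof -
    have "\<ominus>\<^bsub>subring_of R\<^esub> x \<in> R" "x + \<ominus>\<^bsub>subring_of R\<^esub> x = 0"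
      using a_inv_closed[of x] r_neg[of x] that by (simp_all add: subring_of_simps)
    then show ?thesis by (metis add.inverse_unique)
  qed
  then show "1 \<in> R \<and> (\<forall>x\<in>R. - x \<in> R) \<and> (\<forall>x\<in>R. \<forall>y\<in>R. x + y \<in> R \<and> x * y \<in> R)"
    using one_closed a_closed m_closed by (simp add: subring_of_simps)
next
  assume R: "1 \<in> R \<and> (\<forall>x\<in>R. - x \<in> R) \<and> (\<forall>x\<in>R. \<forall>y\<in>R. x + y \<in> R \<and> x * y \<in> R)"
  then have "1 + - 1 \<in> R" by blast
  then have "0 \<in> R" by simp
  show "ring (subring_of R)"
  proof (rule ringI)
    show "abelian_group (subring_of R)"
      by (rule abelian_groupI) (use R \<open>0 \<in> R\<close> in \<open>auto simp: subring_of_simps add_ac intro!: bexI[of _ "- x" for x]\<close>)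
    show "monoid (subring_of R)"
      by (rule monoidI) (use R in \<open>auto simp: subring_of_simps\<close>)
  qed (auto simp: subring_of_simps algebra_simps)
qed

lemma ideal_subring_of_iff:
  "ideal I (subring_of R) \<longleftrightarrow> ring (subring_of R) \<and> I \<subseteq> R \<and> 0 \<in> I \<and> (\<forall>x\<in>I. \<forall>y\<in>I. x + y \<in> I) \<and> (\<forall>x\<in>I. \<forall>y\<in>R. x * y \<in> I)"
proof
  assume "ideal I (subring_of R)"
  then interpret ideal I "subring_of R" .
  show "ring (subring_of R) \<and> I \<subseteq> R \<and> 0 \<in> I \<and> (\<forall>x\<in>I. \<forall>y\<in>I. x + y \<in> I) \<and> (\<forall>x\<in>I. \<forall>y\<in>R. x * y \<in> I)"
    using ring_axioms a_subset additive_subgroup.zero_closed[OF additive_subgroup_axioms]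
      additive_subgroup.a_closed[OF additive_subgroup_axioms] I_r_closed by (simp add: subring_of_simps)
next
  assume I: "ring (subring_of R) \<and> I \<subseteq> R \<and> 0 \<in> I \<and> (\<forall>x\<in>I. \<forall>y\<in>I. x + y \<in> I) \<and> (\<forall>x\<in>I. \<forall>y\<in>R. x * y \<in> I)"
  then interpret ring "subring_of R" by blast
  have R: "1 \<in> R" "\<And>x. x \<in> R \<Longrightarrow> - x \<in> R" using I by (auto simp: ring_subring_of_iff)
  have neg: "- x \<in> I" if "x \<in> I" for x
  proof -
    have "x * (- 1) \<in> I" using I R that by blast
    then show ?thesis by simp
  qed
  show "ideal I (subring_of R)"
  proof (rule idealI)
    show "subgroup I (add_monoid (subring_of R))"
    proof (rule add.subgroupI)
      fix a assume a: "a \<in> I"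
      then have "a \<in> R" using I by blast
      then have "\<ominus>\<^bsub>subring_of R\<^esub> a = - a"
        using R(2)[of a] by (intro minus_equality) (auto simp: subring_of_simps)
      then show "\<ominus>\<^bsub>subring_of R\<^esub> a \<in> I" using neg[OF a] by simp
    qed (use I in \<open>auto simp: subring_of_simps\<close>)
  qed (use I in \<open>auto simp: subring_of_simps ring_axioms mult.commute\<close>)
qed

locale maxideal_of =
  fixes M R :: "'l::field set"
  assumes max: "maximalideal M (subring_of R)"
begin

lemma ideal: "ideal M (subring_of R)"
  using max by (rule maximalideal.axioms(1))

lemma ring: "ring (subring_of R)"
  using ideal by (simp add: ideal_subring_of_iff)

lemma R_closed: "0 \<in> R" "1 \<in> R" "x \<in> R \<Longrightarrow> - x \<in> R" "x \<in> R \<Longrightarrow> y \<in> R \<Longrightarrow> x + y \<in> R" "x \<in> R \<Longrightarrow> y \<in> R \<Longrightarrow> x * y \<in> R"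
  "x \<in> R \<Longrightarrow> y \<in> R \<Longrightarrow> x - y \<in> R"
proof -
  have 1: "1 \<in> R" "\<And>x. x \<in> R \<Longrightarrow> - x \<in> R" "\<And>x y. x \<in> R \<Longrightarrow> y \<in> R \<Longrightarrow> x + y \<in> R" "\<And>x y. x \<in> R \<Longrightarrow> y \<in> R \<Longrightarrow> x * y \<in> R"
    using ring by (auto simp: ring_subring_of_iff)
  show "1 \<in> R" "x \<in> R \<Longrightarrow> - x \<in> R" "x \<in> R \<Longrightarrow> y \<in> R \<Longrightarrow> x + y \<in> R" "x \<in> R \<Longrightarrow> y \<in> R \<Longrightarrow> x * y \<in> R"
    using 1 by blast+
  show "0 \<in> R" using 1(3)[OF 1(1) 1(2)[OF 1(1)]] by simp
  show "x \<in> R \<Longrightarrow> y \<in> R \<Longrightarrow> x - y \<in> R" using 1(3)[of x "- y"] 1(2)[of y] by simp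
qed

lemma M_closed: "M \<subseteq> R" "0 \<in> M" "x \<in> M \<Longrightarrow> y \<in> M \<Longrightarrow> x + y \<in> M" "x \<in> M \<Longrightarrow> y \<in> R \<Longrightarrow> x * y \<in> M"
  "x \<in> R \<Longrightarrow> y \<in> M \<Longrightarrow> x * y \<in> M" "x \<in> M \<Longrightarrow> - x \<in> M" "x \<in> M \<Longrightarrow> y \<in> M \<Longrightarrow> x - y \<in> M"
proof -
  have 1: "M \<subseteq> R" "0 \<in> M" "\<And>x y. x \<in> M \<Longrightarrow> y \<in> M \<Longrightarrow> x + y \<in> M" "\<And>x y. x \<in> M \<Longrightarrow> y \<in> R \<Longrightarrow> x * y \<in> M"
    using ideal by (auto simp: ideal_subring_of_iff)
  show "M \<subseteq> R" "0 \<in> M" "x \<in> M \<Longrightarrow> y \<in> M \<Longrightarrow> x + y \<in> M" "x \<in> M \<Longrightarrow> y \<in> R \<Longrightarrow> x * y \<in> M"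
    using 1 by blast+
  show "x \<in> R \<Longrightarrow> y \<in> M \<Longrightarrow> x * y \<in> M" using 1(4)[of y x] by (simp add: mult.commute)
  have neg: "- x \<in> M" if "x \<in> M" for x using 1(4)[OF that R_closed(3)[OF R_closed(2)]] by simp
  then show "x \<in> M \<Longrightarrow> - x \<in> M" .
  show "x \<in> M \<Longrightarrow> y \<in> M \<Longrightarrow> x - y \<in> M" using 1(3)[of x "- y"] neg[of y] by simp
qed

lemma R_power: "x \<in> R \<Longrightarrow> x ^ n \<in> R"
  by (induction n) (auto simp: R_closed)

lemma R_sum: "(\<And>i. i \<in> A \<Longrightarrow> h i \<in> R) \<Longrightarrow> (\<Sum>i\<in>A. h i) \<in> R"
  by (induction A rule: infinite_finite_induct) (auto simp: R_closed)

lemma M_sum: "(\<And>i. i \<in> A \<Longrightarrow> h i \<in> M) \<Longrightarrow> (\<Sum>i\<in>A. h i) \<in> M"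
  by (induction A rule: infinite_finite_induct) (auto simp: M_closed)

lemma one_notin: "1 \<notin> M"
proof
  assume "1 \<in> M"
  then have "x \<in> M" if "x \<in> R" for x using M_closed(4)[of 1 x] that by simp
  then have "M = R" using M_closed(1) by blast
  moreover have "R \<noteq> M" using maximalideal.I_notcarr[OF max] by (simp add: subring_of_simps)
  ultimately show False by simp
qed

lemma unit_notin: "x \<in> M \<Longrightarrow> y \<in> R \<Longrightarrow> x * y \<noteq> 1"
  using M_closed(4) one_notin by metis

text \<open>
  The residue ring of a maximal ideal is a field.
\<close>
lemma inverse_mod:
  assumes t: "t \<in> R" "t \<notin> M"
  shows "\<exists>b\<in>R. 1 - t * b \<in> M"
proof -
  define J where "J = {x + t * b | x b. x \<in> M \<and> b \<in> R}"
  have JR: "J \<subseteq> R" using M_closed(1) R_closed t(1) by (auto simp: J_def)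
  have "ideal J (subring_of R)"
    unfolding ideal_subring_of_iff
  proof (intro conjI ballI)
    have "0 + t * 0 \<in> J" unfolding J_def using M_closed R_closed by blast
    then show "0 \<in> J" by simp
    fix x assume "x \<in> J"
    then obtain x1 b1 where x: "x = x1 + t * b1" "x1 \<in> M" "b1 \<in> R" by (auto simp: J_def)
    {
      fix z assume "z \<in> J"
      then obtain x2 b2 where z: "z = x2 + t * b2" "x2 \<in> M" "b2 \<in> R" by (auto simp: J_def)
      have "x + z = (x1 + x2) + t * (b1 + b2)" using x z by (simp add: algebra_simps)
      then show "x + z \<in> J" unfolding J_def using x z M_closed(3) R_closed(4) by blast
    next
      fix z assume z: "z \<in> R"
      have "x * z = x1 * z + t * (b1 * z)" using x by (simp add: algebra_simps)
      then show "x * z \<in> J" unfolding J_def using x z M_closed(4) R_closed(5) by blast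
    }
  qed (use ring JR in auto)
  moreover have MJ: "M \<subseteq> J"
  proof
    fix x assume "x \<in> M"
    moreover have "x = x + t * 0" by simp
    ultimately show "x \<in> J" unfolding J_def using R_closed by blast
  qed
  ultimately have "J = M \<or> J = R"
    using maximalideal.I_maximal[OF max, of J] JR by (simp add: subring_of_simps)
  moreover have "t \<in> J"
  proof -
    have "t = 0 + t * 1" by simp
    then show ?thesis unfolding J_def using M_closed R_closed by blast
  qed
  ultimately have "1 \<in> J" using t R_closed by auto
  then obtain x b where "1 = x + t * b" "x \<in> M" "b \<in> R" by (auto simp: J_def)
  then have "1 - t * b = x" by (simp add: algebra_simps)
  then show ?thesis using \<open>x \<in> M\<close> \<open>b \<in> R\<close> by blast
qed

lemma prime:
  assumes "x \<in> R" "y \<in> R" "x * y \<in> M" "x \<notin> M"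
  shows "y \<in> M"
proof -
  obtain b where b: "b \<in> R" "1 - x * b \<in> M" using inverse_mod assms by blast
  have "y = (1 - x * b) * y + (x * y) * b" by (simp add: algebra_simps)
  then show ?thesis using M_closed(3,4) b assms by metis
qed

lemma prime_power: "x \<in> R \<Longrightarrow> x ^ n \<in> M \<Longrightarrow> x \<in> M"
proof (induction n)
  case 0 then show ?case using one_notin by simp
next
  case (Suc n)
  then show ?case using prime[of x "x ^ n"] R_power by auto
qed

end


section \<open>The local ring of a point\<close>

definition total_degree_le :: "'a::zero poly poly \<Rightarrow> nat \<Rightarrow> bool" where
  "total_degree_le p N \<longleftrightarrow> (\<forall>i j. coeff (coeff p j) i \<noteq> 0 \<longrightarrow> i + j \<le> N)"

lemma total_degree_le_exists: "\<exists>N. total_degree_le p N"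
proof -
  have "i + j \<le> degree p + (\<Sum>j\<le>degree p. degree (coeff p j))" if "coeff (coeff p j) i \<noteq> 0" for i j
  proof -
    have j: "j \<le> degree p" using that by (intro le_degree) auto
    have "i \<le> degree (coeff p j)" using that by (rule le_degree)
    also have "\<dots> \<le> (\<Sum>j\<le>degree p. degree (coeff p j))" using j by (intro member_le_sum) auto
    finally show ?thesis using j by simp
  qed
  then show ?thesis unfolding total_degree_le_def by blast
qed

lemma total_degree_le_iff: "total_degree p \<le> N \<longleftrightarrow> total_degree_le p N"
proof
  have "total_degree_le p (total_degree p)"
    unfolding total_degree_def total_degree_le_def[symmetric] by (rule LeastI_ex[OF total_degree_le_exists])
  then show "total_degree p \<le> N \<Longrightarrow> total_degree_le p N" by (force simp: total_degree_le_def)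
  show "total_degree_le p N \<Longrightarrow> total_degree p \<le> N"
    unfolding total_degree_def total_degree_le_def[symmetric] by (rule Least_le)
qed

lemma total_degree_le_altdef:
  "total_degree_le p N \<longleftrightarrow> (\<forall>j. coeff p j = 0 \<or> degree (coeff p j) + j \<le> N)"
  unfolding total_degree_le_def
proof safe
  fix j assume "\<forall>i j. coeff (coeff p j) i \<noteq> 0 \<longrightarrow> i + j \<le> N" "\<not> degree (coeff p j) + j \<le> N"
  then have "coeff (coeff p j) (degree (coeff p j)) = 0" by blast
  then show "coeff p j = 0" by simp
next
  fix i j assume "\<forall>j. coeff p j = 0 \<or> degree (coeff p j) + j \<le> N" "coeff (coeff p j) i \<noteq> 0"
  then have "coeff p j \<noteq> 0" "degree (coeff p j) + j \<le> N" "i \<le> degree (coeff p j)"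
    by (auto intro: le_degree) (metis coeff_0)
  then show "i + j \<le> N" by simp
qed

lemma total_degree_le_mult:
  fixes p q :: "'a::comm_ring_1 poly poly"
  assumes "total_degree_le p N" "total_degree_le q M"
  shows "total_degree_le (p * q) (N + M)"
  unfolding total_degree_le_def
proof (intro allI impI)
  fix i j assume "coeff (coeff (p * q) j) i \<noteq> 0"
  then have "(\<Sum>k\<le>j. coeff (coeff p k * coeff q (j - k)) i) \<noteq> 0" by (simp add: coeff_mult coeff_sum)
  then obtain k where k: "k \<le> j" "coeff (coeff p k * coeff q (j - k)) i \<noteq> 0"
    by (metis (mono_tags, lifting) atMost_iff sum.neutral)
  then have "(\<Sum>l\<le>i. coeff (coeff p k) l * coeff (coeff q (j - k)) (i - l)) \<noteq> 0" by (simp add: coeff_mult)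
  then obtain l where l: "l \<le> i" "coeff (coeff p k) l * coeff (coeff q (j - k)) (i - l) \<noteq> 0"
    by (metis (mono_tags, lifting) atMost_iff sum.neutral)
  then have "coeff (coeff p k) l \<noteq> 0" "coeff (coeff q (j - k)) (i - l) \<noteq> 0" by auto
  then have "l + k \<le> N" "(i - l) + (j - k) \<le> M"
    using assms unfolding total_degree_le_def by blast+
  then show "i + j \<le> N + M" using k l by simp
qed

lemma total_degree_le_add:
  "total_degree_le p N \<Longrightarrow> total_degree_le q N \<Longrightarrow> total_degree_le (p + q) N"
  unfolding total_degree_le_def by (metis add.right_neutral coeff_add)

lemma total_degree_le_uminus: "total_degree_le (- p) N \<longleftrightarrow> total_degree_le (p :: 'a::comm_ring_1 poly poly) N"
  by (simp add: total_degree_le_def)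

lemma total_degree_le_twist: "total_degree_le p N \<Longrightarrow> total_degree_le (twist z p) N"
  unfolding total_degree_le_def coeff_twist coeff_smult by (metis mult_zero_right)

lemma total_degree_le_const: "total_degree_le [:u:] N \<longleftrightarrow> u = 0 \<or> degree u \<le> N"
  unfolding total_degree_le_altdef by (force simp: coeff_pCons split: nat.splits)

lemma total_degree_le_0 [simp]: "total_degree_le 0 N"
  by (simp add: total_degree_le_def)

lemma total_degree_le_1 [simp]: "total_degree_le 1 N"
  using total_degree_le_const[of 1 N] by (simp add: one_pCons)

text \<open>
  A point of the projective closure, given by the functional \<open>H N\<close> that evaluates a form of
  degree \<open>N\<close> at a fixed coordinate vector of the point.
\<close>
locale local_point = kummer d f for d and f :: "'k::{finite,field} poly" +
  fixes P :: "('k alg_closure \<times> 'k alg_closure \<times> 'k alg_closure) set"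
    and H :: "nat \<Rightarrow> 'k alg_closure poly poly \<Rightarrow> 'k alg_closure"
  assumes H_iff: "total_degree_le r N \<Longrightarrow> (\<forall>v\<in>P. homog_eval N r v \<noteq> 0) \<longleftrightarrow> H N r \<noteq> 0"
    and H_mult: "total_degree_le p N \<Longrightarrow> total_degree_le q N' \<Longrightarrow> H (N + N') (p * q) = H N p * H N' q"
    and H_add: "H N (p + q) = H N p + H N q"
    and H_const: "H 0 [:[:c:]:] = c"
    and H_nonzero: "total_degree_le r N \<Longrightarrow> H N r \<noteq> 0 \<Longrightarrow> ev r \<noteq> 0"
begin

definition O_P :: "'k ambient set" where
  "O_P = {ev p / ev r | p r N. total_degree_le p N \<and> total_degree_le r N \<and> H N r \<noteq> 0}"

definition m_P :: "'k ambient set" where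
  "m_P = {ev p / ev r | p r N. total_degree_le p N \<and> total_degree_le r N \<and> H N p = 0 \<and> H N r \<noteq> 0}"

lemma local_ring_eq: "local_ring d f P = O_P"
proof -
  have "local_ring d f P = {ev p / ev r | p r. ev r \<noteq> 0 \<and>
      (\<exists>N. total_degree_le p N \<and> total_degree_le r N \<and> (\<forall>v\<in>P. homog_eval N r v \<noteq> 0))}"
    by (simp add: local_ring_def ev_def y_def total_degree_le_iff)
  also have "\<dots> = O_P" unfolding O_P_def using H_iff H_nonzero by blast
  finally show ?thesis .
qed

lemma O_I: "total_degree_le p N \<Longrightarrow> total_degree_le r N \<Longrightarrow> H N r \<noteq> 0 \<Longrightarrow> ev p / ev r \<in> O_P"
  unfolding O_P_def by blast

lemma m_I: "total_degree_le p N \<Longrightarrow> total_degree_le r N \<Longrightarrow> H N p = 0 \<Longrightarrow> H N r \<noteq> 0 \<Longrightarrow> ev p / ev r \<in> m_P"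
  unfolding m_P_def by blast

lemma O_E:
  assumes "h \<in> O_P"
  obtains p r N where "h = ev p / ev r" "total_degree_le p N" "total_degree_le r N" "H N r \<noteq> 0" "ev r \<noteq> 0"
proof -
  from assms obtain p r N where *: "h = ev p / ev r" "total_degree_le p N" "total_degree_le r N" "H N r \<noteq> 0"
    unfolding O_P_def by blast
  show thesis by (rule that[OF * H_nonzero[OF *(3) *(4)]])
qed

lemma m_E:
  assumes "h \<in> m_P"
  obtains p r N where "h = ev p / ev r" "total_degree_le p N" "total_degree_le r N" "H N p = 0" "H N r \<noteq> 0" "ev r \<noteq> 0"
proof -
  from assms obtain p r N where *: "h = ev p / ev r" "total_degree_le p N" "total_degree_le r N" "H N p = 0" "H N r \<noteq> 0"
    unfolding m_P_def by blast
  show thesis by (rule that[OF * H_nonzero[OF *(3) *(5)]])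
qed

lemma H_uminus: "H N (- p) = - H N p"
proof -
  have "H N 0 + H N 0 = H N 0 + 0" using H_add[of N 0 0] by simp
  then have "H N 0 = 0" by (simp only: add_left_cancel)
  then show ?thesis using H_add[of N p "- p"] by (simp add: eq_neg_iff_add_eq_0 add.commute)
qed

lemma H_1: "H 0 1 = 1"
  using H_const[of 1] by (simp flip: one_pCons)

lemma m_subset_O: "m_P \<subseteq> O_P"
  unfolding m_P_def O_P_def by blast

lemma O_const: "x_fun [:c:] \<in> O_P"
  using O_I[of "[:[:c:]:]" 0 1] by (simp add: total_degree_le_const H_1)

lemma O_0 [simp]: "0 \<in> O_P" and O_1 [simp]: "1 \<in> O_P"
  using O_const[of 0] O_const[of 1] by (simp_all flip: one_pCons)

lemma frac_combine:
  assumes "h = ev p / ev r" "total_degree_le p N" "total_degree_le r N" "H N r \<noteq> 0" "ev r \<noteq> 0"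
    "g = ev p' / ev r'" "total_degree_le p' N'" "total_degree_le r' N'" "H N' r' \<noteq> 0" "ev r' \<noteq> 0"
  shows "h + g = ev (p * r' + p' * r) / ev (r * r')" "h * g = ev (p * p') / ev (r * r')"
    "total_degree_le (p * r' + p' * r) (N + N')" "total_degree_le (r * r') (N + N')" "total_degree_le (p * p') (N + N')"
    "H (N + N') (r * r') \<noteq> 0" "H (N + N') (p * r' + p' * r) = H N p * H N' r' + H N' p' * H N r"
    "H (N + N') (p * p') = H N p * H N' p'"
proof -
  show "h + g = ev (p * r' + p' * r) / ev (r * r')" "h * g = ev (p * p') / ev (r * r')"
    using assms by (simp_all add: add_frac_eq)
  show "total_degree_le (p * r' + p' * r) (N + N')"
    using assms total_degree_le_mult[of p N r' N'] total_degree_le_mult[of p' N' r N]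
    by (intro total_degree_le_add) (simp_all add: add.commute)
  show "H (N + N') (p * r' + p' * r) = H N p * H N' r' + H N' p' * H N r"
    using assms H_mult[of p N r' N'] H_mult[of p' N' r N] by (simp add: H_add add.commute)
qed (use assms in \<open>auto simp: H_mult total_degree_le_mult\<close>)

lemma O_closed: "h \<in> O_P \<Longrightarrow> g \<in> O_P \<Longrightarrow> h + g \<in> O_P" "h \<in> O_P \<Longrightarrow> g \<in> O_P \<Longrightarrow> h * g \<in> O_P" "h \<in> O_P \<Longrightarrow> - h \<in> O_P"
proof -
  show mult: "h * g \<in> O_P" if hg: "h \<in> O_P" "g \<in> O_P" for h g
  proof -
    obtain p r N where 1: "h = ev p / ev r" "total_degree_le p N" "total_degree_le r N" "H N r \<noteq> 0" "ev r \<noteq> 0"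
      using hg(1) by (rule O_E)
    obtain p' r' N' where 2: "g = ev p' / ev r'" "total_degree_le p' N'" "total_degree_le r' N'" "H N' r' \<noteq> 0" "ev r' \<noteq> 0"
      using hg(2) by (rule O_E)
    note c = frac_combine[OF 1 2]
    show ?thesis unfolding c(2) by (rule O_I[OF c(5,4,6)])
  qed
  show "h + g \<in> O_P" if hg: "h \<in> O_P" "g \<in> O_P" for h g
  proof -
    obtain p r N where 1: "h = ev p / ev r" "total_degree_le p N" "total_degree_le r N" "H N r \<noteq> 0" "ev r \<noteq> 0"
      using hg(1) by (rule O_E)
    obtain p' r' N' where 2: "g = ev p' / ev r'" "total_degree_le p' N'" "total_degree_le r' N'" "H N' r' \<noteq> 0" "ev r' \<noteq> 0"
      using hg(2) by (rule O_E)
    note c = frac_combine[OF 1 2]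
    show ?thesis unfolding c(1) by (rule O_I[OF c(3,4,6)])
  qed
  show "- h \<in> O_P" if "h \<in> O_P" for h
  proof -
    have "- (1 :: 'k alg_closure poly) = [:- 1:]" by (simp add: one_pCons)
    then have "x_fun [:- 1:] = (- 1 :: 'k ambient)" by (metis x_fun_simps(2,5))
    then show ?thesis using mult[OF O_const[of "- 1"] that] by simp
  qed
qed

lemma m_closed: "0 \<in> m_P" "h \<in> m_P \<Longrightarrow> g \<in> m_P \<Longrightarrow> h + g \<in> m_P" "h \<in> m_P \<Longrightarrow> g \<in> O_P \<Longrightarrow> h * g \<in> m_P"
proof -
  show "0 \<in> m_P" using m_I[of "[:[:0:]:]" 0 1] by (simp add: total_degree_le_const H_1 H_const[of 0, simplified])
  show "h * g \<in> m_P" if hg: "h \<in> m_P" "g \<in> O_P" for h g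
  proof -
    obtain p r N where 1: "h = ev p / ev r" "total_degree_le p N" "total_degree_le r N" "H N p = 0" "H N r \<noteq> 0" "ev r \<noteq> 0"
      using hg(1) by (rule m_E)
    obtain p' r' N' where 2: "g = ev p' / ev r'" "total_degree_le p' N'" "total_degree_le r' N'" "H N' r' \<noteq> 0" "ev r' \<noteq> 0"
      using hg(2) by (rule O_E)
    note c = frac_combine[OF 1(1,2,3,5,6) 2]
    show ?thesis unfolding c(2) by (rule m_I[OF c(5,4) _ c(6)]) (simp add: c 1)
  qed
  show "h + g \<in> m_P" if hg: "h \<in> m_P" "g \<in> m_P" for h g
  proof -
    obtain p r N where 1: "h = ev p / ev r" "total_degree_le p N" "total_degree_le r N" "H N p = 0" "H N r \<noteq> 0" "ev r \<noteq> 0"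
      using hg(1) by (rule m_E)
    obtain p' r' N' where 2: "g = ev p' / ev r'" "total_degree_le p' N'" "total_degree_le r' N'" "H N' p' = 0" "H N' r' \<noteq> 0" "ev r' \<noteq> 0"
      using hg(2) by (rule m_E)
    note c = frac_combine[OF 1(1,2,3,5,6) 2(1,2,3,5,6)]
    show ?thesis unfolding c(1) by (rule m_I[OF c(3,4) _ c(6)]) (simp add: c 1 2)
  qed
qed

lemma O_power: "h \<in> O_P \<Longrightarrow> h ^ n \<in> O_P"
  by (induction n) (auto simp: O_closed)

lemma m_sum: "(\<And>i. i \<in> A \<Longrightarrow> h i \<in> m_P) \<Longrightarrow> (\<Sum>i\<in>A. h i) \<in> m_P"
  by (induction A rule: infinite_finite_induct) (auto simp: m_closed)

lemma O_unit:
  assumes "h \<in> O_P" "h \<notin> m_P"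
  shows "h \<noteq> 0" "inverse h \<in> O_P"
proof -
  show "h \<noteq> 0" using assms(2) m_closed(1) by auto
  obtain p r N where 1: "h = ev p / ev r" "total_degree_le p N" "total_degree_le r N" "H N r \<noteq> 0" "ev r \<noteq> 0"
    using assms(1) by (rule O_E)
  then have "H N p \<noteq> 0" using assms(2) m_I by metis
  then have "ev r / ev p \<in> O_P" by (intro O_I[OF 1(3,2)])
  then show "inverse h \<in> O_P" by (simp add: 1(1))
qed

lemma one_notin_m: "1 \<notin> m_P"
proof
  assume "1 \<in> m_P"
  then obtain p r N where 1: "1 = ev p / ev r" "total_degree_le p N" "total_degree_le r N" "H N p = 0" "H N r \<noteq> 0" "ev r \<noteq> 0"
    by (rule m_E)
  then have "ev (r + - p) = 0" by (simp add: field_simps)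
  moreover have "H N (r + - p) \<noteq> 0" using 1 by (simp add: H_add H_uminus del: add_uminus_conv_diff)
  moreover have "total_degree_le (r + - p) N" using 1 by (intro total_degree_le_add) (simp_all add: total_degree_le_uminus)
  ultimately show False using H_nonzero by blast
qed

lemma O_subset_K: "O_P \<subseteq> K"
proof
  fix h assume "h \<in> O_P"
  then show "h \<in> K" by (rule O_E) (simp add: K_I)
qed

definition R_P :: "'k ambient set" where "R_P = integral_closure O_P K"

lemma R_subset_K: "R_P \<subseteq> K"
  by (auto simp: R_P_def integral_closure_def)

lemma R_I: "h \<in> K \<Longrightarrow> lead_coeff p = 1 \<Longrightarrow> (\<And>i. coeff p i \<in> O_P) \<Longrightarrow> poly p h = 0 \<Longrightarrow> h \<in> R_P"
  by (auto simp: R_P_def integral_closure_def)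

lemma R_E:
  assumes "h \<in> R_P"
  obtains p where "h \<in> K" "lead_coeff p = 1" "\<forall>i. coeff p i \<in> O_P" "poly p h = 0"
  using assms by (auto simp: R_P_def integral_closure_def)

lemma O_subset_R: "O_P \<subseteq> R_P"
proof
  fix h assume h: "h \<in> O_P"
  show "h \<in> R_P"
  proof (rule R_I[of h "[:- h, 1:]"])
    show "coeff [:- h, 1:] i \<in> O_P" for i
      using h O_closed by (auto simp: coeff_pCons split: nat.splits)
  qed (use h O_subset_K in auto)
qed

text \<open>
  The maximal ideal of the local ring lies in every maximal ideal \<open>M\<close> of the integral closure. Were
  \<open>t \<in> m_P\<close> invertible modulo \<open>M\<close> with inverse \<open>b\<close>, multiplying an integral equation of \<open>b\<close> by a
  power of \<open>t\<close> would produce an element of \<open>M\<close> of the form \<open>1 + a\<close> with \<open>a \<in> m_P\<close>, a unit.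
\<close>
lemma m_subset_maximal:
  assumes M: "maximalideal M (subring_of R_P)"
  shows "m_P \<subseteq> M"
proof
  fix t assume t: "t \<in> m_P"
  interpret maxideal_of M R_P by (rule maxideal_of.intro[OF M])
  have tO: "t \<in> O_P" and tR: "t \<in> R_P" using t m_subset_O O_subset_R by auto
  show "t \<in> M"
  proof (rule ccontr)
    assume "t \<notin> M"
    then obtain b where b: "b \<in> R_P" "1 - t * b \<in> M" using inverse_mod tR by blast
    obtain p where bK: "b \<in> K" and p: "lead_coeff p = 1" "\<forall>i. coeff p i \<in> O_P" "poly p b = 0"
      using b(1) by (rule R_E)
    define n where "n = degree p"
    have pw: "(t * b) ^ i - 1 \<in> M" for i
    proof (induction i)
      case (Suc i)
      have "(t * b) ^ Suc i - 1 = ((t * b) ^ i - 1) * (t * b) + - (1 - t * b)" by (simp add: algebra_simps)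
      then show ?case using Suc b tR M_closed(3,4,6) R_closed(5) by metis
    qed (simp add: M_closed)
    define a where "a i = coeff p i * t ^ (n - i)" for i
    have aO: "a i \<in> O_P" for i using p(2) tO O_closed O_power by (auto simp: a_def)
    have "(\<Sum>i\<le>n. a i * (t * b) ^ i) = (\<Sum>i\<le>n. t ^ n * (coeff p i * b ^ i))"
    proof (rule sum.cong)
      fix i assume "i \<in> {..n}"
      then have "t ^ n = t ^ (n - i) * t ^ i" by (simp flip: power_add)
      then show "a i * (t * b) ^ i = t ^ n * (coeff p i * b ^ i)" by (simp add: a_def power_mult_distrib)
    qed simp
    also have "\<dots> = t ^ n * poly p b" by (simp add: poly_altdef n_def sum_distrib_left)
    finally have "(\<Sum>i\<le>n. a i * (t * b) ^ i) = 0" using p(3) by simp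
    then have "(\<Sum>i\<le>n. a i) = - (\<Sum>i\<le>n. a i * ((t * b) ^ i - 1))"
      by (simp add: algebra_simps sum_subtractf)
    moreover have "(\<Sum>i\<le>n. a i * ((t * b) ^ i - 1)) \<in> M"
      using pw aO O_subset_R by (intro M_sum M_closed(5)) auto
    ultimately have sM: "(\<Sum>i\<le>n. a i) \<in> M" using M_closed(6) by simp
    have "(\<Sum>i\<le>n. a i) = a n + (\<Sum>i<n. a i)" by (simp add: lessThan_Suc_atMost[symmetric] add.commute)
    also have "a n = 1" using p(1) by (simp add: a_def n_def)
    finally have s: "(\<Sum>i\<le>n. a i) = 1 + (\<Sum>i<n. a i)" .
    have m: "(\<Sum>i<n. a i) \<in> m_P"
    proof (rule m_sum)
      fix i assume "i \<in> {..<n}"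
      then have "a i = t * (t ^ (n - i - 1) * coeff p i)"
        by (cases "n - i") (simp_all add: a_def mult.commute mult.left_commute)
      then show "a i \<in> m_P" using m_closed(3)[OF t] p(2) tO O_power O_closed(2) by simp
    qed
    have "(\<Sum>i\<le>n. a i) \<notin> m_P"
    proof
      assume "(\<Sum>i\<le>n. a i) \<in> m_P"
      then have "(\<Sum>i\<le>n. a i) + (\<Sum>i<n. a i) * (- 1) \<in> m_P" using m O_closed(3)[OF O_1] m_closed(2,3) by blast
      then show False using s one_notin_m by simp
    qed
    moreover have "(\<Sum>i\<le>n. a i) \<in> O_P" unfolding s using m m_subset_O O_closed(1) by auto
    ultimately have "(\<Sum>i\<le>n. a i) \<noteq> 0" "inverse (\<Sum>i\<le>n. a i) \<in> R_P" using O_unit O_subset_R by blast+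
    then show False using unit_notin[OF sM] by force
  qed
qed

text \<open>There is only one point above an integrally closed local ring, because the elements outside \<open>m_P\<close> are units.\<close>
lemma maximalideal_iff_normal:
  assumes "R_P = O_P"
  shows "maximalideal M (subring_of R_P) \<longleftrightarrow> M = m_P"
proof
  assume M: "maximalideal M (subring_of R_P)"
  interpret maxideal_of M R_P by (rule maxideal_of.intro[OF M])
  have "x \<in> m_P" if "x \<in> M" for x
  proof (rule ccontr)
    assume "x \<notin> m_P"
    moreover have "x \<in> O_P" using that M_closed(1) assms by blast
    ultimately have "x \<noteq> 0" "inverse x \<in> R_P" using O_unit assms by auto
    then show False using unit_notin[OF that] by force
  qed
  then show "M = m_P" using m_subset_maximal[OF M] by blast
next
  assume M: "M = m_P"
  have ring: "ring (subring_of O_P)" using O_closed by (auto simp: ring_subring_of_iff)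
  show "maximalideal M (subring_of R_P)"
    unfolding M assms
  proof (rule maximalidealI)
    show "ideal m_P (subring_of O_P)"
      unfolding ideal_subring_of_iff using ring m_subset_O m_closed by blast
    show "carrier (subring_of O_P) \<noteq> m_P" using one_notin_m O_1 by (auto simp: subring_of_simps)
    fix J assume J: "ideal J (subring_of O_P)" "m_P \<subseteq> J" "J \<subseteq> carrier (subring_of O_P)"
    have J': "J \<subseteq> O_P" "\<And>x y. x \<in> J \<Longrightarrow> y \<in> O_P \<Longrightarrow> x * y \<in> J" using J(1) by (auto simp: ideal_subring_of_iff)
    have "J = O_P" if x: "x \<in> J" "x \<notin> m_P" for x
    proof -
      have "x \<noteq> 0" "inverse x \<in> O_P" using O_unit[of x] x J' by auto
      then have "1 \<in> J" using J'(2)[OF x(1), of "inverse x"] by simp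
      then have "y \<in> J" if "y \<in> O_P" for y using J'(2)[of 1 y] that by simp
      then show ?thesis using J'(1) by blast
    qed
    then show "J = m_P \<or> J = carrier (subring_of O_P)" using J(2) by (auto simp: subring_of_simps)
  qed
qed

end

section \<open>Totally ramified points\<close>

text \<open>
  The valuation \<open>ord\<close> of \<open>k(x)\<close> is the one below the point. As \<open>ord F\<close> is
  prime to \<open>d\<close>, it is totally ramified in the function field. The assumption
  \<open>ord_average\<close> says that the average over the Galois group of an element of the local ring has
  nonnegative valuation, and \<open>ord_pos_mem_maximal\<close> that functions of \<open>x\<close> with positive
  valuation vanish at every point above.
\<close>
locale ramified_point = local_point d f P H
  for d and f :: "'k::{finite,field} poly" and P :: "('k alg_closure \<times> 'k alg_closure \<times> 'k alg_closure) set" and H +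
  fixes ord :: "'k alg_closure poly \<Rightarrow> int"
  assumes ord_mult: "p \<noteq> 0 \<Longrightarrow> q \<noteq> 0 \<Longrightarrow> ord (p * q) = ord p + ord q"
    and ord_add: "p \<noteq> 0 \<Longrightarrow> q \<noteq> 0 \<Longrightarrow> p + q \<noteq> 0 \<Longrightarrow> ord (p + q) \<ge> min (ord p) (ord q)"
    and ord_residue: "p \<noteq> 0 \<Longrightarrow> q \<noteq> 0 \<Longrightarrow> ord p = ord q \<Longrightarrow> \<exists>c. p - smult c q = 0 \<or> ord (p - smult c q) > ord q"
    and ord_F: "coprime (int d) (ord F)"
    and H_twist: "z \<in> U \<Longrightarrow> total_degree_le R N \<Longrightarrow> H N (twist z R) = 0 \<longleftrightarrow> H N R = 0"
    and ord_average: "total_degree_le S N \<Longrightarrow> total_degree_le R N \<Longrightarrow> H N R \<noteq> 0 \<Longrightarrow>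
      red (S * conorm_poly R) = 0 \<or> ord (red (S * conorm_poly R)) \<ge> ord (red (norm_poly R))"
    and ord_pos_mem_maximal: "maximalideal M (subring_of R_P) \<Longrightarrow> r \<noteq> 0 \<Longrightarrow> p = 0 \<or> ord p > ord r \<Longrightarrow>
      x_fun p / x_fun r \<in> R_P \<Longrightarrow> x_fun p / x_fun r \<in> M"
begin

text \<open>
  The valuation ring of \<open>ord\<close> in \<open>k(x)\<close>.
\<close>
definition A :: "'k ambient set" where
  "A = {x_fun p / x_fun r | p r. r \<noteq> 0 \<and> (p = 0 \<or> ord p \<ge> ord r)}"

definition mA :: "'k ambient set" where
  "mA = {x_fun p / x_fun r | p r. r \<noteq> 0 \<and> (p = 0 \<or> ord p > ord r)}"

lemma ord_cross:
  assumes "p * r' = p' * r" "r \<noteq> 0" "r' \<noteq> 0" "p \<noteq> 0"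
  shows "p' \<noteq> 0" "ord p + ord r' = ord p' + ord r"
proof -
  show p': "p' \<noteq> 0" using assms by auto
  show "ord p + ord r' = ord p' + ord r"
    using arg_cong[OF assms(1), of ord] ord_mult[OF assms(4,3)] ord_mult[OF p' assms(2)] by linarith
qed

lemma frac_eq_cross:
  assumes "x_fun p / x_fun r = x_fun p' / x_fun r'" "r \<noteq> 0" "r' \<noteq> 0"
  shows "p * r' = p' * r"
proof -
  have "x_fun (p * r') = x_fun (p' * r)" using assms by (simp add: frac_eq_eq)
  then show ?thesis by (simp only: x_fun_eq_iff)
qed

lemma A_frac: "r \<noteq> 0 \<Longrightarrow> x_fun p / x_fun r \<in> A \<longleftrightarrow> p = 0 \<or> ord p \<ge> ord r"
proof
  assume r: "r \<noteq> 0" and "x_fun p / x_fun r \<in> A"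
  then obtain p' r' where *: "x_fun p / x_fun r = x_fun p' / x_fun r'" "r' \<noteq> 0" "p' = 0 \<or> ord p' \<ge> ord r'"
    unfolding A_def by blast
  note c = frac_eq_cross[OF *(1) r *(2)]
  show "p = 0 \<or> ord p \<ge> ord r" using ord_cross[OF c r *(2)] *(3) by force
next
  show "r \<noteq> 0 \<Longrightarrow> p = 0 \<or> ord p \<ge> ord r \<Longrightarrow> x_fun p / x_fun r \<in> A" unfolding A_def by blast
qed

lemma mA_frac: "r \<noteq> 0 \<Longrightarrow> x_fun p / x_fun r \<in> mA \<longleftrightarrow> p = 0 \<or> ord p > ord r"
proof
  assume r: "r \<noteq> 0" and "x_fun p / x_fun r \<in> mA"
  then obtain p' r' where *: "x_fun p / x_fun r = x_fun p' / x_fun r'" "r' \<noteq> 0" "p' = 0 \<or> ord p' > ord r'"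
    unfolding mA_def by blast
  note c = frac_eq_cross[OF *(1) r *(2)]
  show "p = 0 \<or> ord p > ord r" using ord_cross[OF c r *(2)] *(3) by force
next
  show "r \<noteq> 0 \<Longrightarrow> p = 0 \<or> ord p > ord r \<Longrightarrow> x_fun p / x_fun r \<in> mA" unfolding mA_def by blast
qed

lemma K0_I: "r \<noteq> 0 \<Longrightarrow> x_fun p / x_fun r \<in> K0"
  unfolding K0_def by blast

lemma K0_E:
  assumes "t \<in> K0" obtains p r where "t = x_fun p / x_fun r" "r \<noteq> 0"
  using assms by (auto simp: K0_def)

lemma A_subset_K0: "A \<subseteq> K0"
  unfolding A_def K0_def by blast

lemma mA_subset_A: "mA \<subseteq> A"
proof
  fix t assume "t \<in> mA"
  then obtain p r where *: "t = x_fun p / x_fun r" "r \<noteq> 0" "p = 0 \<or> ord p > ord r" unfolding mA_def by blast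
  show "t \<in> A" unfolding *(1) A_frac[OF *(2)] using *(3) by auto
qed

lemma ord_1: "ord 1 = 0"
  using ord_mult[of 1 1] by simp

lemma A_1: "1 \<in> A" and mA_0: "0 \<in> mA" and one_notin_mA: "1 \<notin> mA"
  using A_frac[of 1 1] mA_frac[of 1 0] mA_frac[of 1 1] by auto

lemma mA_mult: "s \<in> mA \<Longrightarrow> t \<in> A \<Longrightarrow> s * t \<in> mA"
proof -
  assume "s \<in> mA" "t \<in> A"
  then obtain p r p' r' where *: "s = x_fun p / x_fun r" "r \<noteq> 0" "p = 0 \<or> ord p > ord r"
    "t = x_fun p' / x_fun r'" "r' \<noteq> 0" "p' = 0 \<or> ord p' \<ge> ord r'" unfolding A_def mA_def by blast
  have "s * t = x_fun (p * p') / x_fun (r * r')" using * by simp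
  moreover have "p * p' = 0 \<or> ord (p * p') > ord (r * r')" using * ord_mult by (cases "p * p' = 0") force+
  ultimately show ?thesis using mA_frac[of "r * r'" "p * p'"] * by simp
qed

lemma mA_add: "s \<in> mA \<Longrightarrow> t \<in> mA \<Longrightarrow> s + t \<in> mA"
proof -
  assume "s \<in> mA" "t \<in> mA"
  then obtain p r p' r' where *: "s = x_fun p / x_fun r" "r \<noteq> 0" "p = 0 \<or> ord p > ord r"
    "t = x_fun p' / x_fun r'" "r' \<noteq> 0" "p' = 0 \<or> ord p' > ord r'" unfolding mA_def by blast
  have eq: "s + t = x_fun (p * r' + p' * r) / x_fun (r * r')" using * by (simp add: add_frac_eq)
  have "p * r' + p' * r = 0 \<or> ord (p * r' + p' * r) > ord (r * r')"
  proof (cases "p = 0 \<or> p' = 0 \<or> p * r' + p' * r = 0")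
    case False
    then show ?thesis using * ord_add[of "p * r'" "p' * r"] ord_mult by force
  next
    case True
    then show ?thesis using *(2,3,5,6) by (cases "p = 0"; cases "p' = 0") (auto simp: ord_mult)
  qed
  then show ?thesis unfolding eq using mA_frac[of "r * r'" "p * r' + p' * r"] * by simp
qed

lemma mA_sum: "(\<And>i. i \<in> I \<Longrightarrow> h i \<in> mA) \<Longrightarrow> (\<Sum>i\<in>I. h i) \<in> mA"
  by (induction I rule: infinite_finite_induct) (auto simp: mA_add mA_0)

lemma mA_power: "t \<in> mA \<Longrightarrow> n > 0 \<Longrightarrow> t ^ n \<in> mA"
proof (induction n)
  case (Suc n)
  then show ?case using mA_mult[of t "t ^ n"] mA_subset_A A_1 by (cases "n = 0") auto
qed simp

lemma av_O: "h \<in> O_P \<Longrightarrow> av h \<in> A"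
proof (elim O_E)
  fix p r N assume *: "h = ev p / ev r" "total_degree_le p N" "total_degree_le r N" "H N r \<noteq> 0" "ev r \<noteq> 0"
  show "av h \<in> A"
    unfolding *(1) av_frac[OF *(5)]
    by (rule iffD2[OF A_frac ord_average[OF *(2,3,4)]]) (use *(5) in \<open>simp add: red_norm_poly_eq_0_iff\<close>)
qed

lemma sg_O: "z \<in> U \<Longrightarrow> h \<in> O_P \<Longrightarrow> sg z h \<in> O_P"
proof (elim O_E)
  fix p r N assume z: "z \<in> U" and *: "h = ev p / ev r" "total_degree_le p N" "total_degree_le r N" "H N r \<noteq> 0" "ev r \<noteq> 0"
  show "sg z h \<in> O_P"
    unfolding *(1) sg_frac[OF z *(5)]
    by (rule O_I[OF total_degree_le_twist[OF *(2)] total_degree_le_twist[OF *(3)]])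
       (use *(4) H_twist[OF z *(3)] in simp)
qed

lemma sg_R:
  assumes z: "z \<in> U" and h: "h \<in> R_P"
  shows "sg z h \<in> R_P"
proof -
  obtain p where p: "h \<in> K" "lead_coeff p = 1" "\<forall>i. coeff p i \<in> O_P" "poly p h = 0" using h by (rule R_E)
  let ?q = "map_poly (sg z) p"
  have cq: "coeff ?q i = sg z (coeff p i)" for i using z by (intro coeff_map_poly) simp
  have "degree ?q = degree p" using p(2) z by (intro map_poly_degree_eq) simp
  show ?thesis
  proof (rule R_I)
    show "sg z h \<in> K" using sg_hom(3)[OF z p(1) p(1)] .
    show "lead_coeff ?q = 1" using \<open>degree ?q = degree p\<close> p(2) z by (simp add: cq)
    show "coeff ?q i \<in> O_P" for i using sg_O[OF z] p(3) by (simp add: cq)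
    have cK: "coeff p i \<in> K" for i using p(3) O_subset_K by blast
    have "poly ?q (sg z h) = (\<Sum>i\<le>degree p. sg z (coeff p i * h ^ i))"
      unfolding poly_altdef \<open>degree ?q = degree p\<close> cq
      by (intro sum.cong) (simp_all add: sg_hom[OF z cK K_power[OF p(1)]] sg_power[OF z p(1)])
    also have "\<dots> = sg z (poly p h)"
      unfolding poly_altdef using cK p(1) by (intro sg_sum[OF z, symmetric]) (simp add: K_closed K_power)
    finally show "poly ?q (sg z h) = 0" using p(4) z by simp
  qed
qed

text \<open>
  Averaging an integral equation of \<open>t\<close> over the Galois group, which fixes \<open>t\<close>, gives
  one with coefficients in the valuation ring \<open>A\<close>; and \<open>A\<close> is integrally closed.
\<close>
lemma R_K0_subset_A:
  assumes "t \<in> R_P" "t \<in> K0"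
  shows "t \<in> A"
proof (rule ccontr)
  assume "t \<notin> A"
  obtain p r where t: "t = x_fun p / x_fun r" "r \<noteq> 0" using assms(2) by (rule K0_E)
  have pr: "p \<noteq> 0" "ord p < ord r" using A_frac[OF t(2), of p] t \<open>t \<notin> A\<close> by auto
  define u where "u = x_fun r / x_fun p"
  have u: "u \<in> mA" "t * u = 1" using mA_frac[OF pr(1), of r] pr t by (auto simp: u_def)
  have uA: "u ^ i \<in> A" for i using mA_power[OF u(1), of i] mA_subset_A A_1 by (cases "i = 0") auto
  obtain q where q: "t \<in> K" "lead_coeff q = 1" "\<forall>i. coeff q i \<in> O_P" "poly q t = 0" using assms(1) by (rule R_E)
  define n where "n = degree q"
  \<comment> \<open>Divide the integral equation by \<open>t ^ n\<close>: it makes \<open>1\<close> a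
    combination of positive powers of \<open>u = inverse t\<close>, with coefficients in \<open>A\<close> after
    averaging.\<close>
  have "(\<Sum>i\<le>n. coeff q i * u ^ (n - i)) = (\<Sum>i\<le>n. coeff q i * t ^ i * u ^ n)"
  proof (rule sum.cong)
    fix i assume "i \<in> {..n}"
    then have "u ^ n = u ^ i * u ^ (n - i)" by (simp flip: power_add)
    then have "t ^ i * u ^ n = (t * u) ^ i * u ^ (n - i)" by (simp add: power_mult_distrib)
    then show "coeff q i * u ^ (n - i) = coeff q i * t ^ i * u ^ n" using u(2) by (simp add: mult.assoc)
  qed simp
  also have "\<dots> = poly q t * u ^ n" by (simp add: poly_altdef n_def sum_distrib_right)
  finally have "0 = av (\<Sum>i\<le>n. coeff q i * u ^ (n - i))" using q(4) by (simp add: av_def U_simps)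
  also have "\<dots> = (\<Sum>i\<le>n. av (coeff q i) * u ^ (n - i))"
  proof -
    have 1: "u ^ (n - i) \<in> K0" "coeff q i \<in> K" for i using q(3) O_subset_K uA A_subset_K0 by blast+
    then have "coeff q i * u ^ (n - i) \<in> K" for i using K0_subset_K K_closed(2) by blast
    then show ?thesis using 1 by (simp add: av_sum av_mult_K0)
  qed
  also have "\<dots> = av (coeff q n) + (\<Sum>i<n. av (coeff q i) * u ^ (n - i))"
    by (simp add: lessThan_Suc_atMost[symmetric] add.commute)
  also have "av (coeff q n) = 1" using q(2) A_1 A_subset_K0 av_K0 unfolding n_def by auto
  finally have one: "(\<Sum>i<n. av (coeff q i) * u ^ (n - i)) * (- 1) = 1" by (simp add: neg_eq_iff_add_eq_0 add.commute)
  have "(\<Sum>i<n. av (coeff q i) * u ^ (n - i)) \<in> mA"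
    using mA_power[OF u(1)] mA_mult av_O q(3) by (intro mA_sum) (simp add: mult.commute)
  moreover have "- 1 \<in> A"
    using A_frac[of 1 "- 1"] ord_mult[of "- 1" "- 1"] ord_1 by simp
  ultimately have "(\<Sum>i<n. av (coeff q i) * u ^ (n - i)) * (- 1) \<in> mA" by (rule mA_mult)
  then show False unfolding one using one_notin_mA by simp
qed

lemma x_fun_inverse_d: "x_fun [:inverse (of_nat d):] * x_fun [:of_nat d:] = (1 :: 'k ambient)"
  unfolding x_fun_const_mult[symmetric] left_inverse[OF d_nonzero] by (rule x_fun_const_1)

text \<open>
  The component of \<open>h\<close> in the eigenspace of the Galois group for the character
  \<open>z \<mapsto> z ^ i\<close>, which is \<open>k(x) * y ^ i\<close>.
\<close>
definition component :: "nat \<Rightarrow> 'k ambient \<Rightarrow> 'k ambient" where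
  "component i h = x_fun [:inverse (of_nat d):] * (\<Sum>z\<in>U. x_fun [:inverse z ^ i:] * sg z h)"

lemma component_0: "component 0 h = av h"
proof -
  have "x_fun [:inverse (of_nat d):] = inverse (x_fun [:of_nat d:] :: 'k ambient)"
    by (rule inverse_unique[symmetric]) (subst mult.commute, rule x_fun_inverse_d)
  then show ?thesis by (simp add: component_def av_def divide_inverse mult.commute x_fun_const_1)
qed

lemma sum_component:
  assumes "h \<in> K"
  shows "(\<Sum>i<d. component i h) = h"
proof -
  have geo: "(\<Sum>i<d. inverse z ^ i) = (if z = 1 then of_nat d else 0)" if "z \<in> U" for z
  proof (cases "z = 1")
    case False
    then have "inverse z \<noteq> 1" by simp
    then have "(\<Sum>i<d. inverse z ^ i) = (inverse z ^ d - 1) / (inverse z - 1)" by (rule geometric_sum)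
    also have "inverse z ^ d = 1" using U_simps(3,5) that by blast
    finally show ?thesis using False by simp
  qed simp
  have "(\<Sum>i<d. component i h) = x_fun [:inverse (of_nat d):] * (\<Sum>z\<in>U. (\<Sum>i<d. x_fun [:inverse z ^ i:]) * sg z h)"
    unfolding component_def sum_distrib_left[symmetric] sum_distrib_right by (subst sum.swap) simp
  also have "(\<Sum>z\<in>U. (\<Sum>i<d. x_fun [:inverse z ^ i:]) * sg z h) = (\<Sum>z\<in>U. if z = 1 then of_nat d * h else 0)"
  proof (rule sum.cong)
    fix z assume z: "z \<in> U"
    have "(\<Sum>i<d. x_fun [:inverse z ^ i:]) = x_fun [:\<Sum>i<d. inverse z ^ i:]"
      by (simp only: x_fun_const_sum)
    then show "(\<Sum>i<d. x_fun [:inverse z ^ i:]) * sg z h = (if z = 1 then of_nat d * h else 0)"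
      using geo[OF z] sg_id[OF assms] by (simp add: x_fun_of_nat)
  qed simp
  also have "\<dots> = of_nat d * h" using finite_U U_simps(1) by simp
  also have "x_fun [:inverse (of_nat d):] * (of_nat d * h) = h"
    using x_fun_inverse_d by (simp add: x_fun_of_nat flip: mult.assoc)
  finally show ?thesis .
qed

lemma sg_component:
  assumes w: "w \<in> U" and h: "h \<in> K"
  shows "sg w (component i h) = x_fun [:w ^ i:] * component i h"
proof -
  have 1: "sg z h \<in> K" if "z \<in> U" for z using sg_hom(3)[OF that h h] .
  have "sg w (component i h) = x_fun [:inverse (of_nat d):] * (\<Sum>z\<in>U. sg w (x_fun [:inverse z ^ i:] * sg z h))"
    unfolding component_def using w 1 by (subst sg_hom(2)) (auto simp: sg_sum K_sum K_closed)
  also have "(\<Sum>z\<in>U. sg w (x_fun [:inverse z ^ i:] * sg z h)) = (\<Sum>z\<in>U. x_fun [:inverse z ^ i:] * sg (w * z) h)"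
    using w 1 h by (intro sum.cong) (auto simp: sg_hom sg_sg)
  also have "\<dots> = (\<Sum>z\<in>U. x_fun [:w ^ i:] * (x_fun [:inverse z ^ i:] * sg z h))"
  proof (rule sum.reindex_bij_witness[where i = "\<lambda>z. inverse w * z" and j = "\<lambda>z. w * z"])
    fix z assume z: "z \<in> U"
    have "w ^ i * inverse (w * z) ^ i = inverse z ^ i"
      using U_simps(4)[OF w] by (simp add: power_mult_distrib power_inverse)
    then have "x_fun [:inverse z ^ i:] = x_fun [:w ^ i:] * x_fun [:inverse (w * z) ^ i:]"
      by (simp only: x_fun_const_mult[symmetric])
    then show "x_fun [:w ^ i:] * (x_fun [:inverse (w * z) ^ i:] * sg (w * z) h) = x_fun [:inverse z ^ i:] * sg (w * z) h"
      by (simp only: mult.assoc)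
  qed (use w U_simps in \<open>auto simp flip: mult.assoc\<close>)
  finally show ?thesis by (simp add: component_def sum_distrib_left mult_ac)
qed

lemma y_nonzero: "y \<noteq> 0"
  using y_power F0 d_pos by (metis power_0_left x_fun_eq_0_iff not_gr0)

lemma eigenvector_form:
  assumes g: "g \<in> K" and eig: "\<And>w. w \<in> U \<Longrightarrow> sg w g = x_fun [:w ^ i:] * g"
  shows "\<exists>t\<in>K0. g = t * y ^ i"
proof
  define t where "t = g / y ^ i"
  have tK: "t \<in> K" using g by (simp add: t_def K_divide K_power)
  show gt: "g = t * y ^ i" using y_nonzero by (simp add: t_def)
  have "sg w t = t" if w: "w \<in> U" for w
  proof -
    have "x_fun [:w ^ i:] * g = sg w t * (x_fun [:w:] * y) ^ i"
      using eig[OF w] sg_hom(2)[OF w tK K_power] sg_power[OF w] sg_y[OF w] unfolding gt by simp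
    also have "\<dots> = x_fun [:w ^ i:] * (sg w t * y ^ i)"
      by (simp add: power_mult_distrib x_fun_const_power)
    finally have "g = sg w t * y ^ i" using U_simps(4)[OF w] by simp
    then have "sg w t * y ^ i = t * y ^ i" by (rule trans[OF sym gt])
    then show ?thesis using y_nonzero by simp
  qed
  then have "av t = t" using of_nat_d_nonzero by (simp add: av_def card_U x_fun_of_nat)
  then show "t \<in> K0" using av_mem_K0[OF tK] by simp
qed

lemma ord_power: "p \<noteq> 0 \<Longrightarrow> ord (p ^ n) = int n * ord p"
  by (induction n) (auto simp: ord_1 ord_mult algebra_simps)

text \<open>
  A nonzero component has the form \<open>t * y ^ i\<close> with \<open>t\<close> in \<open>k(x)\<close>, and
  its \<open>d\<close>-th power \<open>t ^ d * F ^ i\<close> is an integral element of \<open>k(x)\<close>. The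
  valuation of this power is not divisible by \<open>d\<close>, in particular nonzero, so it is positive.
\<close>
lemma component_mem_maximal:
  assumes M: "maximalideal M (subring_of R_P)" and h: "h \<in> R_P" and i: "0 < i" "i < d"
  shows "component i h \<in> M"
proof -
  interpret maxideal_of M R_P by (rule maxideal_of.intro[OF M])
  let ?g = "component i h"
  have hK: "h \<in> K" using h R_subset_K by blast
  have cR: "x_fun [:c:] \<in> R_P" for c using O_const O_subset_R by blast
  have gR: "?g \<in> R_P" unfolding component_def by (intro R_closed(5) R_sum cR sg_R h)
  then have gK: "?g \<in> K" using R_subset_K by blast
  obtain t where t: "t \<in> K0" "?g = t * y ^ i" using eigenvector_form[OF gK sg_component[OF _ hK]] by blast
  obtain p r where pr: "t = x_fun p / x_fun r" "r \<noteq> 0" using t(1) by (rule K0_E)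
  have "?g ^ d = t ^ d * (y ^ d) ^ i" by (simp add: t(2) power_mult_distrib mult.commute flip: power_mult)
  then have gd: "?g ^ d = x_fun (p ^ d * F ^ i) / x_fun (r ^ d)" by (simp add: pr y_power power_divide)
  have gdR: "?g ^ d \<in> R_P" using R_power[OF gR] .
  moreover have gK0: "?g ^ d \<in> K0" unfolding gd by (rule K0_I) (use pr(2) in simp)
  ultimately have "?g ^ d \<in> A" by (rule R_K0_subset_A)
  moreover have rd: "r ^ d \<noteq> 0" using pr(2) by simp
  ultimately have "p ^ d * F ^ i = 0 \<or> ord (p ^ d * F ^ i) \<ge> ord (r ^ d)" unfolding gd A_frac[OF rd] by blast
  moreover have "ord (p ^ d * F ^ i) \<noteq> ord (r ^ d)" if "p \<noteq> 0"
  proof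
    assume "ord (p ^ d * F ^ i) = ord (r ^ d)"
    then have "int i * ord F = int d * (ord r - ord p)"
      using that F0 pr(2) by (simp add: ord_mult ord_power algebra_simps)
    then have "int d dvd int i * ord F" by simp
    then have "int d dvd int i" using ord_F by (simp add: coprime_dvd_mult_left_iff)
    then have "d dvd i" by simp
    then show False using i by (auto dest: dvd_imp_le)
  qed
  ultimately have "p ^ d * F ^ i = 0 \<or> ord (p ^ d * F ^ i) > ord (r ^ d)"
    using d_pos by (cases "p = 0") (auto simp: power_0_left)
  then have "?g ^ d \<in> M"
    unfolding gd using ord_pos_mem_maximal[OF M rd _ gdR[unfolded gd]] by blast
  then show ?thesis using prime_power gR by blast
qed

text \<open>
  Uniqueness of the point above a totally ramified one. An integral element differs from its average, the
  component of degree \<open>0\<close>, by components that lie in every maximal ideal \<open>M\<close>. So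
  \<open>M\<close> is determined by its elements in \<open>k(x)\<close>, and these are the integral elements of
  positive valuation: an element of valuation \<open>0\<close> differs from a nonzero constant by one of
  positive valuation.
\<close>
theorem maximal_eq:
  assumes M: "maximalideal M (subring_of R_P)"
  shows "M = {h \<in> R_P. av h \<in> mA}"
proof -
  interpret maxideal_of M R_P by (rule maxideal_of.intro[OF M])
  have cR: "x_fun [:c:] \<in> R_P" for c using O_const O_subset_R by blast
  have mA: "t \<in> M" if "t \<in> mA" "t \<in> R_P" for t
    using that ord_pos_mem_maximal[OF M] unfolding mA_def by blast
  have avR: "av h \<in> R_P" if "h \<in> R_P" for h
    unfolding component_0[symmetric] component_def by (intro R_closed(5) R_sum cR sg_R that)
  have diff: "h - av h \<in> M" if h: "h \<in> R_P" for h
  proof -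
    have "{..<d} = insert 0 {0<..<d}" using d_pos by auto
    then have "h = av h + (\<Sum>i\<in>{0<..<d}. component i h)"
      using sum_component[of h] h R_subset_K component_0 by auto
    moreover have "(\<Sum>i\<in>{0<..<d}. component i h) \<in> M"
      using component_mem_maximal[OF M h] by (intro M_sum) auto
    ultimately show ?thesis by (metis add_diff_cancel_left')
  qed
  have av_M: "t \<in> mA" if t: "t \<in> M" "t \<in> K0" for t
  proof (rule ccontr)
    assume nt: "t \<notin> mA"
    have "t \<in> A" using R_K0_subset_A t M_closed(1) by blast
    then obtain p r where pr: "t = x_fun p / x_fun r" "r \<noteq> 0" "p = 0 \<or> ord p \<ge> ord r" unfolding A_def by blast
    then have p: "p \<noteq> 0" "ord p = ord r" using nt mA_frac[OF pr(2), of p] by auto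
    then obtain c where c: "p - smult c r = 0 \<or> ord (p - smult c r) > ord r" using ord_residue pr(2) by blast
    then have c0: "c \<noteq> 0" using p by auto
    have "smult c r = [:c:] * r" by simp
    then have eq: "t - x_fun [:c:] = x_fun (p - smult c r) / x_fun r"
      using pr by (simp only: x_fun_simps) (simp add: field_simps)
    have "t - x_fun [:c:] \<in> mA" unfolding eq mA_frac[OF pr(2)] by (rule c)
    moreover have "t - x_fun [:c:] \<in> R_P" using t M_closed(1) cR R_closed(6) by blast
    ultimately have "t - x_fun [:c:] \<in> M" by (rule mA)
    then have "x_fun [:c:] \<in> M" using M_closed(7)[OF t(1)] by fastforce
    moreover have "x_fun [:c:] * x_fun [:inverse c:] = 1"
      unfolding x_fun_const_mult[symmetric] right_inverse[OF c0] by (rule x_fun_const_1)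
    ultimately show False using unit_notin[OF _ cR] by blast
  qed
  show ?thesis
  proof (intro equalityI subsetI)
    fix h assume h: "h \<in> M"
    then have hR: "h \<in> R_P" using M_closed(1) by blast
    have "h - (h - av h) \<in> M" by (rule M_closed(7)[OF h diff[OF hR]])
    then have "av h \<in> M" by simp
    then show "h \<in> {h \<in> R_P. av h \<in> mA}" using hR av_M av_mem_K0 R_subset_K by blast
  next
    fix h assume "h \<in> {h \<in> R_P. av h \<in> mA}"
    then have h: "h \<in> R_P" "av h \<in> M" using mA avR by auto
    have "h = (h - av h) + av h" by simp
    then show "h \<in> M" using M_closed(3)[OF diff[OF h(1)] h(2)] by simp
  qed
qed

lemma maximal_sg_stable:
  assumes M: "maximalideal M (subring_of R_P)" and z: "z \<in> U"
  shows "{h \<in> K. sg z h \<in> M} = M"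
proof -
  have "h \<in> R_P" if "h \<in> K" "sg z h \<in> R_P" for h
    using sg_R[OF U_simps(3)[OF z] that(2)] sg_inverse_inverse[OF z that(1)] by simp
  then show ?thesis
    unfolding maximal_eq[OF M] using R_subset_K sg_R[OF z] av_sg[OF z] by auto
qed

end

section \<open>Evaluation of forms\<close>

definition eval2 :: "'a::comm_ring_1 poly poly \<Rightarrow> 'a \<Rightarrow> 'a \<Rightarrow> 'a" where
  "eval2 p a b = poly (poly p [:b:]) a"

lemma power_pred: "0 < n \<Longrightarrow> x ^ n = x * x ^ (n - 1)" for x :: "'a::monoid_mult"
  by (cases n) auto

lemma ring_map_eval2: "ring_map (\<lambda>p. eval2 p a b)"
  by (simp add: ring_map_def eval2_def)

lemmas eval2_simps = ring_mapD[OF ring_map_eval2]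

lemma eval2_const [simp]: "eval2 [:u:] a b = poly u a"
  by (simp add: eval2_def)

lemma homog_eval_scale:
  "homog_eval N r (s * u, s * v, s * w) = s ^ N * homog_eval N r (u, v, w)"
proof -
  have "coeff (coeff r j) i * (s * u) ^ i * (s * v) ^ j * (s * w) ^ (N - i - j)
      = s ^ N * (coeff (coeff r j) i * u ^ i * v ^ j * w ^ (N - i - j))" if "j \<le> N" "i \<le> N - j" for i j
  proof -
    have "i + j + (N - i - j) = N" using that by simp
    then have "s ^ N = s ^ i * s ^ j * s ^ (N - i - j)" by (metis power_add)
    then show ?thesis by (simp add: power_mult_distrib mult_ac)
  qed
  then show ?thesis unfolding homog_eval_def by (simp add: sum_distrib_left)
qed

lemma total_degree_le_degree_coeff:
  assumes "total_degree_le p N"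
  shows "degree (coeff p j) \<le> N - j"
proof (cases "coeff p j = 0")
  case False
  then have "degree (coeff p j) + j \<le> N" using assms unfolding total_degree_le_altdef by blast
  then show ?thesis by simp
qed simp

lemma total_degree_le_coeff_0:
  assumes "total_degree_le p N" "N < j"
  shows "coeff p j = 0"
proof (rule ccontr)
  assume "coeff p j \<noteq> 0"
  then have "degree (coeff p j) + j \<le> N" using assms(1) unfolding total_degree_le_altdef by blast
  then show False using assms(2) by simp
qed

lemma total_degree_le_degree: "total_degree_le p N \<Longrightarrow> degree p \<le> N"
  by (rule degree_le) (use total_degree_le_coeff_0 in blast)

lemma homog_eval_affine:
  assumes "total_degree_le r N"
  shows "homog_eval N r (a, b, 1) = eval2 r a b"
proof -
  have c: "poly (coeff r j) a = (\<Sum>i\<le>N - j. coeff (coeff r j) i * a ^ i)" for j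
  proof -
    have "degree (coeff r j) \<le> N - j" by (rule total_degree_le_degree_coeff[OF assms])
    then show ?thesis unfolding poly_altdef
      by (intro sum.mono_neutral_left) (auto simp: coeff_eq_0)
  qed
  have "degree r \<le> N" by (rule total_degree_le_degree[OF assms])
  then have "poly r [:b:] = (\<Sum>j\<le>N. coeff r j * [:b:] ^ j)" unfolding poly_altdef
    by (intro sum.mono_neutral_left) (auto simp: coeff_eq_0)
  then have "eval2 r a b = (\<Sum>j\<le>N. poly (coeff r j) a * b ^ j)"
    by (simp add: eval2_def poly_sum)
  then show ?thesis unfolding homog_eval_def c by (simp add: sum_distrib_right)
qed

lemma homog_eval_infinity:
  "homog_eval N r (u, v, 0) = (\<Sum>j\<le>N. coeff (coeff r j) (N - j) * u ^ (N - j) * v ^ j)"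
  for u v :: "'a::comm_ring_1"
proof -
  have "(\<Sum>i\<le>N - j. coeff (coeff r j) i * u ^ i * v ^ j * 0 ^ (N - i - j)) = coeff (coeff r j) (N - j) * u ^ (N - j) * v ^ j"
    if "j \<le> N" for j
  proof -
    have "(\<Sum>i\<le>N - j. coeff (coeff r j) i * u ^ i * v ^ j * 0 ^ (N - i - j))
        = (\<Sum>i\<in>{N - j}. coeff (coeff r j) i * u ^ i * v ^ j * 0 ^ (N - i - j))"
    proof (rule sum.mono_neutral_right)
      show "\<forall>i\<in>{..N - j} - {N - j}. coeff (coeff r j) i * u ^ i * v ^ j * 0 ^ (N - i - j) = 0"
      proof
        fix i assume "i \<in> {..N - j} - {N - j}"
        then have "N - i - j > 0" by auto
        then show "coeff (coeff r j) i * u ^ i * v ^ j * 0 ^ (N - i - j) = 0" by (simp add: power_0_left)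
      qed
    qed auto
    then show ?thesis using that by simp
  qed
  then show ?thesis unfolding homog_eval_def by simp
qed

lemma coeff_mult_top:
  fixes p q :: "'a::comm_ring_1 poly"
  assumes "degree p \<le> N" "degree q \<le> M"
  shows "coeff (p * q) (N + M) = coeff p N * coeff q M"
proof -
  have "coeff (p * q) (N + M) = (\<Sum>i\<in>{N}. coeff p i * coeff q (N + M - i))"
    unfolding coeff_mult
  proof (rule sum.mono_neutral_right)
    show "\<forall>i\<in>{..N + M} - {N}. coeff p i * coeff q (N + M - i) = 0"
    proof
      fix i assume "i \<in> {..N + M} - {N}"
      then consider "i > N" | "N + M - i > M" by force
      then show "coeff p i * coeff q (N + M - i) = 0"
        by cases (use assms in \<open>auto simp: coeff_eq_0\<close>)
    qed
  qed auto
  then show ?thesis by simp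
qed

lemma eval2_twist: "eval2 (twist z p) a b = eval2 p a (z * b)"
  by (simp add: eval2_def twist_def poly_pcompose mult.commute)


section \<open>The points of the projective closure\<close>

definition affine_point :: "'a::field \<Rightarrow> 'a \<Rightarrow> ('a \<times> 'a \<times> 'a) set" where
  "affine_point a b = {(s * a, s * b, s) | s. s \<noteq> 0}"

definition x_infinity :: "('a::field \<times> 'a \<times> 'a) set" where
  "x_infinity = {(s, 0, 0) | s. s \<noteq> 0}"

definition y_infinity :: "('a::field \<times> 'a \<times> 'a) set" where
  "y_infinity = {(0, s, 0) | s. s \<noteq> 0}"

lemma proj_point_scale:
  fixes c :: "'a::field"
  assumes "c \<noteq> 0"
  shows "{(s * (c * u), s * (c * v), s * (c * w)) | s. s \<noteq> 0} = {(s * u, s * v, s * w) | s. s \<noteq> 0}"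
proof (intro equalityI subsetI)
  fix x assume "x \<in> {(s * (c * u), s * (c * v), s * (c * w)) | s. s \<noteq> 0}"
  then obtain s where "x = (s * (c * u), s * (c * v), s * (c * w))" "s \<noteq> 0" by blast
  then have "x = ((s * c) * u, (s * c) * v, (s * c) * w)" "s * c \<noteq> 0" using assms by (simp_all add: mult.assoc)
  then show "x \<in> {(s * u, s * v, s * w) | s. s \<noteq> 0}" by blast
next
  fix x assume "x \<in> {(s * u, s * v, s * w) | s. s \<noteq> 0}"
  then obtain s where "x = (s * u, s * v, s * w)" "s \<noteq> 0" by blast
  then have "x = ((s / c) * (c * u), (s / c) * (c * v), (s / c) * (c * w))" "s / c \<noteq> 0" using assms by simp_all
  then show "x \<in> {(s * (c * u), s * (c * v), s * (c * w)) | s. s \<noteq> 0}" by blast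
qed

lemma affine_point_eq_iff: "affine_point a b = affine_point a' b' \<longleftrightarrow> a = a' \<and> b = b'"
proof
  assume *: "affine_point a b = affine_point a' b'"
  have "(a, b, 1) \<in> affine_point a b" unfolding affine_point_def by (intro CollectI exI[of _ 1]) simp
  then have "(a, b, 1) \<in> affine_point a' b'" unfolding * by simp
  then show "a = a' \<and> b = b'" by (auto simp: affine_point_def)
qed simp

lemma ball_affine_point: "(\<forall>v\<in>affine_point a b. Q v) \<longleftrightarrow> (\<forall>s. s \<noteq> 0 \<longrightarrow> Q (s * a, s * b, s))"
  by (auto simp: affine_point_def)

lemma homog_eval_affine_point:
  "total_degree_le r N \<Longrightarrow> homog_eval N r (s * a, s * b, s) = s ^ N * eval2 r a b"
  using homog_eval_scale[of N r s a b 1] by (simp add: homog_eval_affine)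

context kummer
begin

lemma eval2_curve: "eval2 curve a b = b ^ d - poly F a"
  by (simp add: curve_altdef eval2_simps, simp add: eval2_def poly_monom)

lemma total_degree_curve: "total_degree curve = max d (degree F)"
proof (rule antisym)
  show "total_degree curve \<le> max d (degree F)"
    unfolding total_degree_le_iff total_degree_le_altdef coeff_curve using d_pos by auto
  have t: "total_degree_le curve (total_degree curve)"
    using total_degree_le_iff[of curve "total_degree curve"] by simp
  have "coeff (coeff curve d) 0 \<noteq> 0" using d_pos by (simp add: coeff_curve)
  then have "0 + d \<le> total_degree curve" using t unfolding total_degree_le_def by blast
  moreover have "coeff (coeff curve 0) (degree F) \<noteq> 0" using d_pos F0 by (simp add: coeff_curve)
  then have "degree F + 0 \<le> total_degree curve" using t unfolding total_degree_le_def by blast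
  ultimately show "max d (degree F) \<le> total_degree curve" by simp
qed

lemma map_curve: "map_poly (map_poly to_ac) (curve_poly d f) = curve"
proof -
  have "coeff (curve_poly d f) i = (if i = d then 1 else 0) - (if i = 0 then f else 0)" for i
  proof -
    have "curve_poly d f = monom 1 d - [:f:]" by (simp add: curve_poly_def monom_altdef)
    then show ?thesis by (cases i) auto
  qed
  then show ?thesis
    by (intro poly_eqI) (auto simp: coeff_map_poly coeff_curve F_def ring_mapD[OF ring_map_map_poly[OF ring_map_to_ac]])
qed

lemma total_degree_curve_f: "total_degree (curve_poly d f) = max d (degree F)"
proof -
  have "coeff (coeff (curve_poly d f) j) i \<noteq> 0 \<longleftrightarrow> coeff (coeff curve j) i \<noteq> 0" for i j
    unfolding map_curve[symmetric] by (simp add: coeff_map_poly)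
  then have "total_degree (curve_poly d f) = total_degree curve" unfolding total_degree_def by simp
  then show ?thesis by (simp add: total_degree_curve)
qed

lemma total_degree_le_curve: "total_degree_le curve (max d (degree F))"
  using total_degree_curve by (simp flip: total_degree_le_iff)

lemma affine_point_mem_iff: "affine_point a b \<in> proj_closure d f \<longleftrightarrow> b ^ d = poly F a"
proof -
  have "affine_point a b \<in> proj_plane"
    unfolding proj_plane_def by (intro CollectI exI[of _ a] exI[of _ b] exI[of _ 1]) (simp add: affine_point_def)
  moreover have "(\<forall>v\<in>affine_point a b. homog_eval (max d (degree F)) curve v = 0) \<longleftrightarrow> b ^ d = poly F a"
    unfolding ball_affine_point homog_eval_affine_point[OF total_degree_le_curve] eval2_curve
    by (auto intro: exI[of _ 1])
  ultimately show ?thesis by (simp add: proj_closure_def map_curve total_degree_curve_f)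
qed

text \<open>
  On the line at infinity only the terms of top degree \<open>max d (degree F)\<close> of
  \<open>Y ^ d - F\<close> survive, and there is exactly one of them since \<open>degree F \<noteq> d\<close>.
\<close>
lemma homog_eval_curve_infinity:
  assumes "degree F \<noteq> d"
  shows "homog_eval (max d (degree F)) curve (u, v, 0) =
    (if degree F > d then - lead_coeff F * u ^ degree F else v ^ d)"
proof (cases "degree F > d")
  case True
  then have "homog_eval (max d (degree F)) curve (u, v, 0)
      = (\<Sum>j\<le>degree F. coeff (coeff curve j) (degree F - j) * u ^ (degree F - j) * v ^ j)"
    by (simp add: homog_eval_infinity max_def)
  also have "\<dots> = (\<Sum>j\<in>{0}. coeff (coeff curve j) (degree F - j) * u ^ (degree F - j) * v ^ j)"
    by (rule sum.mono_neutral_right) (use True in \<open>auto simp: coeff_curve\<close>)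
  also have "\<dots> = - lead_coeff F * u ^ degree F" using d_pos by (simp add: coeff_curve)
  finally show ?thesis using True by simp
next
  case False
  then have lt: "degree F < d" using assms by simp
  then have "homog_eval (max d (degree F)) curve (u, v, 0)
      = (\<Sum>j\<le>d. coeff (coeff curve j) (d - j) * u ^ (d - j) * v ^ j)"
    by (simp add: homog_eval_infinity max_def)
  also have "\<dots> = (\<Sum>j\<in>{d}. coeff (coeff curve j) (d - j) * u ^ (d - j) * v ^ j)"
    by (rule sum.mono_neutral_right) (use lt in \<open>auto simp: coeff_curve coeff_eq_0\<close>)
  also have "\<dots> = v ^ d" using d_pos by (simp add: coeff_curve)
  finally show ?thesis using False by simp
qed

text \<open>
  The closure has a single point at infinity, in the direction of the \<open>y\<close> axis or of the
  \<open>x\<close> axis according to which of \<open>degree F\<close> and \<open>d\<close> is larger.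
\<close>
lemma proj_closure_cases:
  assumes P: "P \<in> proj_closure d f" and deg: "degree F \<noteq> d"
  obtains a b where "P = affine_point a b" "b ^ d = poly F a"
  | "degree F > d" "P = y_infinity" | "degree F < d" "P = x_infinity"
proof -
  from P obtain u v w where P_eq: "P = {(s * u, s * v, s * w) | s. s \<noteq> 0}" and nz: "(u, v, w) \<noteq> (0, 0, 0)"
    unfolding proj_closure_def proj_plane_def by blast
  show thesis
  proof (cases "w = 0")
    case False
    then have eq: "P = affine_point (u / w) (v / w)"
      unfolding P_eq affine_point_def using proj_point_scale[of w "u / w" "v / w" 1] by simp
    show thesis by (rule that(1)[OF eq]) (use P in \<open>simp add: eq affine_point_mem_iff\<close>)
  next
    case True
    have uvP: "(u, v, w) \<in> P" unfolding P_eq by (intro CollectI exI[of _ 1]) simp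
    have "\<forall>v\<in>P. homog_eval (max d (degree F)) curve v = 0"
      using P by (simp add: proj_closure_def map_curve total_degree_curve_f)
    then have "homog_eval (max d (degree F)) curve (u, v, 0) = 0" using uvP True by blast
    then have *: "(if degree F > d then - lead_coeff F * u ^ degree F else v ^ d) = 0"
      using homog_eval_curve_infinity[OF deg] by simp
    show thesis
    proof (cases "degree F > d")
      case gt: True
      then have u: "u = 0" using * F0 by simp
      then have v: "v \<noteq> 0" using nz True by simp
      have "P = y_infinity"
        unfolding P_eq y_infinity_def u True using proj_point_scale[OF v, of 0 1 0] by simp
      then show thesis using that(2) gt by blast
    next
      case gt: False
      then have v: "v = 0" using * by simp
      then have u: "u \<noteq> 0" using nz True by simp
      have "P = x_infinity"
        unfolding P_eq x_infinity_def v True using proj_point_scale[OF u, of 1 0 0] by simp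
      then show thesis using that(3) gt deg by simp
    qed
  qed
qed

lemma affine_local_point:
  assumes "b ^ d = poly F a"
  shows "local_point d f (affine_point a b) (\<lambda>N p. eval2 p a b)"
proof unfold_locales
  show "(\<forall>v\<in>affine_point a b. homog_eval N r v \<noteq> 0) \<longleftrightarrow> eval2 r a b \<noteq> 0" if "total_degree_le r N" for r N
    unfolding ball_affine_point homog_eval_affine_point[OF that] by (auto intro: exI[of _ 1])
  show "eval2 [:[:c:]:] a b = c" for c by simp
  show "ev r \<noteq> 0" if "eval2 r a b \<noteq> 0" for r
    using that assms eval2_curve[of a b] by (auto simp: ev_eq_0_iff eval2_simps)
qed (auto simp: eval2_simps)


section \<open>Affine points with vanishing second coordinate\<close>

lemma eval2_norm_poly: "eval2 (norm_poly r) a b = (\<Prod>z\<in>U. eval2 r a (z * b))"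
  by (simp add: norm_poly_def ring_map_prod[OF ring_map_eval2] eval2_twist)

text \<open>
  Where \<open>F\<close> vanishes, only the coefficient of \<open>Y ^ 0\<close> contributes.
\<close>
lemma poly_red_at_root:
  assumes "poly F a = 0"
  shows "poly (red p) a = eval2 p a 0"
proof -
  have "poly (red p) a = (\<Sum>j\<le>degree p. poly (coeff p (d * j)) a * poly F a ^ j)"
    by (simp add: red_def poly_sum)
  also have "\<dots> = (\<Sum>j\<in>{0}. poly (coeff p (d * j)) a * poly F a ^ j)"
    by (rule sum.mono_neutral_right) (use assms in \<open>auto simp: power_0_left\<close>)
  also have "\<dots> = eval2 p a 0" by (simp add: eval2_def poly_0_coeff_0)
  finally show ?thesis .
qed

lemma order_add_ge:
  fixes p q :: "'a::idom poly"
  assumes "p \<noteq> 0" "q \<noteq> 0" "p + q \<noteq> 0"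
  shows "order a (p + q) \<ge> min (order a p) (order a q)"
proof -
  have "[:-a, 1:] ^ min (order a p) (order a q) dvd p" "[:-a, 1:] ^ min (order a p) (order a q) dvd q"
    using assms by (simp_all add: order_divides)
  then have "[:-a, 1:] ^ min (order a p) (order a q) dvd p + q" by (rule dvd_add)
  then show ?thesis using assms by (simp add: order_divides)
qed

text \<open>
  The residue field of the valuation is the field of constants.
\<close>
lemma order_residue:
  fixes p q :: "'a::field poly"
  assumes "p \<noteq> 0" "q \<noteq> 0" "order a p = order a q"
  shows "\<exists>c. p - smult c q = 0 \<or> order a (p - smult c q) > order a q"
proof -
  define n where "n = order a q"
  obtain p' where p': "p = [:-a, 1:] ^ n * p'" "\<not> [:-a, 1:] dvd p'"
    using order_decomp[OF assms(1)] assms(3) unfolding n_def by metis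
  obtain q' where q': "q = [:-a, 1:] ^ n * q'" "\<not> [:-a, 1:] dvd q'"
    using order_decomp[OF assms(2)] unfolding n_def by metis
  define c where "c = poly p' a / poly q' a"
  have "poly q' a \<noteq> 0" using q'(2) by (simp add: poly_eq_0_iff_dvd)
  then have "poly (p' - smult c q') a = 0" by (simp add: c_def)
  then have "[:-a, 1:] dvd p' - smult c q'" by (simp only: poly_eq_0_iff_dvd)
  then have "[:-a, 1:] ^ n * [:-a, 1:] dvd [:-a, 1:] ^ n * (p' - smult c q')" by (rule mult_dvd_mono[OF dvd_refl])
  also have "[:-a, 1:] ^ n * (p' - smult c q') = p - smult c q" by (simp only: p'(1) q'(1) right_diff_distrib mult_smult_right)
  finally have "[:-a, 1:] ^ Suc n dvd p - smult c q" by (simp only: power_Suc2)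
  then have "p - smult c q = 0 \<or> Suc n \<le> order a (p - smult c q)" by (simp only: order_divides)
  then show ?thesis unfolding n_def by (intro exI[of _ c]) auto
qed

text \<open>
  At \<open>(a, 0)\<close> the average of an element of the local ring has a denominator that is the norm of a
  function not vanishing at the point, hence does not vanish at \<open>a\<close>. A rational function of
  \<open>x\<close> with a zero at \<open>a\<close> lies in the maximal ideal of the local ring itself.
\<close>
lemma ramified_affine_point:
  assumes root: "poly F a = 0" and cop: "coprime d (order a F)"
  shows "ramified_point d f (affine_point a 0) (\<lambda>N p. eval2 p a 0) (\<lambda>p. int (order a p))"
proof -
  have "local_point d f (affine_point a 0) (\<lambda>N p. eval2 p a 0)"
    by (rule affine_local_point) (use root d_pos in \<open>simp add: power_0_left\<close>)
  then interpret local_point d f "affine_point a 0" "\<lambda>N p. eval2 p a 0" .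
  show ?thesis
  proof unfold_locales
    show "int (order a (p * q)) = int (order a p) + int (order a q)" if "p \<noteq> 0" "q \<noteq> 0" for p q
      using that by (simp add: order_mult)
    show "min (int (order a p)) (int (order a q)) \<le> int (order a (p + q))" if "p \<noteq> 0" "q \<noteq> 0" "p + q \<noteq> 0" for p q
      using order_add_ge[OF that, of a] by linarith
    show "\<exists>c. p - smult c q = 0 \<or> int (order a q) < int (order a (p - smult c q))"
      if "p \<noteq> 0" "q \<noteq> 0" "int (order a p) = int (order a q)" for p q
      using order_residue[OF that(1,2), of a] that(3) by simp
    show "coprime (int d) (int (order a F))" using cop by simp
    show "eval2 (twist z R) a 0 = 0 \<longleftrightarrow> eval2 R a 0 = 0" for z R by (simp add: eval2_twist)
    fix S R N assume "eval2 R a 0 \<noteq> 0"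
    then have "poly (red (norm_poly R)) a \<noteq> 0"
      using finite_U by (simp add: poly_red_at_root[OF root] eval2_norm_poly)
    then have "order a (red (norm_poly R)) = 0" by (rule order_0I)
    then show "red (S * conorm_poly R) = 0 \<or> int (order a (red (norm_poly R))) \<le> int (order a (red (S * conorm_poly R)))"
      by simp
  next
    fix M r p
    assume M: "maximalideal M (subring_of R_P)" and r: "r \<noteq> 0" and p: "p = 0 \<or> int (order a r) < int (order a p)"
    interpret maxideal_of M R_P by (rule maxideal_of.intro[OF M])
    show "x_fun p / x_fun r \<in> M"
    proof (cases "p = 0")
      case True
      then show ?thesis using M_closed(2) by simp
    next
      case False
      define n where "n = order a r"
      obtain r' where r': "r = [:-a, 1:] ^ n * r'" "\<not> [:-a, 1:] dvd r'"
        using order_decomp[OF r] unfolding n_def by metis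
      have "Suc n \<le> order a p" using p False unfolding n_def by simp
      then have "[:-a, 1:] ^ Suc n dvd p" by (simp only: order_divides) simp
      then obtain p' where p': "p = [:-a, 1:] ^ n * ([:-a, 1:] * p')" by (metis dvdE mult.assoc power_Suc2)
      have nz: "x_fun ([:-a, 1:] ^ n) \<noteq> 0" unfolding x_fun_eq_0_iff by simp
      have "x_fun p / x_fun r = ev [:[:-a, 1:] * p':] / ev [:r':]"
        unfolding ev_const p' r'(1) ring_mapD(4)[OF ring_map_x_fun]
        by (rule mult_divide_mult_cancel_left[OF nz])
      moreover have "ev [:[:-a, 1:] * p':] / ev [:r':] \<in> m_P"
      proof -
        obtain N1 N2 where "total_degree_le [:[:-a, 1:] * p':] N1" "total_degree_le [:r':] N2"
          using total_degree_le_exists by meson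
        then have "total_degree_le [:[:-a, 1:] * p':] (max N1 N2)" "total_degree_le [:r':] (max N1 N2)"
          by (auto simp: total_degree_le_const)
        moreover have "eval2 [:[:-a, 1:] * p':] a 0 = 0" by simp
        moreover have "eval2 [:r':] a 0 \<noteq> 0" using r'(2) by (simp add: poly_eq_0_iff_dvd)
        ultimately show ?thesis by (rule m_I)
      qed
      ultimately show ?thesis using m_subset_maximal[OF M] by auto
    qed
  qed
qed


section \<open>The point at infinity\<close>

lemma H_norm_poly:
  assumes mult: "\<And>p N q N'. total_degree_le p N \<Longrightarrow> total_degree_le q N' \<Longrightarrow> H (N + N') (p * q) = (H N p * H N' q :: 'k alg_closure)"
    and one: "H 0 1 = 1" and r: "total_degree_le r N" and V: "finite V"
  shows "total_degree_le (\<Prod>z\<in>V. twist z r) (card V * N) \<and> H (card V * N) (\<Prod>z\<in>V. twist z r) = (\<Prod>z\<in>V. H N (twist z r))"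
  using V
proof (induction V rule: finite_induct)
  case (insert z V)
  have "total_degree_le (twist z r * (\<Prod>z\<in>V. twist z r)) (N + card V * N)"
    using insert by (intro total_degree_le_mult total_degree_le_twist[OF r]) simp
  moreover have "H (N + card V * N) (twist z r * (\<Prod>z\<in>V. twist z r)) = H N (twist z r) * H (card V * N) (\<Prod>z\<in>V. twist z r)"
    using insert by (intro mult total_degree_le_twist[OF r]) simp
  ultimately show ?case using insert by simp
qed (simp add: one)

lemma total_degree_le_norm_poly: "total_degree_le r N \<Longrightarrow> total_degree_le (norm_poly r) (d * N)"
  using H_norm_poly[of "\<lambda>N p. 1" r N U] finite_U card_U by (simp add: norm_poly_def)

lemma total_degree_le_conorm_poly:
  assumes "total_degree_le p N" "total_degree_le r N"
  shows "total_degree_le (p * conorm_poly r) (d * N)"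
proof -
  have "card (U - {1}) = d - 1" using U_simps(1) card_U finite_U by (simp add: card_Diff_singleton)
  then have "total_degree_le (conorm_poly r) ((d - 1) * N)"
    using H_norm_poly[of "\<lambda>N p. 1" r N "U - {1}"] assms finite_U by (simp add: conorm_poly_def)
  from total_degree_le_mult[OF assms(1) this] show ?thesis using d_pos by (cases d) auto
qed

lemma red_bounded:
  assumes "total_degree_le q (d * N)"
  shows "red q = (\<Sum>j\<le>N. coeff q (d * j) * F ^ j)"
  by (rule red_altdef, rule total_degree_le_coeff_0[OF assms]) (use d_pos in simp)

lemma degree_red_term:
  assumes "total_degree_le q (d * N)" "j \<le> N"
  shows "degree (coeff q (d * j) * F ^ j) \<le> d * (N - j) + j * degree F"
proof -
  have "degree (coeff q (d * j)) \<le> d * N - d * j" by (rule total_degree_le_degree_coeff[OF assms(1)])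
  moreover have "degree (F ^ j) = j * degree F" using F0 by (simp add: degree_power_eq)
  ultimately show ?thesis using degree_mult_le[of "coeff q (d * j)" "F ^ j"] by (simp add: diff_mult_distrib2)
qed

lemma x_fun_expand: "x_fun p = (\<Sum>i\<le>degree p. x_fun [:coeff p i:] * x_fun [:0, 1:] ^ i)"
proof -
  have "p = (\<Sum>i\<le>degree p. [:coeff p i:] * [:0, 1:] ^ i)"
    by (subst poly_as_sum_of_monoms[symmetric]) (simp add: monom_altdef)
  then have "x_fun p = x_fun (\<Sum>i\<le>degree p. [:coeff p i:] * [:0, 1:] ^ i)" by (rule arg_cong)
  also have "\<dots> = (\<Sum>i\<le>degree p. x_fun ([:coeff p i:] * [:0, 1:] ^ i))" by (rule ring_map_sum[OF ring_map_x_fun])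
  also have "\<dots> = (\<Sum>i\<le>degree p. x_fun [:coeff p i:] * x_fun [:0, 1:] ^ i)"
    by (simp only: ring_mapD(4,7)[OF ring_map_x_fun])
  finally show ?thesis .
qed

text \<open>
  After multiplication by a power of \<open>s = 1 / x\<close>, numerator and denominator become polynomials in
  \<open>s\<close>; modulo an ideal containing \<open>s\<close> the denominator is its leading coefficient, a
  unit, and the numerator is zero.
\<close>
lemma inverse_x_mem_imp:
  fixes M R :: "'k ambient set"
  assumes M: "maximalideal M (subring_of R)" and cR: "\<And>c. x_fun [:c:] \<in> R"
    and s: "inverse (x_fun [:0, 1:]) \<in> M"
    and r: "r \<noteq> 0" and p: "p = 0 \<or> degree p < degree r" and t: "x_fun p / x_fun r \<in> R"
  shows "x_fun p / x_fun r \<in> M"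
proof -
  interpret maxideal_of M R by (rule maxideal_of.intro[OF M])
  define XX where "XX = (x_fun [:0, 1:] :: 'k ambient)"
  define s where "s = inverse XX"
  have XX: "XX \<noteq> 0" by (simp add: XX_def)
  have sM: "s \<in> M" and sR: "s \<in> R" using s M_closed(1) by (auto simp: s_def XX_def)
  have poly: "x_fun p = (\<Sum>i\<le>degree p. x_fun [:coeff p i:] * XX ^ i)" for p
    unfolding XX_def by (rule x_fun_expand)
  have scale: "x_fun p * s ^ n = (\<Sum>i\<le>degree p. x_fun [:coeff p i:] * s ^ (n - i))" if "degree p \<le> n" for p n
  proof -
    have "XX ^ i * s ^ n = s ^ (n - i)" if "i \<le> n" for i
    proof -
      have "s ^ n = s ^ i * s ^ (n - i)" using that by (simp flip: power_add)
      then show ?thesis using XX by (simp add: s_def power_inverse)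
    qed
    then show ?thesis by (subst poly, unfold sum_distrib_right, intro sum.cong) (use that in \<open>simp_all add: mult.assoc\<close>)
  qed
  have sMp: "x_fun [:c:] * s ^ i \<in> M" if "i > 0" for c i
  proof -
    have "s ^ i = s * s ^ (i - 1)" using that by (rule power_pred)
    then show ?thesis using M_closed(4,5) sM R_power[OF sR] cR by simp
  qed
  define n where "n = degree r"
  have pM: "x_fun p * s ^ n \<in> M"
  proof (cases "p = 0")
    case False
    then have "degree p < n" using p by (simp add: n_def)
    then show ?thesis by (subst scale) (auto intro!: M_sum sMp)
  qed (simp add: M_closed)
  have rs: "x_fun r * s ^ n = x_fun [:lead_coeff r:] + (\<Sum>i<n. x_fun [:coeff r i:] * s ^ (n - i))"
    by (subst scale) (simp_all add: n_def lessThan_Suc_atMost[symmetric] add.commute)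
  have small: "(\<Sum>i<n. x_fun [:coeff r i:] * s ^ (n - i)) \<in> M" by (intro M_sum sMp) simp
  have rR: "x_fun r * s ^ n \<in> R" unfolding rs using cR small M_closed(1) R_closed(4) by blast
  have rM: "x_fun r * s ^ n \<notin> M"
  proof
    assume "x_fun r * s ^ n \<in> M"
    then have "x_fun [:lead_coeff r:] \<in> M" using M_closed(7)[OF _ small, of "x_fun r * s ^ n"] unfolding rs by simp
    moreover have "x_fun [:lead_coeff r:] * x_fun [:inverse (lead_coeff r):] = (1 :: 'k ambient)"
      unfolding x_fun_const_mult[symmetric] using r by (simp add: x_fun_const_1)
    ultimately show False using unit_notin cR by blast
  qed
  have "(x_fun r * s ^ n) * (x_fun p / x_fun r) = x_fun p * s ^ n" using r by simp
  then show ?thesis using prime[OF rR t _ rM] pM by simp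
qed

lemma degree_residue:
  fixes p q :: "'a::field poly"
  assumes "p \<noteq> 0" "q \<noteq> 0" "degree p = degree q"
  shows "\<exists>c. p - smult c q = 0 \<or> degree (p - smult c q) < degree q"
proof -
  define c where "c = lead_coeff p / lead_coeff q"
  have "coeff (p - smult c q) (degree q) = 0" using assms by (simp add: c_def)
  moreover have "degree (p - smult c q) \<le> degree q" using assms by (intro degree_diff_le) auto
  ultimately show ?thesis
    by (metis leading_coeff_0_iff le_neq_implies_less)
qed

text \<open>
  The common part of the two cases at infinity. Once \<open>1 / x\<close> vanishes at every point above, so do
  all functions of \<open>x\<close> with positive valuation.
\<close>
lemma ramified_infinity_common:
  assumes lp: "local_point d f P H" and deg: "coprime (int d) (int (degree F))"
    and tw: "\<And>z r N. z \<in> U \<Longrightarrow> total_degree_le r N \<Longrightarrow> H N (twist z r) = 0 \<longleftrightarrow> H N r = 0"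
    and av: "\<And>S R N. total_degree_le S N \<Longrightarrow> total_degree_le R N \<Longrightarrow> H N R \<noteq> 0 \<Longrightarrow>
      degree (red (S * conorm_poly R)) \<le> degree (red (norm_poly R))"
    and s: "\<And>M. maximalideal M (subring_of (local_point.R_P d f H)) \<Longrightarrow> inverse (x_fun [:0, 1:]) \<in> M"
  shows "ramified_point d f P H (\<lambda>p. - int (degree p))"
proof -
  interpret local_point d f P H by (rule lp)
  show ?thesis
  proof unfold_locales
    show "- int (degree (p * q)) = - int (degree p) + - int (degree q)" if "p \<noteq> 0" "q \<noteq> 0" for p q :: "'k alg_closure poly"
      using that by (simp add: degree_mult_eq)
    show "min (- int (degree p)) (- int (degree q)) \<le> - int (degree (p + q))" for p q :: "'k alg_closure poly"
      using degree_add_le_max[of p q] by linarith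
    show "\<exists>c. p - smult c q = 0 \<or> - int (degree q) < - int (degree (p - smult c q))"
      if "p \<noteq> 0" "q \<noteq> 0" "- int (degree p) = - int (degree q)" for p q :: "'k alg_closure poly"
      using degree_residue[OF that(1,2)] that(3) by simp
    show "coprime (int d) (- int (degree F))" using deg by simp
    show "H N (twist z R) = 0 \<longleftrightarrow> H N R = 0" if "z \<in> U" "total_degree_le R N" for z R N using tw[OF that] .
    show "red (S * conorm_poly R) = 0 \<or> - int (degree (red (norm_poly R))) \<le> - int (degree (red (S * conorm_poly R)))"
      if "total_degree_le S N" "total_degree_le R N" "H N R \<noteq> 0" for S N R using av[OF that] by simp
    show "x_fun p / x_fun r \<in> M"
      if "maximalideal M (subring_of R_P)" "r \<noteq> 0" "p = 0 \<or> - int (degree r) < - int (degree p)" "x_fun p / x_fun r \<in> R_P"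
      for M r p
      by (rule inverse_x_mem_imp[OF that(1) _ s[OF that(1)] that(2) _ that(4)])
         (use O_const O_subset_R that(3) in auto)
  qed
qed

end

text \<open>
  Such an equation shows first that \<open>h\<close> is integral and then that a power of \<open>h\<close> lies
  in \<open>M\<close>.
\<close>
lemma (in local_point) integral_relation_mem:
  assumes M: "maximalideal M (subring_of R_P)" and h: "h \<in> K" and n: "n > 0"
    and a: "\<And>i. i < n \<Longrightarrow> a i \<in> m_P" and eq: "h ^ n = (\<Sum>i<n. a i * h ^ i)"
  shows "h \<in> M"
proof -
  interpret maxideal_of M R_P by (rule maxideal_of.intro[OF M])
  define q where "q = monom 1 n - (\<Sum>i<n. monom (a i) i)"
  have cq: "coeff q i = (if i = n then 1 else if i < n then - a i else 0)" for i
    by (auto simp: q_def coeff_sum)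
  have deg: "degree q = n"
    by (rule antisym) (auto intro!: degree_le le_degree simp: cq)
  have hR: "h \<in> R_P"
  proof (rule R_I[OF h, of q])
    show "lead_coeff q = 1" by (simp add: deg cq)
    show "coeff q i \<in> O_P" for i using a m_subset_O O_closed(3) by (auto simp: cq)
    show "poly q h = 0" by (simp add: q_def poly_sum poly_monom eq)
  qed
  have "h ^ n \<in> M"
    unfolding eq using a m_subset_maximal[OF M] R_power[OF hR] by (intro M_sum M_closed(4)) auto
  then show ?thesis by (rule prime_power[OF hR])
qed

context kummer
begin

text \<open>
  Among the terms of \<open>red q\<close> the one with the highest power of \<open>F\<close> dominates, because
  \<open>degree F > d\<close>; its top coefficient is the value of \<open>q\<close> at the point up to a power
  of the leading coefficient of \<open>F\<close>.
\<close>
lemma red_y_infinity: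
  assumes D: "degree F > d" and q: "total_degree_le q (d * N)"
  shows "degree (red q) \<le> N * degree F" "coeff (red q) (N * degree F) = coeff (coeff q (d * N)) 0 * lead_coeff F ^ N"
proof -
  have dj: "degree (coeff q (d * j) * F ^ j) \<le> d * (N - j) + j * degree F" if "j \<le> N" for j
    using degree_red_term[OF q that] .
  have le: "d * (N - j) + j * degree F \<le> N * degree F" if "j \<le> N" for j
  proof -
    have "d * (N - j) \<le> (N - j) * degree F" using D by simp
    then show ?thesis using that by (metis add_le_mono1 add_mult_distrib le_add_diff_inverse2)
  qed
  have lt: "d * (N - j) + j * degree F < N * degree F" if "j < N" for j
  proof -
    have "d * (N - j) < (N - j) * degree F" using D that by simp
    then have "d * (N - j) + j * degree F < (N - j) * degree F + j * degree F" by simp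
    also have "\<dots> = (N - j + j) * degree F" by (simp only: add_mult_distrib)
    finally show ?thesis using that by simp
  qed
  show "degree (red q) \<le> N * degree F"
    unfolding red_bounded[OF q] using dj le by (intro degree_sum_le) (auto intro: order_trans)
  have "coeff (red q) (N * degree F) = (\<Sum>j\<le>N. coeff (coeff q (d * j) * F ^ j) (N * degree F))"
    unfolding red_bounded[OF q] by (simp add: coeff_sum)
  also have "\<dots> = (\<Sum>j\<in>{N}. coeff (coeff q (d * j) * F ^ j) (N * degree F))"
  proof (rule sum.mono_neutral_right)
    show "\<forall>j\<in>{..N} - {N}. coeff (coeff q (d * j) * F ^ j) (N * degree F) = 0"
    proof
      fix j assume "j \<in> {..N} - {N}"
      then have "j < N" by auto
      then have "degree (coeff q (d * j) * F ^ j) < N * degree F" using dj[of j] lt[of j] by linarith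
      then show "coeff (coeff q (d * j) * F ^ j) (N * degree F) = 0" by (rule coeff_eq_0)
    qed
  qed auto
  also have "\<dots> = coeff (coeff q (d * N) * F ^ N) (0 + N * degree F)" by simp
  also have "\<dots> = coeff (coeff q (d * N)) 0 * coeff (F ^ N) (N * degree F)"
    by (rule coeff_mult_top) (use total_degree_le_degree_coeff[OF q, of "d * N"] F0 in \<open>auto simp: degree_power_eq\<close>)
  also have "coeff (F ^ N) (N * degree F) = lead_coeff F ^ N"
    using lead_coeff_power[of F N] F0 by (simp add: degree_power_eq)
  finally show "coeff (red q) (N * degree F) = coeff (coeff q (d * N)) 0 * lead_coeff F ^ N" .
qed

text \<open>
  Here the term without \<open>F\<close> dominates, because \<open>degree F < d\<close>.
\<close>
lemma red_x_infinity:
  assumes D: "degree F < d" and q: "total_degree_le q (d * N)"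
  shows "degree (red q) \<le> d * N" "coeff (red q) (d * N) = coeff (coeff q 0) (d * N)"
proof -
  have dj: "degree (coeff q (d * j) * F ^ j) \<le> d * (N - j) + j * degree F" if "j \<le> N" for j
    using degree_red_term[OF q that] .
  have le: "d * (N - j) + j * degree F \<le> d * N" if "j \<le> N" for j
  proof -
    have "j * degree F \<le> d * j" using D by simp
    then have "d * (N - j) + j * degree F \<le> d * (N - j) + d * j" by simp
    also have "\<dots> = d * (N - j + j)" by (simp only: add_mult_distrib2)
    finally show ?thesis using that by simp
  qed
  have lt: "d * (N - j) + j * degree F < d * N" if "j \<le> N" "j > 0" for j
  proof -
    have "j * degree F < d * j" using D that by simp
    then have "d * (N - j) + j * degree F < d * (N - j) + d * j" by simp
    also have "\<dots> = d * (N - j + j)" by (simp only: add_mult_distrib2)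
    finally show ?thesis using that by simp
  qed
  show "degree (red q) \<le> d * N"
    unfolding red_bounded[OF q] using dj le by (intro degree_sum_le) (auto intro: order_trans)
  have "coeff (red q) (d * N) = (\<Sum>j\<le>N. coeff (coeff q (d * j) * F ^ j) (d * N))"
    unfolding red_bounded[OF q] by (simp add: coeff_sum)
  also have "\<dots> = (\<Sum>j\<in>{0}. coeff (coeff q (d * j) * F ^ j) (d * N))"
  proof (rule sum.mono_neutral_right)
    show "\<forall>j\<in>{..N} - {0}. coeff (coeff q (d * j) * F ^ j) (d * N) = 0"
    proof
      fix j assume "j \<in> {..N} - {0}"
      then have "degree (coeff q (d * j) * F ^ j) < d * N" using dj[of j] lt[of j] by fastforce
      then show "coeff (coeff q (d * j) * F ^ j) (d * N) = 0" by (rule coeff_eq_0)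
    qed
  qed auto
  finally show "coeff (red q) (d * N) = coeff (coeff q 0) (d * N)" by simp
qed

lemma degree_eq_of_coeff: "degree p \<le> n \<Longrightarrow> coeff p n \<noteq> 0 \<Longrightarrow> degree p = n"
  by (simp add: le_degree le_antisym)

lemma homog_eval_y_infinity: "homog_eval N r (0, s, 0) = s ^ N * coeff (coeff r N) 0"
proof -
  have "homog_eval N r (0, s, 0) = (\<Sum>j\<in>{N}. coeff (coeff r j) (N - j) * 0 ^ (N - j) * s ^ j)"
    unfolding homog_eval_infinity by (rule sum.mono_neutral_right) (auto simp: power_0_left)
  then show ?thesis by simp
qed

lemma homog_eval_x_infinity: "homog_eval N r (s, 0, 0) = s ^ N * coeff (coeff r 0) N"
proof -
  have "homog_eval N r (s, 0, 0) = (\<Sum>j\<in>{0}. coeff (coeff r j) (N - j) * s ^ (N - j) * 0 ^ j)"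
    unfolding homog_eval_infinity by (rule sum.mono_neutral_right) (auto simp: power_0_left)
  then show ?thesis by simp
qed

text \<open>
  The local coordinates at this point are \<open>u = x / y\<close> and \<open>w = 1 / y\<close>, and
  \<open>s = 1 / x\<close> need not lie in the local ring, but it is integral. With \<open>D = degree F\<close>
  and \<open>F = (\<Sum>j\<le>D. f\<^sub>j * x ^ j)\<close>, multiplying the equation of the curve by
  \<open>w ^ d * s ^ (D - d)\<close> and separating the terms with \<open>j \<le> d\<close> from those with
  \<open>j > d\<close> gives \<open>(1 - (\<Sum>j\<le>d. f\<^sub>j * u ^ j * w ^ (d - j))) * s ^ (D - d) =
  (\<Sum>j\<in>{d<..D}. f\<^sub>j * u ^ d * s ^ (D - j))\<close>. The factor on the left is a unit of the local
  ring and \<open>u\<close> vanishes at the point, so \<open>s\<close> satisfies an integral equation all of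
  whose lower coefficients vanish at the point.
\<close>
lemma ramified_y_infinity:
  assumes D: "degree F > d" and cop: "coprime (int d) (int (degree F))"
  shows "ramified_point d f y_infinity (\<lambda>N p. coeff (coeff p N) 0) (\<lambda>p. - int (degree p))"
proof -
  let ?H = "\<lambda>N p. coeff (coeff p N) 0 :: 'k alg_closure"
  have mult: "?H (N + N') (p * q) = ?H N p * ?H N' q" if "total_degree_le p N" "total_degree_le q N'" for p q N N'
    using coeff_mult_top[OF total_degree_le_degree[OF that(1)] total_degree_le_degree[OF that(2)]]
    by (simp add: coeff_mult)
  have norm: "?H (d * N) (norm_poly r) \<noteq> 0" if "total_degree_le r N" "?H N r \<noteq> 0" for r N
  proof -
    have "?H (card U * N) (norm_poly r) = (\<Prod>z\<in>U. ?H N (twist z r))"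
      unfolding norm_poly_def using H_norm_poly[of ?H, OF mult _ that(1) finite_U] by simp
    then show ?thesis using that(2) finite_U U_simps(4) by (auto simp: card_U coeff_twist)
  qed
  have redn: "degree (red (norm_poly r)) = N * degree F" "red (norm_poly r) \<noteq> 0" if "total_degree_le r N" "?H N r \<noteq> 0" for r N
  proof -
    note q = total_degree_le_norm_poly[OF that(1)]
    have c: "coeff (red (norm_poly r)) (N * degree F) \<noteq> 0"
      unfolding red_y_infinity(2)[OF D q] using norm[OF that] F0 by simp
    show "degree (red (norm_poly r)) = N * degree F" by (rule degree_eq_of_coeff[OF red_y_infinity(1)[OF D q] c])
    show "red (norm_poly r) \<noteq> 0" using c by auto
  qed
  have lp: "local_point d f y_infinity ?H"
  proof unfold_locales
    show "(\<forall>v\<in>y_infinity. homog_eval N r v \<noteq> 0) \<longleftrightarrow> ?H N r \<noteq> 0" for r N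
    proof -
      have "(\<forall>v\<in>y_infinity. homog_eval N r v \<noteq> 0) \<longleftrightarrow> (\<forall>s. s \<noteq> 0 \<longrightarrow> s ^ N * ?H N r \<noteq> 0)"
        by (auto simp: y_infinity_def homog_eval_y_infinity)
      also have "\<dots> \<longleftrightarrow> ?H N r \<noteq> 0" by (auto intro: exI[of _ 1])
      finally show ?thesis .
    qed
    show "ev r \<noteq> 0" if "total_degree_le r N" "?H N r \<noteq> 0" for r N
      using redn(2)[OF that] by (simp add: red_norm_poly_eq_0_iff)
  qed (simp_all add: mult)
  interpret local_point d f y_infinity ?H by (rule lp)
  define s where "s = inverse (x_fun [:0, 1:] :: 'k ambient)"
  define u where "u = ev [:[:0, 1:]:] / ev [:0, 1:]"
  define w where "w = ev 1 / ev [:0, 1:]"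
  have y0: "y \<noteq> 0" using y_power F0 d_pos by (metis power_0_left x_fun_eq_0_iff not_gr0)
  have X0: "x_fun [:0, 1:] \<noteq> (0 :: 'k ambient)" by simp
  have td: "total_degree_le [:[:0, 1:]:] 1" "total_degree_le [:0, 1:] 1"
    by (auto simp: total_degree_le_altdef coeff_pCons split: nat.splits)
  have um: "u \<in> m_P" unfolding u_def by (rule m_I[OF td]) simp_all
  have wm: "w \<in> m_P" unfolding w_def by (rule m_I[OF _ td(2)]) simp_all
  have usw: "u * s = w" "w * y = 1" using y0 X0 by (simp_all add: u_def w_def s_def)
  have uX: "u = x_fun [:0, 1:] * w" by (simp add: u_def w_def)
  let ?X = "x_fun [:0, 1:] :: 'k ambient"
  have Xs: "?X * s = 1" using X0 by (simp add: s_def)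
  let ?D = "degree F"
  have sD: "s ^ (?D - d) = (\<Sum>j\<le>?D. x_fun [:coeff F j:] * (?X ^ j * w ^ d * s ^ (?D - d)))"
  proof -
    have "1 = (w * y) ^ d" using usw by simp
    also have "\<dots> = w ^ d * x_fun F" by (simp add: power_mult_distrib y_power)
    also have "\<dots> = w ^ d * (\<Sum>j\<le>?D. x_fun [:coeff F j:] * ?X ^ j)" by (subst x_fun_expand) (rule refl)
    finally have "s ^ (?D - d) = w ^ d * (\<Sum>j\<le>?D. x_fun [:coeff F j:] * ?X ^ j) * s ^ (?D - d)" by simp
    then show ?thesis by (simp add: sum_distrib_left sum_distrib_right mult_ac)
  qed
  have low: "?X ^ j * w ^ d * s ^ (?D - d) = u ^ j * w ^ (d - j) * s ^ (?D - d)" if "j \<le> d" for j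
  proof -
    have "w ^ d = w ^ j * w ^ (d - j)" using that by (simp flip: power_add)
    then show ?thesis by (simp add: uX power_mult_distrib mult_ac)
  qed
  have high: "?X ^ j * w ^ d * s ^ (?D - d) = u ^ d * s ^ (?D - j)" if "d < j" "j \<le> ?D" for j
  proof -
    have "?X ^ j = ?X ^ d * ?X ^ (j - d)" "s ^ (?D - d) = s ^ (j - d) * s ^ (?D - j)"
      using that by (simp_all flip: power_add)
    then have "?X ^ j * w ^ d * s ^ (?D - d) = (?X * w) ^ d * (?X * s) ^ (j - d) * s ^ (?D - j)"
      by (simp add: power_mult_distrib mult_ac)
    then show ?thesis by (simp add: uX Xs)
  qed
  define c0 where "c0 = (\<Sum>j\<le>d. x_fun [:coeff F j:] * (u ^ j * w ^ (d - j)))"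
  have c0m: "c0 \<in> m_P"
    unfolding c0_def
  proof (rule m_sum)
    fix j assume "j \<in> {..d}"
    have uO: "u ^ i \<in> O_P" "w ^ i \<in> O_P" for i using um wm m_subset_O O_power by blast+
    have "u ^ j * w ^ (d - j) \<in> m_P"
    proof (cases "j = 0")
      case True
      have "w ^ d = w * w ^ (d - 1)" using d_pos by (rule power_pred)
      then show ?thesis using m_closed(3)[OF wm uO(2)[of "d - 1"]] True by simp
    next
      case False
      then have "u ^ j = u * u ^ (j - 1)" by (intro power_pred) simp
      then have "u ^ j * w ^ (d - j) = u * (u ^ (j - 1) * w ^ (d - j))" by (simp only: mult.assoc)
      then show ?thesis using m_closed(3)[OF um O_closed(2)[OF uO]] by (simp only:)
    qed
    then have "(u ^ j * w ^ (d - j)) * x_fun [:coeff F j:] \<in> m_P" by (rule m_closed(3)[OF _ O_const])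
    then show "x_fun [:coeff F j:] * (u ^ j * w ^ (d - j)) \<in> m_P" by (subst mult.commute)
  qed
  have split: "{..?D} = {..d} \<union> {d<..?D}" using D by auto
  have "s ^ (?D - d) = (\<Sum>j\<le>d. x_fun [:coeff F j:] * (u ^ j * w ^ (d - j) * s ^ (?D - d)))
      + (\<Sum>j\<in>{d<..?D}. x_fun [:coeff F j:] * (u ^ d * s ^ (?D - j)))"
    by (subst sD, unfold split, subst sum.union_disjoint) (auto simp: low high)
  also have "(\<Sum>j\<le>d. x_fun [:coeff F j:] * (u ^ j * w ^ (d - j) * s ^ (?D - d))) = c0 * s ^ (?D - d)"
    by (simp add: c0_def sum_distrib_right mult.assoc)
  also have "(\<Sum>j\<in>{d<..?D}. x_fun [:coeff F j:] * (u ^ d * s ^ (?D - j)))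
      = (\<Sum>i<?D - d. x_fun [:coeff F (?D - i):] * u ^ d * s ^ i)"
    by (rule sum.reindex_bij_witness[where i = "\<lambda>i. ?D - i" and j = "\<lambda>j. ?D - j"]) (auto simp: mult.assoc)
  finally have rel: "(1 - c0) * s ^ (?D - d) = (\<Sum>i<?D - d. x_fun [:coeff F (?D - i):] * u ^ d * s ^ i)"
    by (simp add: algebra_simps)
  have cO: "c0 \<in> O_P" using c0m m_subset_O by blast
  have eO: "1 - c0 \<in> O_P" using O_closed(1)[OF O_1 O_closed(3)[OF cO]] by simp
  have em: "1 - c0 \<notin> m_P"
  proof
    assume "1 - c0 \<in> m_P"
    then have "(1 - c0) + c0 \<in> m_P" using c0m by (rule m_closed(2))
    then show False using one_notin_m by simp
  qed
  note unit = O_unit[OF eO em]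
  define a where "a i = u ^ d * (inverse (1 - c0) * x_fun [:coeff F (?D - i):])" for i
  have am: "a i \<in> m_P" for i
  proof -
    have "u ^ d = u * u ^ (d - 1)" using d_pos by (rule power_pred)
    then have "u ^ d \<in> m_P" using m_closed(3)[OF um O_power[of u "d - 1"]] um m_subset_O by auto
    then show ?thesis unfolding a_def using unit(2) O_const O_closed(2) by (intro m_closed(3)) auto
  qed
  have "s ^ (?D - d) = inverse (1 - c0) * ((1 - c0) * s ^ (?D - d))" using unit(1) by simp
  also have "\<dots> = (\<Sum>i<?D - d. a i * s ^ i)" unfolding rel by (simp add: a_def sum_distrib_left mult_ac)
  finally have eq: "s ^ (?D - d) = (\<Sum>i<?D - d. a i * s ^ i)" .
  have sK: "s \<in> K" unfolding s_def by (rule K_closed(4)) simp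
  have sM: "s \<in> M" if "maximalideal M (subring_of R_P)" for M
    by (rule integral_relation_mem[OF that sK _ am eq]) (use D in simp)
  show ?thesis
  proof (rule ramified_infinity_common[OF lp cop])
    show "?H N (twist z r) = 0 \<longleftrightarrow> ?H N r = 0" if "z \<in> U" for z r N
      using U_simps(4)[OF that] by (simp add: coeff_twist)
    show "degree (red (S * conorm_poly R)) \<le> degree (red (norm_poly R))"
      if "total_degree_le S N" "total_degree_le R N" "?H N R \<noteq> 0" for S R N
      unfolding redn(1)[OF that(2,3)] by (rule red_y_infinity(1)[OF D total_degree_le_conorm_poly[OF that(1,2)]])
    show "inverse (x_fun [:0, 1:]) \<in> M" if "maximalideal M (subring_of R_P)" for M
      using sM[OF that] by (simp add: s_def)
  qed
qed

text \<open>
  Here \<open>1 / x\<close> is itself a local coordinate and vanishes at the point.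
\<close>
lemma ramified_x_infinity:
  assumes D: "degree F < d" and cop: "coprime (int d) (int (degree F))"
  shows "ramified_point d f x_infinity (\<lambda>N p. coeff (coeff p 0) N) (\<lambda>p. - int (degree p))"
proof -
  let ?H = "\<lambda>N p. coeff (coeff p 0) N :: 'k alg_closure"
  have mult: "?H (N + N') (p * q) = ?H N p * ?H N' q" if "total_degree_le p N" "total_degree_le q N'" for p q N N'
    using coeff_mult_top[of "coeff p 0" N "coeff q 0" N'] total_degree_le_degree_coeff[OF that(1), of 0]
      total_degree_le_degree_coeff[OF that(2), of 0] by (simp add: coeff_mult)
  have norm: "?H (d * N) (norm_poly r) \<noteq> 0" if "total_degree_le r N" "?H N r \<noteq> 0" for r N
  proof -
    have "?H (card U * N) (norm_poly r) = (\<Prod>z\<in>U. ?H N (twist z r))"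
      unfolding norm_poly_def using H_norm_poly[of ?H, OF mult _ that(1) finite_U] by simp
    then show ?thesis using that(2) finite_U by (auto simp: card_U coeff_twist)
  qed
  have redn: "degree (red (norm_poly r)) = d * N" "red (norm_poly r) \<noteq> 0" if "total_degree_le r N" "?H N r \<noteq> 0" for r N
  proof -
    note q = total_degree_le_norm_poly[OF that(1)]
    have c: "coeff (red (norm_poly r)) (d * N) \<noteq> 0"
      unfolding red_x_infinity(2)[OF D q] using norm[OF that] .
    show "degree (red (norm_poly r)) = d * N" by (rule degree_eq_of_coeff[OF red_x_infinity(1)[OF D q] c])
    show "red (norm_poly r) \<noteq> 0" using c by auto
  qed
  have lp: "local_point d f x_infinity ?H"
  proof unfold_locales
    show "(\<forall>v\<in>x_infinity. homog_eval N r v \<noteq> 0) \<longleftrightarrow> ?H N r \<noteq> 0" for r N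
    proof -
      have "(\<forall>v\<in>x_infinity. homog_eval N r v \<noteq> 0) \<longleftrightarrow> (\<forall>s. s \<noteq> 0 \<longrightarrow> s ^ N * ?H N r \<noteq> 0)"
        by (auto simp: x_infinity_def homog_eval_x_infinity)
      also have "\<dots> \<longleftrightarrow> ?H N r \<noteq> 0" by (auto intro: exI[of _ 1])
      finally show ?thesis .
    qed
    show "ev r \<noteq> 0" if "total_degree_le r N" "?H N r \<noteq> 0" for r N
      using redn(2)[OF that] by (simp add: red_norm_poly_eq_0_iff)
  qed (simp_all add: mult)
  interpret local_point d f x_infinity ?H by (rule lp)
  have "total_degree_le ([:[:0, 1:]:] :: 'k alg_closure poly poly) 1" by (simp add: total_degree_le_const)
  then have "ev 1 / ev [:[:0, 1:]:] \<in> m_P" by (rule m_I[OF total_degree_le_1]) simp_all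
  then have sm: "inverse (x_fun [:0, 1:]) \<in> m_P" by (simp add: divide_inverse)
  show ?thesis
  proof (rule ramified_infinity_common[OF lp cop])
    show "?H N (twist z r) = 0 \<longleftrightarrow> ?H N r = 0" if "z \<in> U" for z r N
      by (simp add: coeff_twist)
    show "degree (red (S * conorm_poly R)) \<le> degree (red (norm_poly R))"
      if "total_degree_le S N" "total_degree_le R N" "?H N R \<noteq> 0" for S R N
      unfolding redn(1)[OF that(2,3)] by (rule red_x_infinity(1)[OF D total_degree_le_conorm_poly[OF that(1,2)]])
    show "inverse (x_fun [:0, 1:]) \<in> M" if "maximalideal M (subring_of R_P)" for M
      using m_subset_maximal[OF that] sm by blast
  qed
qed

end

section \<open>Affine points with nonzero second coordinate\<close>

lemma common_total_degree: "\<exists>N. total_degree_le p N \<and> total_degree_le r N"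
proof -
  obtain N1 N2 where "total_degree_le p N1" "total_degree_le r N2" using total_degree_le_exists by meson
  then have "total_degree_le p (max N1 N2)" "total_degree_le r (max N1 N2)"
    unfolding total_degree_le_def by (meson le_max_iff_disj)+
  then show ?thesis by blast
qed

context kummer
begin

text \<open>
  The local ring at a point with \<open>y \<noteq> 0\<close> is a discrete valuation ring with uniformiser
  \<open>x - a\<close>. Nonzero elements \<open>p (x, y)\<close> divide their norm, a polynomial in
  \<open>x\<close> and thus a power of \<open>x - a\<close> times a unit; so they are themselves of this form.
  Hence of any two mutually inverse elements of the function field one lies in the local ring, which is
  therefore integrally closed.
\<close>
lemma unramified_point_normal:
  assumes ab: "b ^ d = poly F a" and b: "b \<noteq> 0"
  shows "local_point.R_P d f (\<lambda>N p. eval2 p a b) = local_point.O_P d f (\<lambda>N p. eval2 p a b)"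
proof -
  interpret local_point d f "affine_point a b" "\<lambda>N p. eval2 p a b" by (rule affine_local_point[OF ab])
  define \<pi> where "\<pi> = (x_fun [:-a, 1:] :: 'k ambient)"
  have O_I': "ev p / ev r \<in> O_P" if "eval2 r a b \<noteq> 0" for p r
  proof -
    obtain N where "total_degree_le p N" "total_degree_le r N" using common_total_degree by blast
    then show ?thesis using that by (rule O_I)
  qed
  have m_I': "ev p / ev r \<in> m_P" if "eval2 p a b = 0" "eval2 r a b \<noteq> 0" for p r
  proof -
    obtain N where "total_degree_le p N" "total_degree_le r N" using common_total_degree by blast
    then show ?thesis using that by (rule m_I)
  qed
  have \<pi>0: "\<pi> \<noteq> 0" by (simp add: \<pi>_def)
  have "ev [:[:-a, 1:]:] / ev 1 \<in> m_P" by (rule m_I') (simp_all add: eval2_simps)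
  then have \<pi>m: "\<pi> \<in> m_P" by (simp add: \<pi>_def)

  \<comment> \<open>\<open>x - a\<close> generates the maximal ideal, because \<open>y - b\<close> divides
    \<open>y ^ d - b ^ d\<close> with a cofactor that does not vanish at the point.\<close>
  have principal: "\<exists>t'\<in>O_P. t = \<pi> * t'" if t: "t \<in> m_P" for t
  proof -
    obtain p r N where pr: "t = ev p / ev r" "total_degree_le p N" "total_degree_le r N" "eval2 p a b = 0" "eval2 r a b \<noteq> 0" "ev r \<noteq> 0"
      using t by (rule m_E)
    define Y where "Y = ([:0, 1:] :: 'k alg_closure poly poly)"
    define B where "B = ([:[:b:]:] :: 'k alg_closure poly poly)"
    have "poly (p - [:poly p [:b:]:]) [:b:] = 0" by simp
    then have "[:- [:b:], 1:] dvd p - [:poly p [:b:]:]" by (simp only: poly_eq_0_iff_dvd)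
    then obtain p2 where p2: "p - [:poly p [:b:]:] = [:- [:b:], 1:] * p2" by blast
    have "poly (poly p [:b:]) a = 0" using pr(4) by (simp add: eval2_def)
    then have "[:-a, 1:] dvd poly p [:b:]" by (simp only: poly_eq_0_iff_dvd)
    then obtain p1 where p1: "poly p [:b:] = [:-a, 1:] * p1" by blast
    have lin: "[:- [:b:], 1:] = Y - B" by (simp add: Y_def B_def)
    have "p = [:[:-a, 1:]:] * [:p1:] + (Y - B) * p2"
    proof -
      have "[:[:-a, 1:] * p1:] = [:[:-a, 1:]:] * [:p1:]" by simp
      then have "p - [:[:-a, 1:]:] * [:p1:] = (Y - B) * p2" using p2 unfolding p1 lin by (simp only:)
      then show ?thesis by (simp only: diff_eq_eq add.commute)
    qed
    then have "ev p = ev ([:[:-a, 1:]:] * [:p1:] + (Y - B) * p2)" by (rule arg_cong)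
    then have evp: "ev p = \<pi> * x_fun p1 + (y - x_fun [:b:]) * ev p2"
      by (simp only: ev_simps ev_const Y_def B_def ev_Y \<pi>_def)
    \<comment> \<open>The cofactor of \<open>y - b\<close> in \<open>y ^ d - b ^ d\<close>, with value
      \<open>d * b ^ (d - 1)\<close> at the point.\<close>
    define g where "g = (\<Sum>i<d. B ^ (d - Suc i) * Y ^ i)"
    have "eval2 g a b = (\<Sum>i<d. b ^ (d - Suc i) * b ^ i)"
      unfolding g_def by (simp only: ring_map_sum[OF ring_map_eval2] eval2_simps) (simp add: B_def Y_def eval2_def)
    also have "\<dots> = (\<Sum>i<d. b ^ (d - 1))" by (rule sum.cong) (simp_all flip: power_add)
    finally have g: "eval2 g a b \<noteq> 0" using b d_nonzero by simp
    have evg: "ev g \<noteq> 0"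
    proof -
      obtain N where "total_degree_le g N" using total_degree_le_exists by blast
      then show ?thesis using g by (rule H_nonzero)
    qed
    have "poly (F - [:b ^ d:]) a = 0" using ab by simp
    then have "[:-a, 1:] dvd F - [:b ^ d:]" by (simp only: poly_eq_0_iff_dvd)
    then obtain F1 where F1: "F - [:b ^ d:] = [:-a, 1:] * F1" by blast
    have "Y ^ d - B ^ d = (Y - B) * g" unfolding g_def by (rule power_diff_sumr2)
    then have "ev (Y ^ d - B ^ d) = ev ((Y - B) * g)" by (rule arg_cong)
    then have "(y - x_fun [:b:]) * ev g = y ^ d - x_fun [:b:] ^ d"
      by (simp only: ev_simps ev_const Y_def B_def ev_Y)
    also have "\<dots> = x_fun (F - [:b ^ d:])" by (simp only: y_power x_fun_const_power x_fun_simps)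
    also have "\<dots> = \<pi> * x_fun F1" unfolding F1 \<pi>_def by (rule ring_mapD(4)[OF ring_map_x_fun])
    finally have yb: "y - x_fun [:b:] = \<pi> * x_fun F1 / ev g" using evg by (simp only: eq_divide_eq not_False_eq_True if_True)
    define t' where "t' = ev ([:p1:] * g + [:F1:] * p2) / ev (g * r)"
    have "t' \<in> O_P" unfolding t'_def by (rule O_I') (use g pr(5) in \<open>simp only: eval2_simps mult_eq_0_iff, simp\<close>)
    moreover have "t = \<pi> * t'"
    proof -
      have num: "ev ([:p1:] * g + [:F1:] * p2) = x_fun p1 * ev g + x_fun F1 * ev p2"
        by (simp only: ev_simps ev_const)
      have den: "ev (g * r) = ev g * ev r" by (rule ev_simps(4))
      show ?thesis
        unfolding pr(1) evp yb t'_def num den using evg pr(6) by (simp add: add_divide_distrib distrib_left)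
    qed
    ultimately show ?thesis by blast
  qed

  define unit where "unit e \<longleftrightarrow> e \<in> O_P \<and> e \<noteq> 0 \<and> inverse e \<in> O_P" for e
  have unit_mult: "unit (e * e')" "unit (inverse e)" if "unit e" "unit e'" for e e'
    using that O_closed(2) by (auto simp: unit_def)
  have unit_notin: "e \<notin> m_P" if "unit e" for e
    using m_closed(3)[of e "inverse e"] that one_notin_m by (auto simp: unit_def)
  \<comment> \<open>The divisors of a power of \<open>x - a\<close> times a unit: divide by \<open>x - a\<close>
    as long as \<open>g\<close> is not a unit.\<close>
  have factor: "\<exists>k e. unit e \<and> g = \<pi> ^ k * e" if "g \<in> O_P" "g' \<in> O_P" "unit e0" "g * g' = \<pi> ^ n * e0" for n g g' e0
    using that
  proof (induction n arbitrary: g)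
    case 0
    have "g \<notin> m_P"
    proof
      assume "g \<in> m_P"
      then have "g * g' \<in> m_P" using 0 m_closed(3) by blast
      then show False using 0 unit_notin by simp
    qed
    then have "unit g" using O_unit[OF 0(1)] 0(1) by (simp add: unit_def)
    then show ?case by (intro exI[of _ 0] exI[of _ g]) simp
  next
    case (Suc n)
    show ?case
    proof (cases "g \<in> m_P")
      case False
      then have "unit g" using O_unit[OF Suc.prems(1)] Suc.prems(1) by (simp add: unit_def)
      then show ?thesis by (intro exI[of _ 0] exI[of _ g]) simp
    next
      case True
      then obtain g1 where g1: "g1 \<in> O_P" "g = \<pi> * g1" using principal by blast
      have "\<pi> * (g1 * g') = \<pi> * (\<pi> ^ n * e0)" using Suc.prems(4) unfolding g1(2) by (simp add: mult.assoc)
      then have "g1 * g' = \<pi> ^ n * e0" using \<pi>0 by simp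
      then obtain k e where "unit e" "g1 = \<pi> ^ k * e" using Suc.IH[OF g1(1) Suc.prems(2,3)] by blast
      then show ?thesis by (intro exI[of _ "Suc k"] exI[of _ e]) (simp add: g1(2) mult.assoc)
    qed
  qed
  have ev_factor: "\<exists>k e. unit e \<and> ev p = \<pi> ^ k * e" if p: "ev p \<noteq> 0" for p
  proof -
    have red0: "red (norm_poly p) \<noteq> 0" using p by (simp add: red_norm_poly_eq_0_iff)
    obtain q where q: "red (norm_poly p) = [:-a, 1:] ^ order a (red (norm_poly p)) * q" "\<not> [:-a, 1:] dvd q"
      using order_decomp[OF red0] by blast
    have qa: "poly q a \<noteq> 0" using q(2) by (simp add: poly_eq_0_iff_dvd)
    then have "q \<noteq> 0" by auto
    have "ev [:q:] / ev 1 \<in> O_P" by (rule O_I') (simp add: eval2_simps)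
    moreover have "ev 1 / ev [:q:] \<in> O_P" by (rule O_I') (simp add: qa)
    ultimately have u: "unit (x_fun q)" using \<open>q \<noteq> 0\<close> by (simp add: unit_def divide_inverse)
    have "ev p * ev (conorm_poly p) = x_fun (red (norm_poly p))"
      by (metis ev_norm_poly norm_poly_split ev_simps(4))
    also have "\<dots> = \<pi> ^ order a (red (norm_poly p)) * x_fun q"
      by (subst q(1)) (simp only: x_fun_simps \<pi>_def)
    finally have eq: "ev p * ev (conorm_poly p) = \<pi> ^ order a (red (norm_poly p)) * x_fun q" .
    have "ev p' / ev 1 \<in> O_P" for p' by (rule O_I') (simp add: eval2_simps)
    then have "ev p' \<in> O_P" for p' by simp
    then show ?thesis using factor[OF _ _ u eq] by blast
  qed
  have valuation: "h \<in> O_P \<or> h \<noteq> 0 \<and> inverse h \<in> m_P" if h: "h \<in> K" for h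
  proof -
    obtain p r where pr: "h = ev p / ev r" "ev r \<noteq> 0" using h by (rule K_E)
    show ?thesis
    proof (cases "ev p = 0")
      case True
      then show ?thesis using pr by simp
    next
      case False
      obtain k e where k: "unit e" "ev p = \<pi> ^ k * e" using ev_factor[OF False] by blast
      obtain l e' where l: "unit e'" "ev r = \<pi> ^ l * e'" using ev_factor[OF pr(2)] by blast
      have nz: "e \<noteq> 0" "e' \<noteq> 0" using k l by (auto simp: unit_def)
      have \<pi>O: "\<pi> ^ i \<in> O_P" for i using \<pi>m m_subset_O O_power by blast
      show ?thesis
      proof (cases "l \<le> k")
        case True
        then have "\<pi> ^ k = \<pi> ^ (k - l) * \<pi> ^ l" by (simp flip: power_add)
        then have "h = \<pi> ^ (k - l) * (e * inverse e')"
          unfolding pr(1) k(2) l(2) using \<pi>0 nz by (simp add: divide_inverse)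
        then show ?thesis using \<pi>O k(1) l(1) O_closed(2) by (simp add: unit_def)
      next
        case False
        then have "\<pi> ^ l = \<pi> * \<pi> ^ (l - k - 1) * \<pi> ^ k" by (simp flip: power_add power_Suc)
        then have "inverse h = \<pi> * (\<pi> ^ (l - k - 1) * (e' * inverse e))"
          unfolding pr(1) k(2) l(2) using \<pi>0 nz by (simp add: divide_inverse mult_ac)
        moreover have "\<pi> * (\<pi> ^ (l - k - 1) * (e' * inverse e)) \<in> m_P"
          using m_closed(3)[OF \<pi>m] \<pi>O k(1) l(1) O_closed(2) by (simp add: unit_def)
        moreover have "h \<noteq> 0" using pr \<open>ev p \<noteq> 0\<close> by simp
        ultimately show ?thesis by simp
      qed
    qed
  qed
  have "h \<in> O_P" if h: "h \<in> R_P" for h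
  proof (rule ccontr)
    assume "h \<notin> O_P"
    obtain q where q: "h \<in> K" "lead_coeff q = 1" "\<forall>i. coeff q i \<in> O_P" "poly q h = 0" using h by (rule R_E)
    define u where "u = inverse h"
    have u: "h \<noteq> 0" "u \<in> m_P" using valuation[OF q(1)] \<open>h \<notin> O_P\<close> by (auto simp: u_def)
    have hu: "h * u = 1" using u(1) by (simp add: u_def)
    define n where "n = degree q"
    have "(\<Sum>i\<le>n. coeff q i * u ^ (n - i)) = (\<Sum>i\<le>n. coeff q i * h ^ i * u ^ n)"
    proof (rule sum.cong)
      fix i assume "i \<in> {..n}"
      then have "u ^ n = u ^ i * u ^ (n - i)" by (simp flip: power_add)
      then have "h ^ i * u ^ n = (h * u) ^ i * u ^ (n - i)" by (simp add: power_mult_distrib)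
      then show "coeff q i * u ^ (n - i) = coeff q i * h ^ i * u ^ n" using hu by (simp add: mult.assoc)
    qed simp
    also have "\<dots> = poly q h * u ^ n" by (simp add: poly_altdef n_def sum_distrib_right)
    finally have "(\<Sum>i\<le>n. coeff q i * u ^ (n - i)) = 0" using q(4) by simp
    moreover have "(\<Sum>i\<le>n. coeff q i * u ^ (n - i)) = coeff q n + (\<Sum>i<n. coeff q i * u ^ (n - i))"
      by (simp add: lessThan_Suc_atMost[symmetric] add.commute)
    moreover have "coeff q n = 1" using q(2) by (simp add: n_def)
    ultimately have one: "(\<Sum>i<n. coeff q i * u ^ (n - i)) * (- 1) = 1" by (simp add: neg_eq_iff_add_eq_0 add.commute)
    have "(\<Sum>i<n. coeff q i * u ^ (n - i)) \<in> m_P"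
    proof (rule m_sum)
      fix i assume "i \<in> {..<n}"
      then have "u ^ (n - i) = u * u ^ (n - i - 1)" by (intro power_pred) simp
      then have "coeff q i * u ^ (n - i) = u * (u ^ (n - i - 1) * coeff q i)" by (simp only: mult_ac)
      moreover have "u ^ (n - i - 1) * coeff q i \<in> O_P"
        using u(2) m_subset_O O_power O_closed(2) q(3) by blast
      ultimately show "coeff q i * u ^ (n - i) \<in> m_P" using m_closed(3)[OF u(2)] by (simp only:)
    qed
    then have "(\<Sum>i<n. coeff q i * u ^ (n - i)) * (- 1) \<in> m_P" by (rule m_closed(3)[OF _ O_closed(3)[OF O_1]])
    then show False unfolding one using one_notin_m by simp
  qed
  then show ?thesis using O_subset_R by blast
qed

end

section \<open>The action on the points of the smooth model\<close>

text \<open>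
  The curve is totally ramified over every root of \<open>f\<close> and over infinity.
\<close>
locale ramified_curve = kummer d f for d and f :: "'k::{finite,field} poly" +
  assumes root_order: "poly F a = 0 \<Longrightarrow> coprime d (order a F)"
    and degree_coprime: "coprime d (degree F)" and degree_neq: "degree F \<noteq> d"
begin

definition m_at :: "'k alg_closure \<Rightarrow> 'k alg_closure \<Rightarrow> 'k ambient set" where
  "m_at a b = local_point.m_P d f (\<lambda>N p. eval2 p a b)"

definition pt :: "'k alg_closure \<times> 'k alg_closure \<Rightarrow> 'k curve_point" where
  "pt = (\<lambda>(a, b). (affine_point a b, m_at a b))"

definition unramified_pairs :: "('k alg_closure \<times> 'k alg_closure) set" where
  "unramified_pairs = {(a, b). b ^ d = poly F a \<and> b \<noteq> 0}"

text \<open>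
  The points above the roots of \<open>f\<close> and above infinity.
\<close>
definition ramified_points :: "'k curve_point set" where
  "ramified_points = smooth_model d f - pt ` unramified_pairs"

lemma smooth_model_iff:
  "(P, M) \<in> smooth_model d f \<longleftrightarrow>
     P \<in> proj_closure d f \<and> maximalideal M (subring_of (integral_closure (local_ring d f P) K))"
  by (simp add: smooth_model_def)

lemma (in local_point) integral_closure_eq: "integral_closure (local_ring d f P) K = R_P"
  by (simp add: R_P_def local_ring_eq)

lemma smooth_model_affine:
  assumes "b ^ d = poly F a" "b \<noteq> 0"
  shows "(affine_point a b, M) \<in> smooth_model d f \<longleftrightarrow> M = m_at a b"
proof -
  interpret local_point d f "affine_point a b" "\<lambda>N p. eval2 p a b" by (rule affine_local_point[OF assms(1)])
  show ?thesis
    unfolding smooth_model_iff integral_closure_eq maximalideal_iff_normal[OF unramified_point_normal[OF assms]]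
    by (simp add: affine_point_mem_iff assms m_at_def)
qed

lemma pt_mem: "s \<in> unramified_pairs \<Longrightarrow> pt s \<in> smooth_model d f"
  using smooth_model_affine by (auto simp: unramified_pairs_def pt_def)

lemma inj_pt: "inj pt"
  by (auto simp: inj_def pt_def affine_point_eq_iff)

definition special_points :: "('k alg_closure \<times> 'k alg_closure \<times> 'k alg_closure) set set" where
  "special_points = insert x_infinity (insert y_infinity ((\<lambda>a. affine_point a 0) ` {a. poly F a = 0}))"

lemma finite_special_points: "finite special_points"
  unfolding special_points_def using poly_roots_finite[OF F0] by simp

lemma ramified_points_cases:
  assumes "(P, M) \<in> ramified_points"
  shows "P \<in> special_points \<and> (\<exists>H ord. ramified_point d f P H ord)"
proof -
  have PM: "(P, M) \<in> smooth_model d f" "(P, M) \<notin> pt ` unramified_pairs" using assms by (auto simp: ramified_points_def)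
  then have "P \<in> proj_closure d f" by (simp add: smooth_model_iff)
  from this degree_neq show ?thesis
  proof (cases rule: proj_closure_cases)
    case (1 a b)
    have "b = 0"
    proof (rule ccontr)
      assume b: "b \<noteq> 0"
      then have "M = m_at a b" using PM(1) smooth_model_affine[OF 1(2)] 1(1) by simp
      then have "(P, M) = pt (a, b)" "(a, b) \<in> unramified_pairs" using 1 b by (auto simp: pt_def unramified_pairs_def)
      then show False using PM(2) by blast
    qed
    then have root: "poly F a = 0" using 1(2) d_pos by (simp add: power_0_left)
    show ?thesis
      using ramified_affine_point[OF root root_order[OF root]] root unfolding 1(1) \<open>b = 0\<close> special_points_def by blast
  next
    case 2
    then show ?thesis
      using ramified_y_infinity degree_coprime unfolding special_points_def by (metis coprime_int_iff insertCI)
  next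
    case 3
    then show ?thesis
      using ramified_x_infinity degree_coprime unfolding special_points_def by (metis coprime_int_iff insertCI)
  qed
qed

lemma ramified_points_unique:
  assumes "(P, M) \<in> ramified_points" "(P, M') \<in> ramified_points"
  shows "M = M'"
proof -
  obtain H ord where "ramified_point d f P H ord" using ramified_points_cases[OF assms(1)] by blast
  then interpret ramified_point d f P H ord .
  have "maximalideal M (subring_of R_P)" "maximalideal M' (subring_of R_P)"
    using assms by (auto simp: ramified_points_def smooth_model_iff integral_closure_eq)
  then show ?thesis using maximal_eq by blast
qed

lemma finite_ramified_points: "finite ramified_points"
proof (rule inj_on_finite)
  show "inj_on fst ramified_points"
  proof (rule inj_onI)
    fix x y assume "x \<in> ramified_points" "y \<in> ramified_points" "fst x = fst y"
    then show "x = y" by (metis ramified_points_unique prod.collapse)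
  qed
  show "fst ` ramified_points \<subseteq> special_points" using ramified_points_cases by auto
qed (rule finite_special_points)

lemma mu_act_eq:
  assumes "\<xi> \<in> roots_of_unity d"
  shows "mu_act d f \<xi> (P, M) = ((\<lambda>(u, v, w). (u, to_ac \<xi> * v, w)) ` P, {h \<in> K. sg (to_ac \<xi>) h \<in> M})"
proof -
  have z: "to_ac \<xi> \<in> U" using assms U_eq by blast
  have "{ev p / ev r | p r. ev r \<noteq> 0 \<and> ev (twist (to_ac \<xi>) p) / ev (twist (to_ac \<xi>) r) \<in> M} = {h \<in> K. sg (to_ac \<xi>) h \<in> M}"
    (is "?L = ?R")
  proof (intro equalityI subsetI)
    fix h assume "h \<in> ?L"
    then obtain p r where "h = ev p / ev r" "ev r \<noteq> 0" "ev (twist (to_ac \<xi>) p) / ev (twist (to_ac \<xi>) r) \<in> M" by blast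
    then show "h \<in> ?R" using sg_frac[OF z, of r p] K_I[of r p] by simp
  next
    fix h assume h: "h \<in> ?R"
    then obtain p r where pr: "h = ev p / ev r" "ev r \<noteq> 0" by (metis (no_types, lifting) K_E mem_Collect_eq)
    then have "ev (twist (to_ac \<xi>) p) / ev (twist (to_ac \<xi>) r) \<in> M" using h sg_frac[OF z, of r p] by simp
    then show "h \<in> ?L" using pr by blast
  qed
  then show ?thesis
    unfolding mu_act_def ev_twist by (simp add: Let_def ev_def y_def x_fun_def)
qed

lemma mu_act_special:
  assumes z: "z \<noteq> 0" and P: "P \<in> special_points"
  shows "(\<lambda>(u, v, w). (u, z * v, w)) ` P = P"
proof -
  have 1: "(\<lambda>(u, v, w). (u, z * v, w)) ` y_infinity = y_infinity"
  proof (intro equalityI subsetI)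
    fix x assume "x \<in> (\<lambda>(u, v, w). (u, z * v, w)) ` y_infinity"
    then obtain s where "x = (0, z * s, 0)" "s \<noteq> 0" by (auto simp: y_infinity_def)
    then show "x \<in> y_infinity" using z by (auto simp: y_infinity_def)
  next
    fix x :: "'k alg_closure \<times> 'k alg_closure \<times> 'k alg_closure" assume "x \<in> y_infinity"
    then obtain s where s: "x = (0, s, 0)" "s \<noteq> 0" by (auto simp: y_infinity_def)
    then have "(0, s / z, 0) \<in> y_infinity" using z by (auto simp: y_infinity_def)
    moreover have "x = (\<lambda>(u, v, w). (u, z * v, w)) (0, s / z, 0)" using s z by simp
    ultimately show "x \<in> (\<lambda>(u, v, w). (u, z * v, w)) ` y_infinity" by blast
  qed
  have 2: "(\<lambda>(u, v, w). (u, z * v, w)) ` x_infinity = x_infinity"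
    by (force simp: x_infinity_def image_iff)
  have 3: "(\<lambda>(u, v, w). (u, z * v, w)) ` affine_point a 0 = affine_point a 0" for a
    by (force simp: affine_point_def image_iff)
  show ?thesis using P unfolding special_points_def by (elim insertE imageE) (simp_all only: 1 2 3)
qed

text \<open>
  The action fixes the underlying point of the closure, where \<open>y\<close> or all other coordinates vanish,
  and the maximal ideal, which is described by Galois invariant data.
\<close>
lemma mu_act_ramified_points:
  assumes "\<xi> \<in> roots_of_unity d" "x \<in> ramified_points"
  shows "mu_act d f \<xi> x = x"
proof -
  obtain P M where x: "x = (P, M)" by (cases x)
  have z: "to_ac \<xi> \<in> U" using assms U_eq by blast
  obtain H ord where H: "P \<in> special_points" "ramified_point d f P H ord" using ramified_points_cases assms(2) unfolding x by blast
  interpret ramified_point d f P H ord by (rule H(2))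
  have "maximalideal M (subring_of R_P)"
    using assms(2) by (auto simp: x ramified_points_def smooth_model_iff integral_closure_eq)
  then show ?thesis
    unfolding x mu_act_eq[OF assms(1)] using maximal_sg_stable[OF _ z] mu_act_special[OF U_simps(4)[OF z] H(1)] by simp
qed

lemma affine_m_E:
  assumes "b ^ d = poly F a" "h \<in> m_at a b"
  obtains p r where "h = ev p / ev r" "eval2 p a b = 0" "eval2 r a b \<noteq> 0" "ev r \<noteq> 0"
proof -
  interpret local_point d f "affine_point a b" "\<lambda>N p. eval2 p a b" by (rule affine_local_point[OF assms(1)])
  show thesis using assms(2) that unfolding m_at_def by (elim m_E) blast
qed

lemma affine_m_I:
  assumes "b ^ d = poly F a" "eval2 p a b = 0" "eval2 r a b \<noteq> 0"
  shows "ev p / ev r \<in> m_at a b" "ev r \<noteq> 0"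
proof -
  interpret local_point d f "affine_point a b" "\<lambda>N p. eval2 p a b" by (rule affine_local_point[OF assms(1)])
  obtain N where N: "total_degree_le p N" "total_degree_le r N" using common_total_degree by blast
  show "ev p / ev r \<in> m_at a b" unfolding m_at_def by (rule m_I[OF N assms(2,3)])
  show "ev r \<noteq> 0" by (rule H_nonzero[OF N(2) assms(3)])
qed

lemma sg_m_at:
  assumes w: "w \<in> U" and ab: "b ^ d = poly F a" and g: "g \<in> m_at a (w * b)"
  shows "sg w g \<in> m_at a b"
proof -
  have wb: "(w * b) ^ d = poly F a" using ab U_simps(5)[OF w] by (simp add: power_mult_distrib)
  obtain p r where pr: "g = ev p / ev r" "eval2 p a (w * b) = 0" "eval2 r a (w * b) \<noteq> 0" "ev r \<noteq> 0"
    using wb g by (rule affine_m_E)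
  show ?thesis unfolding pr(1) sg_frac[OF w pr(4)]
    by (rule affine_m_I(1)[OF ab]) (use pr in \<open>simp_all add: eval2_twist\<close>)
qed

lemma m_at_subset_K: "b ^ d = poly F a \<Longrightarrow> m_at a b \<subseteq> K"
proof
  fix h assume "b ^ d = poly F a" "h \<in> m_at a b"
  then show "h \<in> K" by (rule affine_m_E) (simp add: K_I)
qed

lemma mu_act_pt:
  assumes \<xi>: "\<xi> \<in> roots_of_unity d" and s: "(a, b) \<in> unramified_pairs"
  shows "mu_act d f \<xi> (pt (a, b)) = pt (a, to_ac \<xi> * b)"
proof -
  define z where "z = to_ac \<xi>"
  have z: "z \<in> U" using \<xi> U_eq unfolding z_def by blast
  have z0: "z \<noteq> 0" using U_simps(4)[OF z] .
  have ab: "b ^ d = poly F a" using s by (simp add: unramified_pairs_def)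
  have zb: "(z * b) ^ d = poly F a" using ab U_simps(5)[OF z] by (simp add: power_mult_distrib)
  have 1: "(\<lambda>(u, v, w). (u, z * v, w)) ` affine_point a b = affine_point a (z * b)"
    by (force simp: affine_point_def image_iff mult.left_commute)
  have 2: "{h \<in> K. sg z h \<in> m_at a b} = m_at a (z * b)"
  proof (intro equalityI subsetI)
    fix h assume h: "h \<in> {h \<in> K. sg z h \<in> m_at a b}"
    have "sg z h \<in> m_at a (inverse z * (z * b))" using h z0 by (simp flip: mult.assoc)
    then have "sg (inverse z) (sg z h) \<in> m_at a (z * b)" by (rule sg_m_at[OF U_simps(3)[OF z] zb])
    then show "h \<in> m_at a (z * b)" using h sg_inverse_inverse[OF z] by simp
  next
    fix h assume h: "h \<in> m_at a (z * b)"
    then show "h \<in> {h \<in> K. sg z h \<in> m_at a b}" using sg_m_at[OF z ab] m_at_subset_K[OF zb] by blast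
  qed
  show ?thesis unfolding pt_def prod.case mu_act_eq[OF \<xi>] z_def[symmetric] 1 2 ..
qed

text \<open>
  This induces the automorphism of the function field that raises constants to the \<open>q\<close>-th power and
  fixes \<open>x\<close> and \<open>y\<close>; it is well defined because the equation of the curve has
  coefficients in the base field.
\<close>
definition fro :: "'k alg_closure poly poly \<Rightarrow> 'k alg_closure poly poly" where
  "fro = frob_coeffs CARD('k)"

lemma ring_map_fro: "ring_map fro"
  unfolding fro_def frob_coeffs_def by (rule ring_map_map_poly[OF ring_map_map_poly[OF ring_map_frobenius]])

lemma eval2_fro: "eval2 (fro p) (a ^ CARD('k)) (b ^ CARD('k)) = eval2 p a b ^ CARD('k)"
proof -
  let ?f = "\<lambda>x :: 'k alg_closure. x ^ CARD('k)"
  have "[:b ^ CARD('k):] = map_poly ?f [:b:]" by (simp add: map_poly_pCons)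
  then have "poly (fro p) [:b ^ CARD('k):] = map_poly ?f (poly p [:b:])"
    unfolding fro_def frob_coeffs_def by (simp add: poly_ring_map[OF ring_map_map_poly[OF ring_map_frobenius]])
  then show ?thesis unfolding eval2_def by (simp add: poly_ring_map[OF ring_map_frobenius])
qed

lemma fro_surj: "\<exists>p'. p = fro p'"
proof -
  define rt where "rt z = (SOME w :: 'k alg_closure. w ^ CARD('k) = z)" for z
  have rt: "rt z ^ CARD('k) = z" for z
    unfolding rt_def by (rule someI_ex) (rule nth_root_exists, simp)
  have "rt 0 = 0" using rt[of 0] by simp
  then have "p = fro (map_poly (map_poly rt) p)"
    by (intro poly_eqI) (simp add: fro_def frob_coeffs_def coeff_map_poly rt power_0_left)
  then show ?thesis by blast
qed

lemma fro_curve: "fro curve = curve"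
proof (rule poly_eqI)
  fix i
  have "map_poly (\<lambda>x. x ^ CARD('k)) F = F" unfolding F_def by (rule map_poly_to_ac_fixed)
  moreover note ring_mapD[OF ring_map_map_poly[OF ring_map_frobenius[where 'k = 'k]]]
  ultimately show "coeff (fro curve) i = coeff curve i"
    by (auto simp: fro_def frob_coeffs_def coeff_map_poly coeff_curve)
qed

lemma ev_fro_eq_0: "ev p = 0 \<Longrightarrow> ev (fro p) = 0"
proof -
  assume "ev p = 0"
  then obtain p' where p': "p = curve * p'" by (auto simp: ev_eq_0_iff)
  show ?thesis unfolding p' ring_mapD(4)[OF ring_map_fro] fro_curve by (simp add: ev_curve)
qed

lemma poly_F_frobenius: "poly F (a ^ CARD('k)) = poly F a ^ CARD('k)"
  using poly_ring_map[OF ring_map_frobenius, of F a] map_poly_to_ac_fixed[of f] by (simp add: F_def)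

lemma unramified_pairs_frobenius: "(a, b) \<in> unramified_pairs \<Longrightarrow> (a ^ CARD('k), b ^ CARD('k)) \<in> unramified_pairs"
  by (simp add: unramified_pairs_def poly_F_frobenius) (metis power_mult mult.commute)

lemma frobenius_pt:
  assumes s: "(a, b) \<in> unramified_pairs"
  shows "frobenius d f (pt (a, b)) = pt (a ^ CARD('k), b ^ CARD('k))"
proof -
  have ab: "b ^ d = poly F a" using s by (simp add: unramified_pairs_def)
  have abq: "(b ^ CARD('k)) ^ d = poly F (a ^ CARD('k))" using unramified_pairs_frobenius[OF s] by (simp add: unramified_pairs_def)
  have 1: "(\<lambda>(u, v, w). (u ^ CARD('k), v ^ CARD('k), w ^ CARD('k))) ` affine_point a b = affine_point (a ^ CARD('k)) (b ^ CARD('k))"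
  proof (intro equalityI subsetI)
    fix x assume "x \<in> (\<lambda>(u, v, w). (u ^ CARD('k), v ^ CARD('k), w ^ CARD('k))) ` affine_point a b"
    then obtain s where "x = ((s * a) ^ CARD('k), (s * b) ^ CARD('k), s ^ CARD('k))" "s \<noteq> 0" by (auto simp: affine_point_def)
    then have "x = (s ^ CARD('k) * a ^ CARD('k), s ^ CARD('k) * b ^ CARD('k), s ^ CARD('k))" "s ^ CARD('k) \<noteq> 0" by (simp_all add: power_mult_distrib)
    then show "x \<in> affine_point (a ^ CARD('k)) (b ^ CARD('k))" unfolding affine_point_def by blast
  next
    fix x assume "x \<in> affine_point (a ^ CARD('k)) (b ^ CARD('k))"
    then obtain t where t: "x = (t * a ^ CARD('k), t * b ^ CARD('k), t)" "t \<noteq> 0" unfolding affine_point_def by blast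
    obtain s where s: "s ^ CARD('k) = t" using nth_root_exists[of "CARD('k)" t] by auto
    then have "s \<noteq> 0" using t(2) by (auto simp: power_0_left)
    then have "(s * a, s * b, s) \<in> affine_point a b" unfolding affine_point_def by blast
    moreover have "x = (\<lambda>(u, v, w). (u ^ CARD('k), v ^ CARD('k), w ^ CARD('k))) (s * a, s * b, s)" using t s by (simp add: power_mult_distrib)
    ultimately show "x \<in> (\<lambda>(u, v, w). (u ^ CARD('k), v ^ CARD('k), w ^ CARD('k))) ` affine_point a b" by blast
  qed
  have 2: "{ev (fro p) / ev (fro r) | p r. ev r \<noteq> 0 \<and> ev p / ev r \<in> m_at a b} = m_at (a ^ CARD('k)) (b ^ CARD('k))"
    (is "?L = ?R")
  proof (intro equalityI subsetI)
    fix h assume "h \<in> ?L"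
    then obtain p r where h: "h = ev (fro p) / ev (fro r)" "ev r \<noteq> 0" "ev p / ev r \<in> m_at a b" by blast
    obtain p' r' where pr: "ev p / ev r = ev p' / ev r'" "eval2 p' a b = 0" "eval2 r' a b \<noteq> 0" "ev r' \<noteq> 0"
      using ab h(3) by (rule affine_m_E)
    have mem: "ev (fro p') / ev (fro r') \<in> ?R" "ev (fro r') \<noteq> 0"
      using affine_m_I[OF abq, of "fro p'" "fro r'"] pr(2,3) by (simp_all add: eval2_fro)
    show "h \<in> ?R"
    proof (cases "ev (fro r) = 0")
      case True
      have "ev 0 / ev 1 \<in> ?R" by (rule affine_m_I(1)[OF abq]) (simp_all add: eval2_simps)
      then show ?thesis using h(1) True by simp
    next
      case False
      have "ev (p * r' - p' * r) = 0" using pr(1,4) h(2) by (simp add: frac_eq_eq)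
      then have "ev (fro (p * r' - p' * r)) = 0" by (rule ev_fro_eq_0)
      then have "ev (fro p) * ev (fro r') = ev (fro p') * ev (fro r)"
        by (simp add: ring_mapD[OF ring_map_fro])
      then have "h = ev (fro p') / ev (fro r')" unfolding h(1) using False mem(2) by (simp add: frac_eq_eq)
      then show ?thesis using mem(1) by simp
    qed
  next
    fix h assume "h \<in> ?R"
    with abq obtain p r where pr: "h = ev p / ev r" "eval2 p (a ^ CARD('k)) (b ^ CARD('k)) = 0" "eval2 r (a ^ CARD('k)) (b ^ CARD('k)) \<noteq> 0" "ev r \<noteq> 0"
      by (rule affine_m_E)
    obtain p' r' where p': "p = fro p'" "r = fro r'" using fro_surj by metis
    have "eval2 p' a b = 0" "eval2 r' a b \<noteq> 0" using pr(2,3) unfolding p' eval2_fro by (auto simp: power_0_left)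
    then have "ev p' / ev r' \<in> m_at a b" "ev r' \<noteq> 0" by (rule affine_m_I[OF ab])+
    then show "h \<in> ?L" unfolding pr(1) p' by blast
  qed
  show ?thesis
    unfolding pt_def prod.case frobenius_def Let_def using 1 2 by (simp add: ev_def y_def fro_def)
qed

lemma frobenius_power_pt:
  assumes "(a, b) \<in> unramified_pairs"
  shows "(frobenius d f ^^ r) (pt (a, b)) = pt (a ^ CARD('k) ^ r, b ^ CARD('k) ^ r) \<and> (a ^ CARD('k) ^ r, b ^ CARD('k) ^ r) \<in> unramified_pairs"
proof (induction r)
  case (Suc r)
  have e: "(x ^ CARD('k) ^ r) ^ CARD('k) = x ^ CARD('k) ^ Suc r" for x :: "'k alg_closure" by (simp add: mult.commute flip: power_mult)
  show ?case using Suc frobenius_pt[of "a ^ CARD('k) ^ r" "b ^ CARD('k) ^ r"] unramified_pairs_frobenius[of "a ^ CARD('k) ^ r" "b ^ CARD('k) ^ r"] by (simp add: e del: power_Suc)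
qed (use assms in simp)


section \<open>Counting points\<close>

lemma card_gt_1: "CARD('k) > 1"
proof -
  have "card {0, 1 :: 'k} \<le> CARD('k)" by (intro card_mono) auto
  then show ?thesis by simp
qed

lemma sum_powers_nat: "1 \<le> (n::nat) \<Longrightarrow> (\<Sum>i<r. n ^ i) * (n - 1) = n ^ r - 1"
proof -
  assume "1 \<le> n"
  then obtain k where k: "n = Suc k" by (cases n) auto
  have "(\<Sum>i<r. n ^ i) * k + 1 = n ^ r" by (induction r) (simp_all add: k algebra_simps)
  then show ?thesis using k by simp
qed

lemma d_dvd_power: "d dvd CARD('k) ^ r - 1"
  using sum_powers_nat[of "CARD('k)" r] d_dvd card_gt_1 by (metis dvd_mult less_imp_le)

definition exponent :: "nat \<Rightarrow> nat" where "exponent r = (CARD('k) ^ r - 1) div d"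

lemma exponent: "d * exponent r + 1 = CARD('k) ^ r"
proof -
  have "CARD('k) ^ r > 0" using card_gt_1 by simp
  then show ?thesis unfolding exponent_def using d_dvd_power[of r] by simp
qed

text \<open>
  The root of unity by which the \<open>r\<close>-th power of the Frobenius moves the fibre over a fixed point
  \<open>a\<close>: for \<open>b ^ d = F a\<close> it sends \<open>b\<close> to
  \<open>b ^ q ^ r = (b ^ d) ^ ((q ^ r - 1) / d) * b\<close>.
\<close>
definition fixed_class :: "nat \<Rightarrow> 'k alg_closure \<Rightarrow> 'k" where
  "fixed_class r a = of_ac (poly F a ^ exponent r)"

lemma poly_F_frobenius_power: "poly F (a ^ CARD('k) ^ r) = poly F a ^ CARD('k) ^ r"
proof (induction r)
  case (Suc r)
  have e: "(x ^ CARD('k) ^ r) ^ CARD('k) = x ^ CARD('k) ^ Suc r" for x :: "'k alg_closure" by (simp add: mult.commute flip: power_mult)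
  show ?case using poly_F_frobenius[of "a ^ CARD('k) ^ r"] Suc by (simp add: e del: power_Suc)
qed simp

lemma fixed_class:
  assumes a: "a ^ CARD('k) ^ r = a" and nz: "poly F a \<noteq> 0"
  shows "to_ac (fixed_class r a) = poly F a ^ exponent r" "fixed_class r a \<in> roots_of_unity d"
proof -
  have "poly F a ^ CARD('k) ^ r = poly F a" using poly_F_frobenius_power[of a r] a by simp
  then have "poly F a ^ (d * exponent r) * poly F a = 1 * poly F a"
    unfolding exponent[symmetric] by simp
  then have "(poly F a ^ exponent r) ^ d = 1" using nz by (simp add: mult.commute flip: power_mult)
  then obtain \<xi> where \<xi>: "\<xi> \<in> roots_of_unity d" "poly F a ^ exponent r = to_ac \<xi>"
    using power_dvd_card_in_range[OF d_dvd] by blast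
  then have "fixed_class r a = \<xi>" by (simp add: fixed_class_def)
  then show "to_ac (fixed_class r a) = poly F a ^ exponent r" "fixed_class r a \<in> roots_of_unity d" using \<xi> by simp_all
qed

text \<open>
  A ramified point fixed by the \<open>r\<close>-th power of the Frobenius is counted for every
  \<open>\<xi>\<close>, so that these points contribute a multiple of
  \<open>\<Sum>\<xi>. \<theta> \<xi> = 0\<close>. Over a fixed \<open>a\<close> that is not a root of
  \<open>f\<close> there are \<open>d\<close> points, each counted for the single
  \<open>\<xi> = fixed_class r a\<close>; the number \<open>d\<close> cancels against the order of the group.
\<close>
theorem N_count_eq:
  fixes \<theta> :: "'k \<Rightarrow> 'e::field_char_0"
  assumes r: "r > 0" and \<theta>: "(\<Sum>\<xi>\<in>roots_of_unity d. \<theta> \<xi>) = 0"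
  shows "N_count (smooth_model d f) (frobenius d f) (roots_of_unity d) (mu_act d f) \<theta> r =
    (\<Sum>a | a ^ CARD('k) ^ r = a. if poly F a = 0 then 0 else \<theta> (fixed_class r a))"
proof -
  let ?\<mu> = "roots_of_unity d :: 'k set"
  define Xs where "Xs = {a :: 'k alg_closure. a ^ CARD('k) ^ r = a \<and> poly F a \<noteq> 0}"
  have finFix: "finite {a :: 'k alg_closure. a ^ CARD('k) ^ r = a}" using finite_frobenius_fixed[OF r] .
  then have finX: "finite Xs" unfolding Xs_def by simp
  define Y where "Y a = {b. b ^ d = poly F a}" for a
  have cardY: "card (Y a) = d" if "a \<in> Xs" for a
    unfolding Y_def using that by (intro card_power_roots[OF d_nonzero]) (simp add: Xs_def)
  have finY: "finite (Y a)" if "a \<in> Xs" for a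
    using cardY[OF that] d_pos by (intro card_ge_0_finite) simp
  define T where "T = (SIGMA a:Xs. Y a)"
  have finT: "finite T" unfolding T_def using finX finY by blast
  have T_alt: "T = {(a, b) \<in> unramified_pairs. a ^ CARD('k) ^ r = a}"
    unfolding T_def Xs_def Y_def unramified_pairs_def using d_pos by (auto simp: power_0_left)
  have act: "(frobenius d f ^^ r) (pt (a, b)) = mu_act d f \<xi> (pt (a, b)) \<longleftrightarrow> a ^ CARD('k) ^ r = a \<and> b ^ CARD('k) ^ r = to_ac \<xi> * b"
    if "\<xi> \<in> ?\<mu>" "(a, b) \<in> unramified_pairs" for \<xi> a b
    using frobenius_power_pt[OF that(2), of r] mu_act_pt[OF that] inj_pt by (simp add: inj_eq)
  have cls: "b ^ CARD('k) ^ r = to_ac \<xi> * b \<longleftrightarrow> \<xi> = fixed_class r a" if "(a, b) \<in> T" "\<xi> \<in> ?\<mu>" for a b \<xi>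
  proof -
    have ab: "a ^ CARD('k) ^ r = a" "b ^ d = poly F a" "b \<noteq> 0" using that by (auto simp: T_alt unramified_pairs_def)
    then have nz: "poly F a \<noteq> 0" using d_pos by (metis power_eq_0_iff)
    have "b ^ CARD('k) ^ r = (b ^ d) ^ exponent r * b" unfolding exponent[symmetric] by (simp add: power_mult)
    also have "\<dots> = to_ac (fixed_class r a) * b" using fixed_class(1)[OF ab(1) nz] ab(2) by simp
    finally show ?thesis using ab(3) by auto
  qed
  define fixed_ramified where "fixed_ramified = card {x \<in> ramified_points. (frobenius d f ^^ r) x = x}"
  have count: "card {x \<in> smooth_model d f. (frobenius d f ^^ r) x = mu_act d f \<xi> x}
      = card {s \<in> T. \<xi> = fixed_class r (fst s)} + fixed_ramified" if \<xi>: "\<xi> \<in> ?\<mu>" for \<xi>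
  proof -
    have "{x \<in> smooth_model d f. (frobenius d f ^^ r) x = mu_act d f \<xi> x}
        = pt ` {s \<in> T. \<xi> = fixed_class r (fst s)} \<union> {x \<in> ramified_points. (frobenius d f ^^ r) x = x}" (is "?L = ?A \<union> ?C")
    proof (intro equalityI subsetI)
      fix x assume x: "x \<in> ?L"
      show "x \<in> ?A \<union> ?C"
      proof (cases "x \<in> ramified_points")
        case True
        then show ?thesis using x mu_act_ramified_points[OF \<xi> True] by simp
      next
        case False
        then obtain a b where ab: "(a, b) \<in> unramified_pairs" "x = pt (a, b)" using x by (auto simp: ramified_points_def)
        then have 1: "a ^ CARD('k) ^ r = a" "b ^ CARD('k) ^ r = to_ac \<xi> * b" using act[OF \<xi> ab(1)] x by auto
        then have "(a, b) \<in> T" using ab(1) by (simp add: T_alt)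
        then show ?thesis using cls[OF _ \<xi>] 1(2) ab(2) by auto
      qed
    next
      fix x assume "x \<in> ?A \<union> ?C"
      then show "x \<in> ?L"
      proof
        assume "x \<in> ?C"
        then show ?thesis using mu_act_ramified_points[OF \<xi>] by (auto simp: ramified_points_def)
      next
        assume "x \<in> ?A"
        then obtain a b where ab: "(a, b) \<in> T" "\<xi> = fixed_class r a" "x = pt (a, b)" by auto
        then have "(a, b) \<in> unramified_pairs" "a ^ CARD('k) ^ r = a" by (auto simp: T_alt)
        then show ?thesis using act[OF \<xi>] cls[OF ab(1) \<xi>] ab pt_mem by auto
      qed
    qed
    moreover have "?A \<inter> ?C = {}" by (auto simp: ramified_points_def T_alt)
    moreover have "finite ?A" using finT by simp
    moreover have "finite ?C" using finite_ramified_points by simp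
    ultimately have "card ?L = card ?A + card ?C" by (simp add: card_Un_disjoint)
    also have "card ?A = card {s \<in> T. \<xi> = fixed_class r (fst s)}"
      by (rule card_image) (rule inj_on_subset[OF inj_pt], simp)
    finally show ?thesis by (simp add: fixed_ramified_def)
  qed
  have fin\<mu>: "finite ?\<mu>" by simp
  have "(\<Sum>\<xi>\<in>?\<mu>. \<theta> \<xi> * of_nat (card {x \<in> smooth_model d f. (frobenius d f ^^ r) x = mu_act d f \<xi> x}))
      = (\<Sum>\<xi>\<in>?\<mu>. \<theta> \<xi> * of_nat (card {s \<in> T. \<xi> = fixed_class r (fst s)}) + \<theta> \<xi> * of_nat fixed_ramified)"
    by (rule sum.cong) (simp_all add: count distrib_left)
  also have "\<dots> = (\<Sum>\<xi>\<in>?\<mu>. \<theta> \<xi> * of_nat (card {s \<in> T. \<xi> = fixed_class r (fst s)}))"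
    using \<theta> by (simp add: sum.distrib flip: sum_distrib_right)
  also have "\<dots> = (\<Sum>\<xi>\<in>?\<mu>. \<Sum>s\<in>T. if \<xi> = fixed_class r (fst s) then \<theta> \<xi> else 0)"
  proof (rule sum.cong)
    fix \<xi> :: 'k
    have "(\<Sum>s\<in>T. if \<xi> = fixed_class r (fst s) then \<theta> \<xi> else 0) = (\<Sum>s\<in>{s \<in> T. \<xi> = fixed_class r (fst s)}. \<theta> \<xi>)"
      by (rule sum.inter_filter[OF finT, symmetric])
    also have "\<dots> = of_nat (card {s \<in> T. \<xi> = fixed_class r (fst s)}) * \<theta> \<xi>" by (rule sum_constant)
    finally show "\<theta> \<xi> * of_nat (card {s \<in> T. \<xi> = fixed_class r (fst s)})
        = (\<Sum>s\<in>T. if \<xi> = fixed_class r (fst s) then \<theta> \<xi> else 0)" by (simp only: mult.commute)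
  qed simp
  also have "\<dots> = (\<Sum>s\<in>T. \<Sum>\<xi>\<in>?\<mu>. if \<xi> = fixed_class r (fst s) then \<theta> \<xi> else 0)" by (rule sum.swap)
  also have "\<dots> = (\<Sum>s\<in>T. \<theta> (fixed_class r (fst s)))"
  proof (rule sum.cong)
    fix s assume "s \<in> T"
    then have "fixed_class r (fst s) \<in> ?\<mu>" by (auto simp: T_def Xs_def fixed_class(2))
    then show "(\<Sum>\<xi>\<in>?\<mu>. if \<xi> = fixed_class r (fst s) then \<theta> \<xi> else 0) = \<theta> (fixed_class r (fst s))"
      using fin\<mu> by simp
  qed simp
  also have "\<dots> = (\<Sum>a\<in>Xs. \<Sum>b\<in>Y a. \<theta> (fixed_class r a))"
    unfolding T_def using finX finY by (subst sum.Sigma) (auto simp: case_prod_beta)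
  also have "\<dots> = of_nat d * (\<Sum>a\<in>Xs. \<theta> (fixed_class r a))"
    using cardY by (simp add: sum_distrib_left)
  also have "(\<Sum>a\<in>Xs. \<theta> (fixed_class r a)) = (\<Sum>a | a ^ CARD('k) ^ r = a. if poly F a = 0 then 0 else \<theta> (fixed_class r a))"
    by (rule sum.mono_neutral_cong_left[OF finFix]) (auto simp: Xs_def)
  finally show ?thesis
    using d_pos by (simp add: N_count_def card_roots_of_unity[OF d_dvd])
qed

end

section \<open>Curves that are ramified over rational points\<close>

lemma order_linear_factor:
  fixes u a x :: "'a::field"
  assumes "u \<noteq> 0"
  shows "order x (smult u [:a, - 1:]) = (if x = a then 1 else 0)"
proof -
  have "smult u [:a, - 1:] = smult (- u) [:- a, 1:]" by simp
  then have "order x (smult u [:a, - 1:]) = order x [:- a, 1:]"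
    using assms order_smult[of "- u" x "[:- a, 1:]"] by simp
  also have "\<dots> = (if x = a then 1 else 0)"
    using order_power_n_n[of a 1] order_0I[of "[:- a, 1:]" x] by auto
  finally show ?thesis .
qed

lemma order_split_poly:
  fixes u \<alpha> :: "nat \<Rightarrow> 'a::field" and e :: "nat \<Rightarrow> nat"
  assumes "finite J" "\<And>j. j \<in> J \<Longrightarrow> u j \<noteq> 0"
  shows "order x (\<Prod>j\<in>J. smult (u j) [:\<alpha> j, - 1:] ^ e j) = (\<Sum>j | j \<in> J \<and> \<alpha> j = x. e j)"
    and "(\<Prod>j\<in>J. smult (u j) [:\<alpha> j, - 1:] ^ e j) \<noteq> 0"
    and "degree (\<Prod>j\<in>J. smult (u j) [:\<alpha> j, - 1:] ^ e j) = (\<Sum>j\<in>J. e j)"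
proof -
  have nz: "smult (u j) [:\<alpha> j, - 1:] ^ e j \<noteq> 0" if "j \<in> J" for j using assms(2)[OF that] by simp
  then show 0: "(\<Prod>j\<in>J. smult (u j) [:\<alpha> j, - 1:] ^ e j) \<noteq> 0" using assms(1) by simp
  have op: "order x (p ^ n) = n * order x p" if "p \<noteq> 0" for p :: "'a poly" and n
    by (induction n) (use that in \<open>auto simp: order_mult\<close>)
  have "order x (\<Prod>j\<in>J. smult (u j) [:\<alpha> j, - 1:] ^ e j) = (\<Sum>j\<in>J. if \<alpha> j = x then e j else 0)"
    using assms nz
  proof (induction J rule: finite_induct)
    case (insert j J)
    have "order x (smult (u j) [:\<alpha> j, - 1:] ^ e j) = (if \<alpha> j = x then e j else 0)"
      using insert.prems(1)[of j] op[of "smult (u j) [:\<alpha> j, - 1:]"] order_linear_factor[of "u j" x "\<alpha> j"] by auto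
    moreover have "order x (\<Prod>j\<in>insert j J. smult (u j) [:\<alpha> j, - 1:] ^ e j)
        = order x (smult (u j) [:\<alpha> j, - 1:] ^ e j) + order x (\<Prod>j\<in>J. smult (u j) [:\<alpha> j, - 1:] ^ e j)"
      unfolding prod.insert[OF insert.hyps] by (rule order_mult) (use insert in auto)
    ultimately show ?case using insert by simp
  qed simp
  also have "\<dots> = (\<Sum>j | j \<in> J \<and> \<alpha> j = x. e j)"
    using sum.inter_filter[OF assms(1), of e "\<lambda>j. \<alpha> j = x"] by simp
  finally show "order x (\<Prod>j\<in>J. smult (u j) [:\<alpha> j, - 1:] ^ e j) = (\<Sum>j | j \<in> J \<and> \<alpha> j = x. e j)" .
  show "degree (\<Prod>j\<in>J. smult (u j) [:\<alpha> j, - 1:] ^ e j) = (\<Sum>j\<in>J. e j)"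
    using assms nz by (subst degree_prod_eq_sum_degree) (auto simp: degree_power_eq intro!: sum.cong)
qed

text \<open>
  The theorem for \<open>f\<close> given by its linear factors \<open>u j * (\<alpha> j - x)\<close>. Let
  \<open>a\<close> be fixed by the \<open>r\<close>-th power of the Frobenius. Evaluating its orbit polynomial
  at \<open>\<alpha> j\<close> shows that the value of the completely multiplicative function
  \<open>\<Psi>\<close> at this polynomial is the residue character of the norm of \<open>f a\<close>, which is
  \<open>\<theta> (fixed_class r a)\<close>. Therefore the counts \<open>N_r\<close> are the orbit sums of
  \<open>\<Psi>\<close>, and the coefficients of the L-series are the sums of \<open>\<Psi>\<close> over monic
  polynomials. The assumption that \<open>0\<close> is a root serves to make \<open>Y ^ d - f\<close>
  irreducible.
\<close>
theorem curve_L_split: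
  fixes \<alpha> u :: "nat \<Rightarrow> 'k::{finite,field}" and \<phi> :: "'k \<Rightarrow> rat alg_closure" and m :: int
  defines "f s e \<equiv> (\<Prod>j<s. smult (u j) [:\<alpha> j, - 1:] ^ e j)"
  assumes \<phi>: "generates_characters \<phi>" and d: "d > 0" "d dvd CARD('k) - 1" and m: "\<not> int d dvd m"
    and u: "\<And>j. j < s \<Longrightarrow> u j \<noteq> 0" and \<alpha>: "inj_on \<alpha> {..<s}" and j0: "j0 < s" "\<alpha> j0 = 0"
    and e: "\<And>j. j < s \<Longrightarrow> coprime d (e j)" "\<And>j. j < s \<Longrightarrow> e j > 0"
    and tot: "coprime d (\<Sum>j<s. e j)" "(\<Sum>j<s. e j) \<noteq> d"
  shows "\<exists>p. curve_L d (f s e) (\<lambda>\<xi>. \<phi> \<xi> powi m) = fps_of_poly p \<and> degree p = s - 1"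
proof -
  define f' where "f' = f s e"
  have s: "s > 0" using j0 by simp
  have f'0: "f' \<noteq> 0" unfolding f'_def f_def using u by (intro order_split_poly(2)) auto
  have ord_f: "coprime d (order (\<alpha> j) f')" if "j < s" for j
  proof -
    have "{i. i \<in> {..<s} \<and> \<alpha> i = \<alpha> j} = {j}" using \<alpha> that by (auto simp: inj_on_def)
    then have "order (\<alpha> j) f' = e j"
      unfolding f'_def f_def using u by (subst order_split_poly(1)) auto
    then show ?thesis using e(1)[OF that] by simp
  qed
  interpret kummer d f'
    by unfold_locales (use d f'0 ord_f[OF j0(1)] j0(2) in simp_all)
  have F_prod: "F = (\<Prod>j<s. smult (to_ac (u j)) [:to_ac (\<alpha> j), - 1:] ^ e j)"
  proof -
    have "F = map_poly to_ac (\<Prod>j<s. smult (u j) [:\<alpha> j, - 1:] ^ e j)"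
      unfolding F_def by (simp only: f'_def f_def)
    also have "\<dots> = (\<Prod>j<s. map_poly to_ac (smult (u j) [:\<alpha> j, - 1:]) ^ e j)"
      by (simp only: ring_map_prod[OF ring_map_map_poly[OF ring_map_to_ac]] ring_mapD(7)[OF ring_map_map_poly[OF ring_map_to_ac]])
    finally show ?thesis by (simp add: map_poly_pCons)
  qed
  have poly_F: "poly F a = (\<Prod>j<s. (to_ac (u j) * (to_ac (\<alpha> j) - a)) ^ e j)" for a
    unfolding F_prod poly_prod by (simp add: algebra_simps)
  have degF: "degree F = (\<Sum>j<s. e j)"
    unfolding F_prod using u by (intro order_split_poly(3)) auto
  have curve: "ramified_curve d f'"
  proof unfold_locales
    show "coprime d (order a F)" if "poly F a = 0" for a
    proof -
      from that obtain j where j: "j < s" "a = to_ac (\<alpha> j)"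
        unfolding poly_F using u by (auto simp: prod_zero_iff)
      have "order (to_ac (\<alpha> j)) F = order (\<alpha> j) f'"
        unfolding F_def by (rule order_map_poly[OF ring_map_to_ac f'0])
      then show ?thesis using ord_f j by simp
    qed
  qed (use tot in \<open>simp_all add: degF\<close>)
  then interpret ramified_curve d f' .
  define \<theta> where "\<theta> \<xi> = \<phi> \<xi> powi m" for \<xi>
  define \<eta> where "\<eta> j x = residue_char \<phi> d m x ^ e j" for j x
  define \<Psi> where "\<Psi> = point_char \<eta> u \<alpha> s"
  have rc: "mult_char (residue_char \<phi> d m)" by (rule mult_char_residue_char[OF \<phi> d(2,1) m])
  have \<eta>: "mult_char (\<eta> j)" "\<exists>z. z \<noteq> 0 \<and> \<eta> j z \<noteq> 1" if "j < s" for j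
  proof -
    show "mult_char (\<eta> j)" unfolding \<eta>_def by (rule mult_char_pow[OF rc e(2)[OF that]])
    show "\<exists>z. z \<noteq> 0 \<and> \<eta> j z \<noteq> 1"
      unfolding \<eta>_def by (rule residue_char_nontrivial[OF \<phi> d(2,1) m e(1)[OF that]])
  qed
  obtain z where z: "z \<noteq> 0" "residue_char \<phi> d m z ^ (\<Sum>j<s. e j) \<noteq> 1"
    using residue_char_nontrivial[OF \<phi> d(2,1) m tot(1)] by blast
  then have z': "(\<Prod>j<s. \<eta> j z) \<noteq> 1" by (simp add: \<eta>_def power_sum)
  have orbit: "\<Psi> (orbit_poly r a) = (if poly F a = 0 then 0 else \<theta> (fixed_class r a))"
    if a: "a ^ CARD('k) ^ r = a" and r: "r > 0" for r a
  proof -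
    \<comment> \<open>Its image under \<open>to_ac\<close> is the norm of \<open>F a\<close> from the field with
      \<open>q ^ r\<close> elements.\<close>
    define W where "W = (\<Prod>j<s. (u j ^ r * poly (orbit_poly r a) (\<alpha> j)) ^ e j)"
    have deg: "degree (orbit_poly r a) = r" using orbit_poly_monic[OF a] by (simp add: monics_def)
    have ev: "to_ac (poly (orbit_poly r a) x) = (\<Prod>i<r. to_ac x - a ^ CARD('k) ^ i)" for x
    proof -
      have "to_ac (poly (orbit_poly r a) x) = poly (orbit_factors r a) (to_ac x)"
        using poly_ring_map[OF ring_map_to_ac, of "orbit_poly r a" x] map_poly_orbit_poly[OF a] by simp
      then show ?thesis by (simp add: orbit_factors_def poly_prod)
    qed
    have "to_ac W = (\<Prod>j<s. (to_ac (u j) ^ r * (\<Prod>i<r. to_ac (\<alpha> j) - a ^ CARD('k) ^ i)) ^ e j)"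
      unfolding W_def to_ac_prod by (simp add: ev)
    also have "\<dots> = (\<Prod>j<s. (\<Prod>i<r. (to_ac (u j) * (to_ac (\<alpha> j) - a ^ CARD('k) ^ i)) ^ e j))"
      by (simp add: prod.distrib flip: prod_power_distrib)
    also have "\<dots> = (\<Prod>i<r. (\<Prod>j<s. (to_ac (u j) * (to_ac (\<alpha> j) - a ^ CARD('k) ^ i)) ^ e j))"
      by (rule prod.swap)
    also have "\<dots> = (\<Prod>i<r. poly F a ^ CARD('k) ^ i)"
      by (rule prod.cong) (simp_all add: poly_F[symmetric] poly_F_frobenius_power)
    finally have W: "to_ac W = poly F a ^ (\<Sum>i<r. CARD('k) ^ i)" by (simp add: power_sum)
    have "\<Psi> (orbit_poly r a) = (\<Prod>j<s. residue_char \<phi> d m ((u j ^ r * poly (orbit_poly r a) (\<alpha> j)) ^ e j))"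
      unfolding \<Psi>_def point_char_def \<eta>_def deg by (simp add: mult_char_power[OF rc])
    also have "\<dots> = residue_char \<phi> d m W"
      unfolding W_def by (rule mult_char_prod[OF rc, symmetric])
    finally have 1: "\<Psi> (orbit_poly r a) = residue_char \<phi> d m W" .
    show ?thesis
    proof (cases "poly F a = 0")
      case True
      have "(\<Sum>i<r. CARD('k) ^ i) > 0" using card_gt_1 r by (intro sum_pos2[of _ 0]) auto
      then have "to_ac W = 0" unfolding W True by (rule zero_power)
      then show ?thesis using True 1 by (simp add: residue_char_def)
    next
      case False
      then have "to_ac W \<noteq> 0" unfolding W by simp
      then have W0: "W \<noteq> 0" by simp
      \<comment> \<open>The exponents agree:
        \<open>(1 + q + ... + q ^ (r - 1)) * (q - 1) / d = (q ^ r - 1) / d\<close>.\<close>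
      have ex: "(\<Sum>i<r. CARD('k) ^ i) * ((CARD('k) - 1) div d) = exponent r"
      proof -
        have "d * ((\<Sum>i<r. CARD('k) ^ i) * ((CARD('k) - 1) div d)) = (\<Sum>i<r. CARD('k) ^ i) * (CARD('k) - 1)"
          using d(2) by (simp add: mult.left_commute)
        also have "\<dots> = CARD('k) ^ r - 1"
          using sum_powers_nat[of "CARD('k)" r] card_gt_1 by simp
        also have "\<dots> = d * exponent r" using exponent[of r] by linarith
        finally show ?thesis using d(1) by simp
      qed
      have "to_ac (W ^ ((CARD('k) - 1) div d)) = to_ac (fixed_class r a)"
        by (simp only: fixed_class(1)[OF a False] W ex to_ac_power power_mult[symmetric])
      then have "W ^ ((CARD('k) - 1) div d) = fixed_class r a" by (simp only: to_ac_eq_iff)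
      then show ?thesis using False W0 1 by (simp add: residue_char_def \<theta>_def)
    qed
  qed
  define c where "c = monic_sum \<Psi>"
  have N: "N_count (smooth_model d f') (frobenius d f') (roots_of_unity d) (mu_act d f') \<theta> r = orbit_sum \<Psi> r"
    if "r > 0" for r
  proof -
    have "(\<Sum>\<xi>\<in>roots_of_unity d. \<theta> \<xi>) = 0"
      unfolding \<theta>_def by (rule sum_character_roots_of_unity[OF \<phi> d(2,1) m])
    then have "N_count (smooth_model d f') (frobenius d f') (roots_of_unity d) (mu_act d f') \<theta> r
        = (\<Sum>a | a ^ CARD('k) ^ r = a. if poly F a = 0 then 0 else \<theta> (fixed_class r a))"
      by (rule N_count_eq[OF that])
    also have "\<dots> = orbit_sum \<Psi> r"
      unfolding orbit_sum_def by (rule sum.cong) (use orbit[OF _ that] in simp_all)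
    finally show ?thesis .
  qed
  have "monics 0 = {1 :: 'k poly}"
    by (auto simp: monics_def elim!: degree_eq_zeroE)
  then have "c 0 = 1" using \<eta>(1) by (simp add: c_def monic_sum_def \<Psi>_def point_char_def mult_char_def)
  moreover have "of_nat n * c n = (\<Sum>r=1..n. orbit_sum \<Psi> r * c (n - r))" for n
    unfolding c_def by (rule monic_sum_recurrence) (unfold \<Psi>_def, rule point_char_mult, use \<eta>(1) in auto)
  ultimately have L: "fps_compose (fps_exp 1) (Abs_fps (\<lambda>r. if r = 0 then 0 else orbit_sum \<Psi> r / of_nat r)) = Abs_fps c"
    by (rule exp_eq_fps_of_recurrence)
  have "(\<lambda>r. if r = 0 then 0 else N_count (smooth_model d f') (frobenius d f') (roots_of_unity d) (mu_act d f') \<theta> r / of_nat r)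
      = (\<lambda>r. if r = 0 then 0 else orbit_sum \<Psi> r / of_nat r)"
    using N by (auto simp: fun_eq_iff)
  then have curve_L: "curve_L d f' \<theta> = Abs_fps c"
    unfolding curve_L_def L_series_def using L by simp
  obtain z0 where z0: "z0 \<noteq> 0" "\<eta> 0 z0 \<noteq> 1" using \<eta>(2)[OF s] by blast
  have vanish: "c n = 0" if "n \<ge> s" for n
    unfolding c_def \<Psi>_def by (rule monic_sum_point_char_eq_0[where \<eta> = \<eta> and z = z0 and u = u and \<alpha> = \<alpha> and s = s, OF \<eta>(1)[OF s] z0 \<alpha> u[OF s] s that])
  have top: "c (s - 1) \<noteq> 0"
    unfolding c_def \<Psi>_def by (rule monic_sum_point_char_nonzero[OF \<eta> z(1) z' \<alpha> u s])
  define p where "p = (\<Sum>i<s. monom (c i) i)"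
  have cp: "coeff p i = c i" for i
    using vanish[of i] by (cases "i < s") (simp_all add: p_def coeff_sum)
  have "fps_of_poly p = Abs_fps c" by (simp add: fps_eq_iff cp)
  moreover have "degree p = s - 1"
  proof (rule antisym)
    show "degree p \<le> s - 1" by (rule degree_le) (use vanish in \<open>auto simp: cp\<close>)
    show "s - 1 \<le> degree p" by (rule le_degree) (use top in \<open>simp only: cp not_False_eq_True\<close>)
  qed
  ultimately show ?thesis using curve_L unfolding f'_def \<theta>_def[abs_def] by (intro exI[of _ p]) simp
qed

theorem theorem4p7:
  fixes d a c n :: nat and b :: "nat \<Rightarrow> nat"
    and lam :: "nat \<Rightarrow> 'k::{finite,field}"
    and e :: int and m :: int
    and \<phi> :: "'k \<Rightarrow> rat alg_closure"
  assumes "generates_characters \<phi>"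
    and "d > 0" and "a > 0" and "c > 0" and "\<And>i. i \<in> {1..n} \<Longrightarrow> b i > 0"
    and "d dvd CARD('k) - 1"
    and "\<And>i. i \<in> {1..n} \<Longrightarrow> lam i \<noteq> 0 \<and> lam i \<noteq> 1"
    and "inj_on lam {1..n}"
    and "e = \<bar>int a + (\<Sum>i = 1..n. int (b i)) + int c - int d\<bar>"
    and "e > 0"
    and "gcd d a = 1" and "\<And>i. i \<in> {1..n} \<Longrightarrow> gcd d (b i) = 1" and "gcd d c = 1"
    and "gcd (int d) e = 1"
    and "\<not> int d dvd m"
  shows "\<exists>p. curve_L d (rhs_poly n lam b a c) (\<lambda>\<xi>. \<phi> \<xi> powi m) = fps_of_poly p
             \<and> Polynomial.degree p = n + 1"
proof -
  \<comment> \<open>The factors are \<open>1 - \<lambda> * x = \<lambda> * (inverse \<lambda> - x)\<close>,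
    \<open>x = - 1 * (0 - x)\<close> and \<open>1 - x = 1 * (1 - x)\<close>, indexed by \<open>j < n\<close>,
    \<open>j = n\<close> and \<open>j = n + 1\<close>.\<close>
  define \<alpha> where "\<alpha> j = (if j < n then inverse (lam (Suc j)) else if j = n then 0 else 1)" for j
  define u where "u j = (if j < n then lam (Suc j) else if j = n then - 1 else 1)" for j
  define k where "k j = (if j < n then b (Suc j) else if j = n then a else c)" for j
  let ?s = "Suc (Suc n)"
  have lam: "lam (Suc j) \<noteq> 0" "lam (Suc j) \<noteq> 1" if "j < n" for j using assms(7)[of "Suc j"] that by auto
  have shift: "(\<Sum>i = 1..n. h i) = (\<Sum>j<n. h (Suc j))" for h :: "nat \<Rightarrow> nat"
    by (rule sum.reindex_bij_witness[where i = Suc and j = "\<lambda>i. i - 1"]) auto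
  have f: "(\<Prod>j<?s. smult (u j) [:\<alpha> j, - 1:] ^ k j) = rhs_poly n lam b a c"
  proof -
    have "(\<Prod>j<n. smult (u j) [:\<alpha> j, - 1:] ^ k j) = (\<Prod>j<n. [:1, - lam (Suc j):] ^ b (Suc j))"
      by (rule prod.cong) (use lam in \<open>auto simp: u_def \<alpha>_def k_def\<close>)
    also have "\<dots> = (\<Prod>i = 1..n. [:1, - lam i:] ^ b i)"
      by (rule prod.reindex_bij_witness[where j = Suc and i = "\<lambda>i. i - 1"]) auto
    finally show ?thesis by (simp add: rhs_poly_def u_def \<alpha>_def k_def)
  qed
  have tot: "(\<Sum>j<?s. k j) = a + (\<Sum>i = 1..n. b i) + c"
    unfolding shift by (simp add: k_def)
  have e: "e = \<bar>int (\<Sum>j<?s. k j) - int d\<bar>" unfolding tot assms(9) by simp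
  \<comment> \<open>Modulo \<open>d\<close>, the number \<open>e\<close> is the degree of the right hand side up
    to sign.\<close>
  have "gcd (int d) (int (\<Sum>j<?s. k j) - int d) = 1"
    using assms(14) unfolding e by simp
  then have cop: "coprime d (\<Sum>j<?s. k j)"
    by (metis coprime_iff_gcd_eq_1 coprime_int_iff gcd_diff2 gcd.commute gcd_diff1)
  have inj: "inj_on \<alpha> {..<?s}"
  proof (rule inj_onI)
    fix i j assume ij: "i \<in> {..<?s}" "j \<in> {..<?s}" "\<alpha> i = \<alpha> j"
    have lj: "lam (Suc i) = lam (Suc j) \<Longrightarrow> i = j" if "i < n" "j < n"
      using inj_onD[OF assms(8), of "Suc i" "Suc j"] that by simp
    show "i = j"
      using ij lam[of i] lam[of j] lj by (auto simp: \<alpha>_def split: if_splits)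
  qed
  have "\<exists>p. curve_L d (\<Prod>j<?s. smult (u j) [:\<alpha> j, - 1:] ^ k j) (\<lambda>\<xi>. \<phi> \<xi> powi m) = fps_of_poly p \<and> degree p = ?s - 1"
  proof (rule curve_L_split[OF assms(1,2,6,15) _ inj])
    show "u j \<noteq> 0" if "j < ?s" for j using lam by (auto simp: u_def)
    show "n < ?s" "\<alpha> n = 0" by (simp_all add: \<alpha>_def)
    show "coprime d (k j)" if "j < ?s" for j
      using assms(11,12,13) that by (auto simp: k_def coprime_iff_gcd_eq_1)
    show "k j > 0" if "j < ?s" for j using assms(3,4,5) that by (auto simp: k_def)
    show "coprime d (\<Sum>j<?s. k j)" by (rule cop)
    show "(\<Sum>j<?s. k j) \<noteq> d" using assms(10) unfolding e by auto
  qed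
  then show ?thesis unfolding f by simp
qed

end
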